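(* Fix $R_1>0$ and a threshold $\phi_s>0$. In the model described in the context, the monostatic sensing coverage probability $\mathcal P_M(R_1)=\mathbb P(\mathrm{SINR}_M>\phi_s)$ for a target at distance $R_1$ from its serving base station is $$\mathcal P_M(R_1)=\mathcal C\cdot \mathcal L_{IC}\!\left(\frac{\phi_s R_1^{\eta_L}}{\sigma_{\mathrm{av}_t}}\right)\cdot \exp\!\left(-\frac{\phi_s(4\pi)^3R_1^{2\eta_L}K_BTW_b}{P_sG_m^2\lambda^2\sigma_{\mathrm{av}_t}}\right)\cdot \mathcal L_{D}\!\left(\frac{\phi_s(4\pi)^3R_1^{2\eta_L}}{P_sG_m^2\lambda^2\sigma_{\mathrm{av}_t}}\right)\cdot \exp\!\left(-\frac{\phi_s(4\pi)^3R_1^{2\eta_L}P_c\zeta}{P_sG_m^2\lambda^2\sigma_{\mathrm{av}_t}}\right),$$ where $$\mathcal C=\exp\!\left(-\lambda_{cl}\frac{c\,\theta_BR_1}{2W_b}\cdot\frac{\phi_s\sigma_{\mathrm{av}_{cl}}}{\sigma_{\mathrm{av}_t}+\phi_s\sigma_{\mathrm{av}_{cl}}}\right),$$ $$\mathcal L_{IC}(s)=\int_{R_1}^\infty\!\int_0^\pi \exp\!\left(-\frac{2\pi\lambda_{BS}}{M}\int_{R_{IC}}^\infty p_{LOS}(r)\Big(1-\frac{1}{1+s\cos(\beta/2)r^{-\eta_L}\sigma_{\mathrm{av}_t}}\Big)r\,dr\right)$$ $$\times\exp\!\left(-\frac{\lambda_{BS}}{M}\int_{R_{IC}}^\infty p_{LOS}(r)\Big(1-\exp\Big(-\lambda_{cl}\frac{c\theta_BR_1}{2W_b}\frac{s\cos(\beta/2)r^{-\eta_L}\sigma_{\mathrm{av}_{cl}}}{1+s\cos(\beta/2)r^{-\eta_L}\sigma_{\mathrm{av}_{cl}}}\Big)\Big)2\pi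 r\,dr\right)2\lambda_{BS}R_{IC}e^{-\lambda_{BS}\pi(R_{IC}^2-R_1^2)}\,d\beta\,dR_{IC},$$ $$\mathcal L_D(s)=\int_0^\infty\exp\!\left(-\frac{2\pi\lambda_{BS}}{M^2}\int_{R_d}^\infty p_{LOS}(r)\Big(1-\Big(1+\frac{sP_cG_m^2C_Lr^{-\eta_L}}{m_L}\Big)^{-m_L}\Big)r\,dr\right)$$ $$\times\exp\!\left(-\frac{2\pi\lambda_{BS}}{M^2}\int_{R_d}^\infty (1-p_{LOS}(r))\Big(1-\Big(1+\frac{sP_cG_m^2C_Nr^{-\eta_N}}{m_N}\Big)^{-m_N}\Big)r\,dr\right)2\pi\lambda_{BS}R_de^{-\pi\lambda_{BS}R_d^2}\,dR_d .$$
   Context: Parameters: $\lambda_{BS},\lambda_{cl},P_s,P_c,G_m,C_L,C_N,\eta_L,\eta_N,m_L,m_N,c,\theta_B,W_b,K_B,T,\lambda,\gamma,\sigma_{\mathrm{av}_t},\sigma_{\mathrm{av}_{cl}}>0$, $\zeta\ge0$, $M$ a positive integer; $p_{LOS}(r)=e^{-\gamma r}$; convention $\exp(-\infty)=0$. PPP means Poisson point process. Target radar cross-section: $\sigma_{tm}$ is exponential with mean $\sigma_{\mathrm{av}_t}$. Intra-clutter: the scatterers form a homogeneous PPP $\Phi_{cl}$ on $\mathbb R^2$ of intensity $\lambda_{cl}$; $A_{rm}$ is a fixed region (the monostatic resolution cell) of area $\frac{c\theta_BR_1}{2W_b}$; each scatterer carries an independent exponential cross-section $\sigma_{cm}$ of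 mean $\sigma_{\mathrm{av}_{cl}}$; $S=\sum_{cl\in\Phi_{cl}\cap A_{rm}}\sigma_{cm}$. Inter-clutter: $R_{IC}$ has density $2\pi\lambda_{BS}R_{IC}e^{-\lambda_{BS}\pi(R_{IC}^2-R_1^2)}$ on $[R_1,\infty)$ and $\beta$ is independent and uniform on $[0,\pi]$. Given $(R_{IC},\beta)$, the interfering base stations (those whose beam points to the target with a line-of-sight path) form a PPP on $\{x\in\mathbb R^2:|x|>R_{IC}\}$ of intensity $p_{LOS}(|x|)\lambda_{BS}/M$, and, with $R_n$ the distance $|x|$ of the $n$-th interferer from the target, $I_{IC1}=\sum_n\cos(\beta/2)R_n^{-\eta_L}\sigma_{tm,n}$ and $I_{IC2}=\sum_n\cos(\beta/2)R_n^{-\eta_L}S_n$, where the $\sigma_{tm,n}$ are i.i.d. copies of $\sigma_{tm}$ and the $S_n$ are i.i.d. copies of $S$. (The same $\beta$ is used for all interferers; bistatic cross-sections are monostatic ones times $\cos(\beta/2)$.) $I_{IC1}$ and $I_{IC2}$ are treated as independent given $(R_{IC},\beta)$. Direct interference: $R_d$ has density $2\pi\lambda_{BS}R_de^{-\pi\lambda_{BS}R_d^2}$ on $[0,\infty)$. Given $R_d$, $\Phi_{L_s}$ and $\Phi_{N_s}$ are independent PPPs on $\{|x|>R_d\}$ of intensities $p_{LOS}(|x|)\lambda_{BS}/M^2$ and $(1-p_{LOS}(|x|))\lambda_{BS}/M^2$; $I_{L_s}=\sum_{x_i\in\Phi_{L_s}}P_ch_{L,i}G_m^2C_L|x_i|^{-\eta_L}$,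 $I_{N_s}=\sum_{x_i\in\Phi_{N_s}}P_ch_{N,i}G_m^2C_N|x_i|^{-\eta_N}$, where the fading gains $h_{L,i}$ (resp. $h_{N,i}$) are i.i.d. Gamma with shape $m_L$ (resp. $m_N$) and mean $1$, independent of everything else. Independence: $\sigma_{tm}$, $S$, $(I_{IC1},I_{IC2})$ and $(I_{L_s},I_{N_s})$ are mutually independent. Monostatic SINR (with $\kappa=P_sG_m^2\lambda^2/(4\pi)^3$): $$\mathrm{SINR}_M=\frac{\kappa\,\sigma_{tm}R_1^{-2\eta_L}}{\kappa R_1^{-2\eta_L}S+\kappa R_1^{-\eta_L}(I_{IC1}+I_{IC2})+K_BTW_b+I_{L_s}+I_{N_s}+P_c\zeta}.$$ *)

theory Defs
  imports "HOL-Probability.Probability"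
begin

section \<open>Poisson point processes\<close>

text \<open>
  A point process on a space \<open>'a\<close> is given by an enumeration of its points: a random number
  \<open>N\<close> of points (possibly infinite) and random points \<open>X 0, X 1, \<dots>\<close>, of which only the
  \<open>X i\<close> with \<open>i < N\<close> belong to the process; the order of the enumeration carries no meaning.
  Sums over the process are taken in \<open>[0,\<infinity>]\<close>, since they may diverge.
\<close>

definition point_sum :: "enat \<Rightarrow> (nat \<Rightarrow> ennreal) \<Rightarrow> ennreal" where
  "point_sum n f = (\<Sum>i. if enat i < n then f i else 0)"

definition point_count ::
    "('w \<Rightarrow> enat) \<Rightarrow> (nat \<Rightarrow> 'w \<Rightarrow> 'a) \<Rightarrow> 'a set \<Rightarrow> 'w \<Rightarrow> ennreal" where
  "point_count N X B \<omega> = point_sum (N \<omega>) (\<lambda>i. indicator B (X i \<omega>))"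

text \<open>Rate \<open>0\<close> is allowed (it gives the point mass at \<open>0\<close>), unlike in \<^const>\<open>poisson_pmf\<close>.\<close>

definition poisson_mass :: "real \<Rightarrow> nat \<Rightarrow> real" where
  "poisson_mass \<mu> k = \<mu> ^ k / fact k * exp (- \<mu>)"

definition cond_prob_sub :: "'w measure \<Rightarrow> 'w measure \<Rightarrow> 'w set \<Rightarrow> 'w \<Rightarrow> real" where
  "cond_prob_sub P F E = real_cond_exp P F (indicator E)"

text \<open>
  The counts of finitely many disjoint bounded Borel sets are independent Poisson variables whose
  means are given by the intensity measure (which is meant to be finite on bounded sets).
\<close>

definition poisson_process ::
    "'w measure \<Rightarrow> ('w \<Rightarrow> enat) \<Rightarrow> (nat \<Rightarrow> 'w \<Rightarrow> 'a::metric_space) \<Rightarrow> 'a measure \<Rightarrow> bool" where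
  "poisson_process P N X \<Lambda> \<longleftrightarrow>
     N \<in> measurable P (count_space UNIV) \<and> (\<forall>i. X i \<in> borel_measurable P) \<and>
     (\<forall>(n::nat) B k. (\<forall>j<n. B j \<in> sets borel \<and> bounded (B j)) \<and> disjoint_family_on B {..<n} \<longrightarrow>
        measure P {\<omega> \<in> space P. \<forall>j<n. point_count N X (B j) \<omega> = of_nat (k j)}
          = (\<Prod>j<n. poisson_mass (measure \<Lambda> (B j)) (k j)))"

text \<open>
  Conditionally on the sub-\<open>\<sigma>\<close>-algebra \<open>F\<close>, the process is Poisson with the random intensity
  measure \<open>\<Lambda> \<omega>\<close>.
\<close>

definition cond_poisson_process ::
    "'w measure \<Rightarrow> 'w measure \<Rightarrow> ('w \<Rightarrow> enat) \<Rightarrow> (nat \<Rightarrow> 'w \<Rightarrow> 'a::metric_space) \<Rightarrow>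
      ('w \<Rightarrow> 'a measure) \<Rightarrow> bool" where
  "cond_poisson_process P F N X \<Lambda> \<longleftrightarrow>
     N \<in> measurable P (count_space UNIV) \<and> (\<forall>i. X i \<in> borel_measurable P) \<and>
     (\<forall>(n::nat) B k. (\<forall>j<n. B j \<in> sets borel \<and> bounded (B j)) \<and> disjoint_family_on B {..<n} \<longrightarrow>
        (AE \<omega> in P.
          cond_prob_sub P F {\<omega> \<in> space P. \<forall>j<n. point_count N X (B j) \<omega> = of_nat (k j)} \<omega>
            = (\<Prod>j<n. poisson_mass (measure (\<Lambda> \<omega>) (B j)) (k j))))"


section \<open>Independence and conditional independence\<close>

abbreviation events_of :: "'w measure \<Rightarrow> 'b measure \<Rightarrow> ('w \<Rightarrow> 'b) \<Rightarrow> 'w set set" where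
  "events_of P K Y \<equiv> sets (vimage_algebra (space P) Y K)"

text \<open>The events generated by the counts, hence not depending on the enumeration of the points.\<close>

definition process_events ::
    "'w measure \<Rightarrow> ('w \<Rightarrow> enat) \<Rightarrow> (nat \<Rightarrow> 'w \<Rightarrow> 'a::topological_space) \<Rightarrow> 'w set set" where
  "process_events P N X =
     sigma_sets (space P) (\<Union>B\<in>sets borel. events_of P borel (point_count N X B))"

definition cond_indep_sets ::
    "'w measure \<Rightarrow> 'w measure \<Rightarrow> 'w set set \<Rightarrow> 'w set set \<Rightarrow> bool" where
  "cond_indep_sets P F \<A> \<B> \<longleftrightarrow>
     (\<forall>A\<in>\<A>. \<forall>B\<in>\<B>. AE \<omega> in P.
        cond_prob_sub P F (A \<inter> B) \<omega> = cond_prob_sub P F A \<omega> * cond_prob_sub P F B \<omega>)"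

text \<open>
  Unlike \<^const>\<open>prob_space.indep_var\<close>, this allows random elements of different types; it
  entails their measurability.
\<close>

definition indep_elements ::
    "'w measure \<Rightarrow> 'b measure \<Rightarrow> ('w \<Rightarrow> 'b) \<Rightarrow> 'c measure \<Rightarrow> ('w \<Rightarrow> 'c) \<Rightarrow> bool" where
  "indep_elements P K Y L Z \<longleftrightarrow> prob_space.indep_set P (events_of P K Y) (events_of P L Z)"

abbreviation seq_space :: "(nat \<Rightarrow> 'b::topological_space) measure" where
  "seq_space \<equiv> (\<Pi>\<^sub>M i\<in>UNIV. borel)"

text \<open>The state space of an enumerated process \<open>(N, X)\<close>.\<close>

abbreviation enum_space :: "(enat \<times> (nat \<Rightarrow> 'a::topological_space)) measure" where
  "enum_space \<equiv> count_space UNIV \<Otimes>\<^sub>M seq_space"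

definition gamma_density :: "real \<Rightarrow> real \<Rightarrow> real \<Rightarrow> real" where
  "gamma_density k b x =
     (if x \<le> 0 then 0 else b powr k * x powr (k - 1) * exp (- b * x) / Gamma k)"


section \<open>The sensing network\<close>

type_synonym plane = "real ^ 2"

text \<open>
  \<open>temp\<close>, \<open>wlen\<close> and \<open>M_div\<close> are the parameters \<open>T\<close>, \<open>\<lambda>\<close> and \<open>M\<close>; \<open>sig_t\<close> and \<open>sig_cl\<close> are
  the mean cross-sections of the target and of a scatterer.
\<close>

record params =
  lam_BS :: real
  lam_cl :: real
  P_s :: real
  P_c :: real
  G_m :: real
  C_L :: real
  C_N :: real
  eta_L :: real
  eta_N :: real
  m_L :: real
  m_N :: real
  c_light :: real
  theta_B :: real
  W_b :: real
  K_B :: real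
  temp :: real
  wlen :: real
  gam :: real
  sig_t :: real
  sig_cl :: real
  zeta_c :: real
  M_div :: nat

definition valid_params :: "params \<Rightarrow> bool" where
  "valid_params p \<longleftrightarrow>
     lam_BS p > 0 \<and> lam_cl p > 0 \<and> P_s p > 0 \<and> P_c p > 0 \<and> G_m p > 0 \<and> C_L p > 0 \<and> C_N p > 0 \<and>
     eta_L p > 0 \<and> eta_N p > 0 \<and> m_L p > 0 \<and> m_N p > 0 \<and> c_light p > 0 \<and> theta_B p > 0 \<and>
     W_b p > 0 \<and> K_B p > 0 \<and> temp p > 0 \<and> wlen p > 0 \<and> gam p > 0 \<and> sig_t p > 0 \<and>
     sig_cl p > 0 \<and> zeta_c p \<ge> 0 \<and> M_div p > 0"

definition p_LOS :: "params \<Rightarrow> real \<Rightarrow> real" where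
  "p_LOS p r = exp (- gam p * r)"

definition kappa :: "params \<Rightarrow> real" where
  "kappa p = P_s p * (G_m p)\<^sup>2 * (wlen p)\<^sup>2 / (4 * pi) ^ 3"

definition cell_area :: "params \<Rightarrow> real \<Rightarrow> real" where
  "cell_area p R1 = c_light p * theta_B p * R1 / (2 * W_b p)"

definition outside_intensity :: "real \<Rightarrow> (real \<Rightarrow> real) \<Rightarrow> plane measure" where
  "outside_intensity R f = density lborel (\<lambda>x. ennreal (if norm x > R then f (norm x) else 0))"

definition IC_intensity :: "params \<Rightarrow> real \<Rightarrow> plane measure" where
  "IC_intensity p R = outside_intensity R (\<lambda>r. p_LOS p r * lam_BS p / real (M_div p))"

definition DL_intensity :: "params \<Rightarrow> real \<Rightarrow> plane measure" where
  "DL_intensity p R = outside_intensity R (\<lambda>r. p_LOS p r * lam_BS p / (real (M_div p))\<^sup>2)"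

definition DN_intensity :: "params \<Rightarrow> real \<Rightarrow> plane measure" where
  "DN_intensity p R = outside_intensity R (\<lambda>r. (1 - p_LOS p r) * lam_BS p / (real (M_div p))\<^sup>2)"

definition R_IC_density :: "params \<Rightarrow> real \<Rightarrow> real \<Rightarrow> real" where
  "R_IC_density p R1 r =
     (if r \<ge> R1 then 2 * pi * lam_BS p * r * exp (- lam_BS p * pi * (r\<^sup>2 - R1\<^sup>2)) else 0)"

definition R_d_density :: "params \<Rightarrow> real \<Rightarrow> real" where
  "R_d_density p r = (if r \<ge> 0 then 2 * pi * lam_BS p * r * exp (- pi * lam_BS p * r\<^sup>2) else 0)"

text \<open>
  Clutter and interference take values in \<open>[0,\<infinity>]\<close>: for small \<open>eta_N\<close> the non-line-of-sight
  interference is infinite. A quotient with infinite denominator is \<open>0\<close>.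
\<close>

definition SINR ::
    "params \<Rightarrow> real \<Rightarrow> real \<Rightarrow> ennreal \<Rightarrow> ennreal \<Rightarrow> ennreal \<Rightarrow> ennreal \<Rightarrow> ennreal \<Rightarrow> ennreal" where
  "SINR p R1 \<sigma> S I1 I2 IL IN =
     ennreal (kappa p * \<sigma> * R1 powr (- 2 * eta_L p)) /
     (ennreal (kappa p * R1 powr (- 2 * eta_L p)) * S
      + ennreal (kappa p * R1 powr (- eta_L p)) * (I1 + I2)
      + ennreal (K_B p * temp p * W_b p) + IL + IN + ennreal (P_c p * zeta_c p))"


section \<open>The closed-form expressions\<close>

text \<open>\<open>exp (- x)\<close> for \<open>x\<close> in \<open>[0,\<infinity>]\<close>, with the convention \<open>exp (-\<infinity>) = 0\<close>.\<close>

definition exp_neg :: "ennreal \<Rightarrow> real" where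
  "exp_neg x = (if x = \<infinity> then 0 else exp (- enn2real x))"

definition clutter_factor :: "params \<Rightarrow> real \<Rightarrow> real \<Rightarrow> real" where
  "clutter_factor p R1 \<phi> =
     exp (- lam_cl p * cell_area p R1 * (\<phi> * sig_cl p / (sig_t p + \<phi> * sig_cl p)))"

text \<open>
  The inner integrals are taken in \<open>[0,\<infinity>]\<close>, as they may be infinite (for the last one in
  \<open>L_D\<close> this happens whenever \<open>eta_N p \<le> 2\<close>).
\<close>

definition L_IC :: "params \<Rightarrow> real \<Rightarrow> real \<Rightarrow> real" where
  "L_IC p R1 s =
    (LINT R:{R1..}|lborel. (LINT \<beta>:{0..pi}|lborel.
       exp_neg (ennreal (2 * pi * lam_BS p / real (M_div p)) *
         (\<integral>\<^sup>+ r\<in>{R..}. ennreal (p_LOS p r *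
            (1 - 1 / (1 + s * cos (\<beta> / 2) * r powr (- eta_L p) * sig_t p)) * r) \<partial>lborel)) *
       exp_neg (ennreal (lam_BS p / real (M_div p)) *
         (\<integral>\<^sup>+ r\<in>{R..}. ennreal (p_LOS p r *
            (1 - exp (- lam_cl p * cell_area p R1 *
                  (s * cos (\<beta> / 2) * r powr (- eta_L p) * sig_cl p /
                    (1 + s * cos (\<beta> / 2) * r powr (- eta_L p) * sig_cl p)))) * (2 * pi * r)) \<partial>lborel)) *
       (2 * lam_BS p * R * exp (- lam_BS p * pi * (R\<^sup>2 - R1\<^sup>2)))))"

definition L_D :: "params \<Rightarrow> real \<Rightarrow> real" where
  "L_D p s =
    (LINT R:{0..}|lborel.
       exp_neg (ennreal (2 * pi * lam_BS p / (real (M_div p))\<^sup>2) *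
         (\<integral>\<^sup>+ r\<in>{R..}. ennreal (p_LOS p r *
            (1 - (1 + s * P_c p * (G_m p)\<^sup>2 * C_L p * r powr (- eta_L p) / m_L p) powr (- m_L p)) * r)
            \<partial>lborel)) *
       exp_neg (ennreal (2 * pi * lam_BS p / (real (M_div p))\<^sup>2) *
         (\<integral>\<^sup>+ r\<in>{R..}. ennreal ((1 - p_LOS p r) *
            (1 - (1 + s * P_c p * (G_m p)\<^sup>2 * C_N p * r powr (- eta_N p) / m_N p) powr (- m_N p)) * r)
            \<partial>lborel)) *
       (2 * pi * lam_BS p * R * exp (- pi * lam_BS p * R\<^sup>2)))"

end

theory Submission
  imports Defs
begin

text \<open>
  Since the target cross-section is exponential and independent of the rest, the coverage
  probability is \<open>E (exp (- c D))\<close> for the denominator \<open>D\<close> of the SINR and a constant \<open>c\<close>, and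
  this factors over the independent blocks of \<open>D\<close>. The Laplace transform of a sum over a marked
  Poisson process is computed by integrating out the i.i.d. marks, which replaces each summand by
  \<open>- ln\<close> of the Laplace transform of the mark, and applying the Laplace functional
  \<open>E (exp (- (\<Sum>x. h x))) = exp (- (\<integral> 1 - exp (- h) d\<Lambda>))\<close> of the Poisson process. The functional is
  derived from the counts of disjoint sets for simple \<open>h\<close> and extended by monotone limits. All
  of this is done under the restriction of the measure to an event of the conditioning
  \<open>\<sigma>\<close>-algebra, which gives the conditional versions. Polar coordinates then yield the radial
  integrals.
\<close>

section \<open>The function \<open>exp (- x)\<close> on the extended half-line\<close>

text \<open>The conditional Poisson property is an almost sure identity for each finite family of
  sets separately, with a null set that depends on the family, so no conditional law of the whole
  process is directly at hand. Integrating over an event \<open>A\<close> of the conditioning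
  \<sigma>-algebra turns it into an equality of numbers under
  \<open>density P (indicator A)\<close>, where the unconditional argument for the Laplace
  functional can be run with a random intensity. That argument treats deterministic summands only,
  while the inter-clutter sums carry the random factor \<open>cos (\<beta> / 2)\<close>; this is the
  origin of the discretisation in \<open>cond_laplace\<close>. The two kinds of interference use
  conditional independence differently: for the inter-clutter it is given for the sums themselves,
  for the direct interference only for the point processes, so there the marks of both families have
  to be removed before the factors can be separated. Working in [0,\<infinity>] with
  \<open>exp_neg top = 0\<close> makes every limit below valid for divergent sums, in particular for
  an infinite non-line-of-sight interference, which contributes the factor 0.\<close>

lemma exp_neg_ennreal [simp]: "0 \<le> x \<Longrightarrow> exp_neg (ennreal x) = exp (- x)"
  by (simp add: exp_neg_def)

lemma exp_neg_top [simp]: "exp_neg top = 0"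
  by (simp add: exp_neg_def infinity_ennreal_def)

lemma exp_neg_0 [simp]: "exp_neg 0 = 1"
  by (simp add: exp_neg_def)

lemma exp_neg_nonneg [simp]: "0 \<le> exp_neg x"
  by (simp add: exp_neg_def)

lemma exp_neg_le_1 [simp]: "exp_neg x \<le> 1"
  by (simp add: exp_neg_def)

lemma ennreal_exp_neg_le_1 [simp]: "ennreal (exp_neg x) \<le> 1"
  using ennreal_leI[OF exp_neg_le_1[of x]] by simp

lemma exp_neg_add: "exp_neg (a + b) = exp_neg a * exp_neg b"
  by (cases a; cases b)
     (simp_all add: ennreal_plus[symmetric] mult_exp_exp del: ennreal_plus)

lemma exp_neg_sum: "exp_neg (\<Sum>i\<in>I. f i) = (\<Prod>i\<in>I. exp_neg (f i))"
  by (induction I rule: infinite_finite_induct) (simp_all add: exp_neg_add)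

lemma exp_neg_antimono: "a \<le> b \<Longrightarrow> exp_neg b \<le> exp_neg a"
  by (metis exp_neg_add exp_neg_le_1 exp_neg_nonneg le_iff_add mult_left_le)

lemma borel_measurable_exp_neg [measurable]: "exp_neg \<in> borel_measurable borel"
  unfolding exp_neg_def by measurable

text \<open>The case of an infinite limit is what lets divergent sums and intensity integrals pass
  through the approximations below.\<close>

lemma tendsto_exp_neg:
  assumes "(f \<longlongrightarrow> l) F"
  shows "((\<lambda>x. exp_neg (f x)) \<longlongrightarrow> exp_neg l) F"
proof (cases "l = top")
  case False
  then have ev: "eventually (\<lambda>x. f x < top) F"
    using assms by (metis less_top order_tendstoD(2))
  have "((\<lambda>x. exp (- enn2real (f x))) \<longlongrightarrow> exp (- enn2real l)) F"
    using False assms by (intro tendsto_intros) (simp_all add: less_top)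
  then have "((\<lambda>x. exp_neg (f x)) \<longlongrightarrow> exp (- enn2real l)) F"
    by (rule Lim_transform_eventually)
       (use ev in \<open>eventually_elim, auto simp: exp_neg_def infinity_ennreal_def\<close>)
  then show ?thesis using False by (simp add: exp_neg_def infinity_ennreal_def)
next
  case True
  show ?thesis unfolding True exp_neg_top
  proof (rule order_tendstoI)
    fix a :: real assume "a < 0"
    then show "eventually (\<lambda>x. a < exp_neg (f x)) F"
      by (intro always_eventually allI) (meson exp_neg_nonneg less_le_trans)
  next
    fix a :: real assume a: "0 < a"
    \<comment> \<open>Beyond \<open>- ln a\<close> the value of \<open>exp_neg\<close> drops below
      \<open>a\<close>; the threshold is clipped at 0 for \<open>a > 1\<close>.\<close>
    have "ennreal (max 0 (- ln a)) < l" using True by simp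
    with assms have "eventually (\<lambda>x. ennreal (max 0 (- ln a)) < f x) F"
      by (simp add: order_tendstoD(1))
    then show "eventually (\<lambda>x. exp_neg (f x) < a) F"
    proof eventually_elim
      case (elim x)
      show ?case
      proof (cases "f x")
        case (real r)
        then have "- ln a < r" using elim by (cases "0 \<le> - ln a") (auto simp: ennreal_less_iff max_def not_le split: if_splits)
        then have "exp (- r) < exp (ln a)" by simp
        then show ?thesis using real a by simp
      qed (use a in simp)
    qed
  qed
qed

lemma exp_neg_incseq:
  "incseq f \<Longrightarrow> (\<lambda>n. exp_neg (f n)) \<longlonglongrightarrow> exp_neg (SUP n. f n)"
  by (intro tendsto_exp_neg LIMSEQ_SUP)

text \<open>Integrating out the marks produces a product of Laplace transforms over the points.
  \<open>neg_ln\<close> writes each factor as an exponent again, so that the product is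
  \<open>exp_neg\<close> of a point sum and the Laplace functional applies. The infinite value at
  \<open>l = 0\<close> fits \<open>exp_neg top = 0\<close>, and for \<open>l > 1\<close> the
  truncation of \<open>ennreal\<close> gives 0.\<close>

definition neg_ln :: "real \<Rightarrow> ennreal" where
  "neg_ln l = (if l \<le> 0 then \<infinity> else ennreal (- ln l))"

lemma exp_neg_neg_ln: "0 \<le> l \<Longrightarrow> l \<le> 1 \<Longrightarrow> exp_neg (neg_ln l) = l"
  by (auto simp: neg_ln_def infinity_ennreal_def)

lemma borel_measurable_neg_ln [measurable]: "neg_ln \<in> borel_measurable borel"
  unfolding neg_ln_def by measurable

lemma neg_ln_antimono: "a \<le> b \<Longrightarrow> neg_ln b \<le> neg_ln a"
  by (auto simp: neg_ln_def infinity_ennreal_def intro!: ennreal_leI)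

section \<open>Sums over points\<close>

lemma point_sum_SUP: "point_sum n f = (SUP k. \<Sum>i<k. if enat i < n then f i else 0)"
  unfolding point_sum_def by (rule suminf_eq_SUP)

lemma incseq_partial_sum: "incseq (\<lambda>k. \<Sum>i<k. (f i :: ennreal))"
  by (intro incseq_SucI) simp

lemma point_sum_cong: "(\<And>i. enat i < n \<Longrightarrow> f i = g i) \<Longrightarrow> point_sum n f = point_sum n g"
  unfolding point_sum_def by (intro arg_cong[where f=suminf] ext) simp

lemma point_sum_sum: "point_sum n (\<lambda>i. \<Sum>j\<in>J. g j i) = (\<Sum>j\<in>J. point_sum n (g j))"
proof -
  have "point_sum n (\<lambda>i. \<Sum>j\<in>J. g j i) = (\<Sum>i. \<Sum>j\<in>J. if enat i < n then g j i else 0)"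
    unfolding point_sum_def by (intro arg_cong[where f=suminf] ext) simp
  also have "\<dots> = (\<Sum>j\<in>J. point_sum n (g j))"
    unfolding point_sum_def by (rule suminf_sum) simp
  finally show ?thesis .
qed

lemma point_sum_cmult: "point_sum n (\<lambda>i. c * g i) = c * point_sum n g"
proof -
  have "point_sum n (\<lambda>i. c * g i) = (\<Sum>i. c * (if enat i < n then g i else 0))"
    unfolding point_sum_def by (intro arg_cong[where f=suminf] ext) simp
  then show ?thesis by (simp add: point_sum_def)
qed

lemma point_sum_mono: "(\<And>i. f i \<le> g i) \<Longrightarrow> point_sum n f \<le> point_sum n g"
  unfolding point_sum_def by (intro suminf_le) auto

lemma point_sum_SUP_incseq:
  assumes "\<And>i. incseq (\<lambda>k. g k i)"
  shows "point_sum n (\<lambda>i. SUP k. g k i) = (SUP k. point_sum n (g k))"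
proof -
  have "point_sum n (\<lambda>i. SUP k. g k i) = (\<Sum>i. SUP k. if enat i < n then g k i else 0)"
    unfolding point_sum_def by (intro arg_cong[where f=suminf] ext) simp
  also have "\<dots> = (SUP k. \<Sum>i. if enat i < n then g k i else 0)"
    by (rule ennreal_suminf_SUP_eq) (use assms in \<open>auto simp: incseq_def\<close>)
  finally show ?thesis by (simp add: point_sum_def)
qed

lemma borel_measurable_point_sum [measurable]:
  assumes [measurable]: "N \<in> measurable M (count_space UNIV)" "\<And>i. f i \<in> borel_measurable M"
  shows "(\<lambda>w. point_sum (N w) (\<lambda>i. f i w)) \<in> borel_measurable M"
  unfolding point_sum_def by measurable

lemma borel_measurable_point_count [measurable]:
  assumes [measurable]: "N \<in> measurable M (count_space UNIV)" "\<And>i. X i \<in> borel_measurable M"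
    "B \<in> sets borel"
  shows "point_count N X B \<in> borel_measurable M"
  unfolding point_count_def[abs_def] by measurable

text \<open>The count is the counting measure of the set of indices whose points are in
  \<open>B\<close>, hence finite and natural, or infinite.\<close>

lemma point_count_cases: "(\<exists>k. point_count N X B w = of_nat k) \<or> point_count N X B w = top"
proof -
  let ?A = "{i. enat i < N w \<and> X i w \<in> B}"
  have "point_count N X B w = (\<Sum>i. indicator ?A i)"
    unfolding point_count_def point_sum_def
    by (intro arg_cong[where f=suminf] ext) (simp add: indicator_def)
  also have "\<dots> = emeasure (count_space UNIV) ?A"
    by (simp add: nn_integral_count_space_nat[symmetric])
  finally show ?thesis by (cases "finite ?A") (auto simp: emeasure_count_space)
qed

section \<open>Laplace functional of a Poisson process\<close>

text \<open>The exponential series at \<open>exp (- c) * \<mu>\<close>: the Laplace transform of a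
  Poisson variable of mean \<open>\<mu>\<close>.\<close>

lemma suminf_exp_poisson_mass:
  assumes "0 \<le> \<mu>"
  shows "(\<Sum>k. ennreal (exp (- c * real k)) * ennreal (poisson_mass \<mu> k))
           = ennreal (exp (- ((1 - exp (- c)) * \<mu>)))"
proof -
  have "(\<lambda>k. exp (- \<mu>) * ((exp (- c) * \<mu>) ^ k /\<^sub>R fact k)) sums (exp (- \<mu>) * exp (exp (- c) * \<mu>))"
    by (intro sums_mult exp_converges)
  moreover have "exp (- \<mu>) * ((exp (- c) * \<mu>) ^ k /\<^sub>R fact k)
      = exp (- c * real k) * poisson_mass \<mu> k" for k
    by (simp add: poisson_mass_def power_mult_distrib exp_of_nat_mult[symmetric] field_simps)
  moreover have "exp (- \<mu>) * exp (exp (- c) * \<mu>) = exp (- ((1 - exp (- c)) * \<mu>))"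
    by (simp add: mult_exp_exp algebra_simps)
  ultimately have "(\<lambda>k. exp (- c * real k) * poisson_mass \<mu> k) sums exp (- ((1 - exp (- c)) * \<mu>))"
    by simp
  then have "(\<Sum>k. ennreal (exp (- c * real k) * poisson_mass \<mu> k))
      = ennreal (exp (- ((1 - exp (- c)) * \<mu>)))"
    using assms by (intro suminf_ennreal_eq) (auto simp: poisson_mass_def)
  then show ?thesis by (simp add: ennreal_mult')
qed

text \<open>
  A positive weight kills the event of infinitely many points, so no almost sure finiteness of
  the counts is needed.
\<close>

lemma exp_neg_point_count:
  assumes "0 < c"
  shows "ennreal (exp_neg (ennreal c * point_count N X B w))
     = (\<Sum>k. ennreal (exp (- c * real k)) * indicator {of_nat k} (point_count N X B w))"
proof (cases "point_count N X B w = top")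
  case True
  have "indicator {of_nat k} (top::ennreal) = (0::ennreal)" for k
    by (simp add: indicator_def)
  with True assms show ?thesis by (simp add: ennreal_mult_top)
next
  case False
  then obtain m where m: "point_count N X B w = of_nat m"
    using point_count_cases[of N X B w] by auto
  have "(\<Sum>k. ennreal (exp (- c * real k)) * indicator {of_nat k} (of_nat m :: ennreal))
     = (\<Sum>k\<in>{m}. ennreal (exp (- c * real k)) * indicator {of_nat k} (of_nat m :: ennreal))"
    by (rule suminf_finite) (auto simp: indicator_def)
  also have "\<dots> = ennreal (exp_neg (ennreal c * of_nat m))"
    using assms by (simp add: ennreal_of_nat_eq_real_of_nat ennreal_mult[symmetric])
  finally show ?thesis by (simp add: m)
qed

text \<open>
  The law of the counts under a finite measure \<open>Q\<close> is a mixture of Poisson laws. For \<open>Q\<close> the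
  restriction of a probability measure to the events of a sub-\<open>\<sigma>\<close>-algebra this expresses the
  conditional Poisson property without conditional expectations.
\<close>

definition poisson_mixture ::
    "'w measure \<Rightarrow> ('w \<Rightarrow> enat) \<Rightarrow> (nat \<Rightarrow> 'w \<Rightarrow> 'a::metric_space) \<Rightarrow> ('w \<Rightarrow> 'a measure) \<Rightarrow> bool" where
  "poisson_mixture Q N X \<Lambda> \<longleftrightarrow>
     finite_measure Q \<and> N \<in> measurable Q (count_space UNIV) \<and> (\<forall>i. X i \<in> borel_measurable Q) \<and>
     (\<forall>u\<in>borel_measurable borel. (\<lambda>w. \<integral>\<^sup>+x. u x \<partial>\<Lambda> w) \<in> borel_measurable Q) \<and>
     (\<forall>w. sets (\<Lambda> w) = sets borel) \<and>
     (\<forall>w B. B \<in> sets borel \<and> bounded B \<longrightarrow> emeasure (\<Lambda> w) B < \<infinity>) \<and>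
     (\<forall>(n::nat) B k. (\<forall>j<n. B j \<in> sets borel \<and> bounded (B j)) \<and> disjoint_family_on B {..<n} \<longrightarrow>
        emeasure Q {w \<in> space Q. \<forall>j<n. point_count N X (B j) w = of_nat (k j)}
          = (\<integral>\<^sup>+w. (\<Prod>j<n. ennreal (poisson_mass (measure (\<Lambda> w) (B j)) (k j))) \<partial>Q))"

context
  fixes Q :: "'w measure" and N and X :: "nat \<Rightarrow> 'w \<Rightarrow> 'a::metric_space" and \<Lambda>
  assumes pm: "poisson_mixture Q N X \<Lambda>"
begin

lemma pm_facts:
  "finite_measure Q" "N \<in> measurable Q (count_space UNIV)" "X i \<in> borel_measurable Q"
  "u \<in> borel_measurable borel \<Longrightarrow> (\<lambda>w. \<integral>\<^sup>+x. u x \<partial>\<Lambda> w) \<in> borel_measurable Q"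
  "sets (\<Lambda> w) = sets borel"
  "B \<in> sets borel \<Longrightarrow> bounded B \<Longrightarrow> emeasure (\<Lambda> w) B < \<infinity>"
  using pm by (auto simp: poisson_mixture_def)

lemma pm_counts:
  fixes n :: nat
  assumes "\<And>j. j < n \<Longrightarrow> B j \<in> sets borel" "\<And>j. j < n \<Longrightarrow> bounded (B j)"
    "disjoint_family_on B {..<n}"
  shows "emeasure Q {w \<in> space Q. \<forall>j<n. point_count N X (B j) w = of_nat (k j)}
          = (\<integral>\<^sup>+w. (\<Prod>j<n. ennreal (poisson_mass (measure (\<Lambda> w) (B j)) (k j))) \<partial>Q)"
  by (rule pm[unfolded poisson_mixture_def, THEN conjunct2, THEN conjunct2, THEN conjunct2, THEN conjunct2,
      THEN conjunct2, THEN conjunct2, rule_format]) (use assms in auto)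

lemma pm_emeasure:
  assumes B: "B \<in> sets borel"
  shows "(\<lambda>w. emeasure (\<Lambda> w) B) \<in> borel_measurable Q"
proof -
  have "(\<lambda>w. \<integral>\<^sup>+x. indicator B x \<partial>\<Lambda> w) \<in> borel_measurable Q"
    by (rule pm_facts(4)[OF borel_measurable_indicator[OF B]])
  moreover have "B \<in> sets (\<Lambda> w)" for w using B by (simp only: pm_facts(5))
  ultimately show ?thesis by simp
qed

lemma pm_measure:
  assumes "B \<in> sets borel"
  shows "(\<lambda>w. measure (\<Lambda> w) B) \<in> borel_measurable Q"
  unfolding measure_def by (rule measurable_compose[OF pm_emeasure[OF assms]]) measurable

lemma pm_sets:
  assumes "finite J" "\<And>j. j \<in> J \<Longrightarrow> B j \<in> sets borel"
  shows "{w\<in>space Q. \<forall>j\<in>J. point_count N X (B j) w = of_nat (k j)} \<in> sets Q"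
proof (intro sets.sets_Collect_finite_All assms)
  fix j assume "j \<in> J"
  then have [measurable]: "point_count N X (B j) \<in> borel_measurable Q"
    by (intro borel_measurable_point_count pm_facts assms)
  show "{w\<in>space Q. point_count N X (B j) w = of_nat (k j)} \<in> sets Q" by measurable
qed

text \<open>Interpolates between the joint law of the counts at \<open>m = 0\<close> and their joint
  Laplace transform at \<open>m = n\<close>, converting one count per step. The integral over
  \<open>Q\<close> stays outside throughout, because the Poisson means are random; only the
  integrand has product form.\<close>

lemma poisson_laplace_counts:
  fixes c :: "nat \<Rightarrow> real"
  assumes B: "\<And>j. j < n \<Longrightarrow> B j \<in> sets borel" "\<And>j. j < n \<Longrightarrow> bounded (B j)"
    "disjoint_family_on B {..<n}"
    and c: "\<And>j. j < n \<Longrightarrow> 0 < c j"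
    and "m \<le> n"
  shows "(\<integral>\<^sup>+w. (\<Prod>j<m. ennreal (exp_neg (ennreal (c j) * point_count N X (B j) w))) *
             indicator {w\<in>space Q. \<forall>j\<in>{m..<n}. point_count N X (B j) w = of_nat (k j)} w \<partial>Q)
    = (\<integral>\<^sup>+w. (\<Prod>j<m. ennreal (exp (- ((1 - exp (- c j)) * measure (\<Lambda> w) (B j))))) *
             (\<Prod>j\<in>{m..<n}. ennreal (poisson_mass (measure (\<Lambda> w) (B j)) (k j))) \<partial>Q)"
  using \<open>m \<le> n\<close>
proof (induction m arbitrary: k)
  case 0
  have "{w\<in>space Q. \<forall>j\<in>{..<n}. point_count N X (B j) w = of_nat (k j)} \<in> sets Q"
    by (rule pm_sets) (use B in auto)
  moreover have "emeasure Q {w \<in> space Q. \<forall>j<n. point_count N X (B j) w = of_nat (k j)}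
          = (\<integral>\<^sup>+w. (\<Prod>j<n. ennreal (poisson_mass (measure (\<Lambda> w) (B j)) (k j))) \<partial>Q)"
    by (rule pm_counts) (use B in auto)
  ultimately show ?case
    by (simp only: atLeast0LessThan lessThan_0 prod.empty mult_1_left nn_integral_indicator
        Ball_def lessThan_iff)
next
  case (Suc m)
  then have m: "m < n" by simp
  note pm_facts(2,3)[measurable]
  have split: "{m..<n} = insert m {Suc m..<n}" using m by auto
  let ?C = "\<lambda>j w. point_count N X (B j) w"
  let ?F = "\<lambda>w. \<Prod>j<m. ennreal (exp_neg (ennreal (c j) * ?C j w))"
  let ?G = "\<lambda>w. \<Prod>j<m. ennreal (exp (- ((1 - exp (- c j)) * measure (\<Lambda> w) (B j))))"
  let ?E = "\<lambda>k m. {w\<in>space Q. \<forall>j\<in>{m..<n}. ?C j w = of_nat (k j)}"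
  let ?a = "\<lambda>i. ennreal (exp (- c m * real i))"
  let ?pp = "\<lambda>k w m. \<Prod>j\<in>{m..<n}. ennreal (poisson_mass (measure (\<Lambda> w) (B j)) (k j))"
  have Cm: "?C j \<in> borel_measurable Q" if "j < n" for j
    by (intro borel_measurable_point_count pm_facts B that)
  have [measurable]: "?C m \<in> borel_measurable Q" by (rule Cm[OF m])
  have Mm: "(\<lambda>w. measure (\<Lambda> w) (B j)) \<in> borel_measurable Q" if "j < n" for j
    by (intro pm_measure B that)
  have [measurable]: "?F \<in> borel_measurable Q"
  proof (intro borel_measurable_prod_ennreal)
    fix j assume "j \<in> {..<m}"
    then have [measurable]: "?C j \<in> borel_measurable Q" using m by (intro Cm) simp
    show "(\<lambda>w. ennreal (exp_neg (ennreal (c j) * ?C j w))) \<in> borel_measurable Q" by measurable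
  qed
  have [measurable]: "?E k m' \<in> sets Q" for k m' by (rule pm_sets) (use B in auto)
  have [measurable]: "?G \<in> borel_measurable Q"
  proof (intro borel_measurable_prod_ennreal)
    fix j assume "j \<in> {..<m}"
    then have [measurable]: "(\<lambda>w. measure (\<Lambda> w) (B j)) \<in> borel_measurable Q"
      using m by (intro Mm) simp
    show "(\<lambda>w. ennreal (exp (- ((1 - exp (- c j)) * measure (\<Lambda> w) (B j))))) \<in> borel_measurable Q"
      by measurable
  qed
  have [measurable]: "(\<lambda>w. ?pp k w m') \<in> borel_measurable Q" for k m'
  proof (intro borel_measurable_prod_ennreal)
    fix j assume "j \<in> {m'..<n}"
    then have [measurable]: "(\<lambda>w. measure (\<Lambda> w) (B j)) \<in> borel_measurable Q"
      by (intro Mm) simp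
    show "(\<lambda>w. ennreal (poisson_mass (measure (\<Lambda> w) (B j)) (k j))) \<in> borel_measurable Q"
      unfolding poisson_mass_def by measurable
  qed
  \<comment> \<open>\<open>exp_neg_point_count\<close> expands the factor of index \<open>m\<close>
    over the values \<open>i\<close> of that count. Fixing the value is the event for
    \<open>k(m:=i)\<close>, which is why \<open>k\<close> is arbitrary in the induction.\<close>
  have "(\<integral>\<^sup>+w. (\<Prod>j<Suc m. ennreal (exp_neg (ennreal (c j) * ?C j w))) * indicator (?E k (Suc m)) w \<partial>Q)
      = (\<integral>\<^sup>+w. (\<Sum>i. ?a i * (?F w * indicator (?E (k(m:=i)) m) w)) \<partial>Q)"
  proof (intro nn_integral_cong)
    fix w assume w: "w \<in> space Q"
    have "indicator (?E (k(m:=i)) m) w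
        = (indicator {of_nat i} (?C m w) * indicator (?E k (Suc m)) w :: ennreal)" for i
      unfolding split using w by (auto simp: indicator_def)
    then have "(\<Sum>i. ?a i * (?F w * indicator (?E (k(m:=i)) m) w))
       = (\<Sum>i. (?F w * indicator (?E k (Suc m)) w) * (?a i * indicator {of_nat i} (?C m w)))"
      by (simp add: mult_ac)
    also have "\<dots> = (?F w * indicator (?E k (Suc m)) w) * ennreal (exp_neg (ennreal (c m) * ?C m w))"
      by (simp only: ennreal_suminf_cmult exp_neg_point_count[OF c[OF m]])
    finally show "(\<Prod>j<Suc m. ennreal (exp_neg (ennreal (c j) * ?C j w))) * indicator (?E k (Suc m)) w
       = (\<Sum>i. ?a i * (?F w * indicator (?E (k(m:=i)) m) w))"
      by (simp add: mult_ac)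
  qed
  also have "\<dots> = (\<Sum>i. \<integral>\<^sup>+w. ?a i * (?F w * indicator (?E (k(m:=i)) m) w) \<partial>Q)"
    by (rule nn_integral_suminf) measurable
  also have "\<dots> = (\<Sum>i. ?a i * (\<integral>\<^sup>+w. ?F w * indicator (?E (k(m:=i)) m) w \<partial>Q))"
    by (subst nn_integral_cmult) measurable
  also have "\<dots> = (\<Sum>i. ?a i * (\<integral>\<^sup>+w. ?G w * ?pp (k(m:=i)) w m \<partial>Q))"
    using m by (subst Suc.IH) auto
  also have "\<dots> = (\<Sum>i. \<integral>\<^sup>+w. ?a i * (?G w * ?pp (k(m:=i)) w m) \<partial>Q)"
    by (subst nn_integral_cmult) measurable
  also have "\<dots> = (\<integral>\<^sup>+w. (\<Sum>i. ?a i * (?G w * ?pp (k(m:=i)) w m)) \<partial>Q)"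
    by (rule nn_integral_suminf[symmetric]) measurable
  also have "\<dots> = (\<integral>\<^sup>+w. (\<Prod>j<Suc m. ennreal (exp (- ((1 - exp (- c j)) * measure (\<Lambda> w) (B j))))) *
             ?pp k w (Suc m) \<partial>Q)"
  proof (intro nn_integral_cong)
    fix w
    let ?\<mu> = "measure (\<Lambda> w) (B m)"
    have "?pp (k(m:=i)) w m = ennreal (poisson_mass ?\<mu> i) * ?pp k w (Suc m)" for i
      unfolding split by simp
    then have "(\<Sum>i. ?a i * (?G w * ?pp (k(m:=i)) w m))
      = (\<Sum>i. (?G w * ?pp k w (Suc m)) * (?a i * ennreal (poisson_mass ?\<mu> i)))"
      by (simp only: mult_ac)
    also have "\<dots> = (?G w * ?pp k w (Suc m)) * ennreal (exp (- ((1 - exp (- c m)) * ?\<mu>)))"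
      by (subst ennreal_suminf_cmult, subst suminf_exp_poisson_mass) simp_all
    finally show "(\<Sum>i. ?a i * (?G w * ?pp (k(m:=i)) w m)) =
       (\<Prod>j<Suc m. ennreal (exp (- ((1 - exp (- c j)) * measure (\<Lambda> w) (B j))))) * ?pp k w (Suc m)"
      by (simp add: mult_ac)
  qed
  finally show ?case .
qed

text \<open>The level sets of \<open>h\<close> are disjoint, and those of nonzero values are
  bounded, so the point sum is a combination of counts covered by the hypothesis on
  \<open>Q\<close>, with positive finite weights.\<close>

lemma poisson_laplace_simple:
  assumes h: "h \<in> borel_measurable borel" "finite (range h)" "bounded {x. h x \<noteq> 0}" "\<And>x. h x < top"
  shows "(\<integral>\<^sup>+w. ennreal (exp_neg (point_sum (N w) (\<lambda>i. h (X i w)))) \<partial>Q)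
     = (\<integral>\<^sup>+w. ennreal (exp_neg (\<integral>\<^sup>+x. ennreal (1 - exp_neg (h x)) \<partial>\<Lambda> w)) \<partial>Q)"
proof -
  note h(1)[measurable]
  \<comment> \<open>The value 0 is excluded: its level set need not be bounded, and the transform of
    the counts asks for positive weights.\<close>
  define V where "V = range h - {0}"
  have "finite V" using h by (simp add: V_def)
  then obtain v where v: "bij_betw v {..<card V} V"
    using ex_bij_betw_nat_finite[of V] by (auto simp: atLeast0LessThan)
  define n where "n = card V"
  define B where "B j = h -` {v j}" for j
  define c where "c j = enn2real (v j)" for j
  have inV: "v j \<in> V" if "j < n" for j using v that by (auto simp: bij_betw_def n_def)
  then have vc: "v j = ennreal (c j)" "0 < c j" if "j < n" for j
  proof -
    obtain x where "v j = h x" "v j \<noteq> 0" using inV[OF \<open>j < n\<close>] by (auto simp: V_def)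
    moreover have "h x < top" by (rule h)
    ultimately show "v j = ennreal (c j)" "0 < c j"
      by (auto simp: c_def enn2real_positive_iff zero_less_iff_neq_zero)
  qed
  have Bm: "B j \<in> sets borel" for j
    unfolding B_def using measurable_sets_borel[OF h(1), of "{v j}"] by simp
  have Bb: "bounded (B j)" if "j < n" for j
    by (rule bounded_subset[OF h(3)]) (use inV[OF that] in \<open>auto simp: B_def V_def\<close>)
  have Bd: "disjoint_family_on B {..<n}"
    using v by (auto simp: disjoint_family_on_def B_def bij_betw_def n_def inj_on_def)
  \<comment> \<open>Used with the identity for the sum over the points and with
    \<open>1 - exp_neg\<close> for the integral over the intensity; both vanish at 0, the value left
    out of \<open>V\<close>.\<close>
  have g_sum: "g (h x) = (\<Sum>j<n. g (v j) * indicator (B j) x)" if "g 0 = 0" for g :: "ennreal \<Rightarrow> ennreal" and x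
  proof -
    have "(\<Sum>j<n. g (v j) * indicator (B j) x) = (\<Sum>j<card V. g (v j) * indicator {v j} (h x))"
      unfolding n_def by (intro sum.cong) (auto simp: B_def indicator_def)
    also have "\<dots> = (\<Sum>y\<in>V. g y * indicator {y} (h x))"
      by (rule sum.reindex_bij_betw[OF v])
    also have "\<dots> = g (h x)"
      using that \<open>finite V\<close> by (cases "h x = 0") (auto simp: V_def indicator_def if_distrib sum.delta cong: if_cong)
    finally show ?thesis ..
  qed
  have "(\<integral>\<^sup>+w. ennreal (exp_neg (point_sum (N w) (\<lambda>i. h (X i w)))) \<partial>Q)
     = (\<integral>\<^sup>+w. (\<Prod>j<n. ennreal (exp_neg (ennreal (c j) * point_count N X (B j) w))) *
             indicator {w\<in>space Q. \<forall>j\<in>{n..<n}. point_count N X (B j) w = of_nat 0} w \<partial>Q)"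
  proof (intro nn_integral_cong)
    fix w assume "w \<in> space Q"
    have "point_sum (N w) (\<lambda>i. h (X i w)) = (\<Sum>j<n. v j * point_count N X (B j) w)"
      unfolding point_count_def point_sum_cmult[symmetric] point_sum_sum[symmetric]
      using g_sum[of "\<lambda>x. x"] by simp
    then show "ennreal (exp_neg (point_sum (N w) (\<lambda>i. h (X i w))))
       = (\<Prod>j<n. ennreal (exp_neg (ennreal (c j) * point_count N X (B j) w))) *
             indicator {w\<in>space Q. \<forall>j\<in>{n..<n}. point_count N X (B j) w = of_nat 0} w"
      using vc \<open>w \<in> space Q\<close> by (simp add: exp_neg_sum prod_ennreal)
  qed
  also have "\<dots> = (\<integral>\<^sup>+w. (\<Prod>j<n. ennreal (exp (- ((1 - exp (- c j)) * measure (\<Lambda> w) (B j))))) *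
             (\<Prod>j\<in>{n..<n}. ennreal (poisson_mass (measure (\<Lambda> w) (B j)) 0)) \<partial>Q)"
    by (rule poisson_laplace_counts) (use Bm Bb Bd vc in auto)
  also have "\<dots> = (\<integral>\<^sup>+w. ennreal (exp_neg (\<integral>\<^sup>+x. ennreal (1 - exp_neg (h x)) \<partial>\<Lambda> w)) \<partial>Q)"
  proof (intro nn_integral_cong)
    fix w
    have "(\<integral>\<^sup>+x. ennreal (1 - exp_neg (h x)) \<partial>\<Lambda> w)
       = (\<integral>\<^sup>+x. (\<Sum>j<n. ennreal (1 - exp_neg (v j)) * indicator (B j) x) \<partial>\<Lambda> w)"
      using g_sum[of "\<lambda>y. ennreal (1 - exp_neg y)"] by simp
    also have "\<dots> = (\<Sum>j<n. ennreal (1 - exp_neg (v j)) * emeasure (\<Lambda> w) (B j))"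
    proof (subst nn_integral_sum)
      have B: "B j \<in> sets (\<Lambda> w)" for j using Bm by (simp only: pm_facts(5))
      show "(\<lambda>x. ennreal (1 - exp_neg (v j)) * indicator (B j) x) \<in> borel_measurable (\<Lambda> w)" for j
        using B by measurable
      show "(\<Sum>j<n. \<integral>\<^sup>+x. ennreal (1 - exp_neg (v j)) * indicator (B j) x \<partial>\<Lambda> w)
        = (\<Sum>j<n. ennreal (1 - exp_neg (v j)) * emeasure (\<Lambda> w) (B j))"
        using B by (simp add: nn_integral_cmult_indicator)
    qed
    also have "\<dots> = (\<Sum>j<n. ennreal ((1 - exp (- c j)) * measure (\<Lambda> w) (B j)))"
    proof (intro sum.cong refl)
      fix j assume "j \<in> {..<n}"
      then have "emeasure (\<Lambda> w) (B j) = ennreal (measure (\<Lambda> w) (B j))"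
        using pm_facts(6)[of "B j" w] Bm Bb
        by (intro emeasure_eq_ennreal_measure) (auto simp: infinity_ennreal_def less_top)
      then show "ennreal (1 - exp_neg (v j)) * emeasure (\<Lambda> w) (B j)
         = ennreal ((1 - exp (- c j)) * measure (\<Lambda> w) (B j))"
        using vc[of j] \<open>j \<in> {..<n}\<close> by (simp add: ennreal_mult')
    qed
    finally have "exp_neg (\<integral>\<^sup>+x. ennreal (1 - exp_neg (h x)) \<partial>\<Lambda> w)
        = (\<Prod>j<n. exp (- ((1 - exp (- c j)) * measure (\<Lambda> w) (B j))))"
    proof (simp only: exp_neg_sum, intro prod.cong refl)
      fix j assume "j \<in> {..<n}"
      then have "0 \<le> 1 - exp (- c j)" using vc[of j] by simp
      then show "exp_neg (ennreal ((1 - exp (- c j)) * measure (\<Lambda> w) (B j)))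
         = exp (- ((1 - exp (- c j)) * measure (\<Lambda> w) (B j)))" by simp
    qed
    then show "(\<Prod>j<n. ennreal (exp (- ((1 - exp (- c j)) * measure (\<Lambda> w) (B j))))) *
             (\<Prod>j\<in>{n..<n}. ennreal (poisson_mass (measure (\<Lambda> w) (B j)) 0))
         = ennreal (exp_neg (\<integral>\<^sup>+x. ennreal (1 - exp_neg (h x)) \<partial>\<Lambda> w))"
      by (simp add: prod_ennreal)
  qed
  finally show ?thesis .
qed

text \<open>Simple functions cut off to balls increase to \<open>h\<close>. On both sides the
  integrands converge and are bounded by 1, which is integrable because \<open>Q\<close> is
  finite.\<close>

lemma poisson_laplace:
  assumes h [measurable]: "h \<in> borel_measurable borel"
  shows "(\<integral>\<^sup>+w. ennreal (exp_neg (point_sum (N w) (\<lambda>i. h (X i w)))) \<partial>Q)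
     = (\<integral>\<^sup>+w. ennreal (exp_neg (\<integral>\<^sup>+x. ennreal (1 - exp_neg (h x)) \<partial>\<Lambda> w)) \<partial>Q)"
proof -
  interpret finite_measure Q by (rule pm_facts)
  note pm_facts(2,3)[measurable]
  obtain f where f: "\<And>i. simple_function borel (f i)" "incseq f" "\<And>i x. f i x < top"
      "\<And>x. (SUP i. f i x) = h x"
    by (rule borel_measurable_implies_simple_function_sequence'[OF h]) (rule that)
  define x0 :: 'a where "x0 = undefined"
  \<comment> \<open>The cut-off gives the bounded support that the simple case asks for. The balls
    grow with \<open>k\<close>, so the sequence stays increasing and still exhausts the space,
    whatever the centre.\<close>
  define g where "g k x = f k x * indicator (cball x0 (real k)) x" for k x
  have [measurable]: "f i \<in> borel_measurable borel" for i
    using f(1) by (rule borel_measurable_simple_function)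
  have [measurable]: "cball x0 (real k) \<in> sets borel" for k by (simp add: borel_closed)
  have gm [measurable]: "g k \<in> borel_measurable borel" for k
    unfolding g_def[abs_def] by measurable
  have g_fin: "finite (range (g k))" for k
  proof -
    have "range (g k) \<subseteq> insert 0 (range (f k))" by (auto simp: g_def indicator_def)
    then show ?thesis using f(1)[of k] by (auto simp: simple_function_def intro: finite_subset)
  qed
  have g_bd: "bounded {x. g k x \<noteq> 0}" for k
    by (rule bounded_subset[OF bounded_cball[of x0 "real k"]]) (auto simp: g_def indicator_def)
  have g_inc: "incseq (\<lambda>k. g k x)" for x
    unfolding g_def using f(2)
    by (auto simp: incseq_def le_fun_def indicator_def intro!: mult_mono)
  have g_sup: "(SUP k. g k x) = h x" for x
  proof (rule LIMSEQ_unique[OF LIMSEQ_SUP[OF g_inc]])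
    have "(\<lambda>k. f k x) \<longlonglongrightarrow> (SUP k. f k x)"
      by (rule LIMSEQ_SUP) (use f(2) in \<open>auto simp: incseq_def le_fun_def\<close>)
    then have lim: "(\<lambda>k. f k x) \<longlonglongrightarrow> h x" by (simp only: f(4))
    have "eventually (\<lambda>k. f k x = g k x) sequentially"
      using eventually_ge_at_top[of "nat \<lceil>dist x0 x\<rceil>"]
    proof eventually_elim
      case (elim k)
      then have "x \<in> cball x0 (real k)" by (simp add: nat_ceiling_le_eq)
      then show ?case by (simp add: g_def)
    qed
    then show "(\<lambda>k. g k x) \<longlonglongrightarrow> h x"
      by (rule Lim_transform_eventually[OF lim])
  qed
  let ?L = "\<lambda>h w. ennreal (exp_neg (point_sum (N w) (\<lambda>i. h (X i w))))"
  let ?R = "\<lambda>h w. ennreal (exp_neg (\<integral>\<^sup>+x. ennreal (1 - exp_neg (h x)) \<partial>\<Lambda> w))"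
  have 1: "(\<lambda>k. \<integral>\<^sup>+w. ?L (g k) w \<partial>Q) \<longlonglongrightarrow> (\<integral>\<^sup>+w. ?L h w \<partial>Q)"
  proof (rule nn_integral_dominated_convergence[where w="\<lambda>_. 1"])
    show "AE w in Q. (\<lambda>k. ?L (g k) w) \<longlonglongrightarrow> ?L h w"
    proof (intro AE_I2 tendsto_ennrealI)
      fix w
      have "(\<lambda>k. exp_neg (point_sum (N w) (\<lambda>i. g k (X i w))))
         \<longlonglongrightarrow> exp_neg (SUP k. point_sum (N w) (\<lambda>i. g k (X i w)))"
        using g_inc by (intro exp_neg_incseq) (auto simp: incseq_def intro!: point_sum_mono)
      then show "(\<lambda>k. exp_neg (point_sum (N w) (\<lambda>i. g k (X i w))))
         \<longlonglongrightarrow> exp_neg (point_sum (N w) (\<lambda>i. h (X i w)))"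
        using g_inc by (subst (asm) point_sum_SUP_incseq[symmetric]) (simp_all add: g_sup)
    qed
    show "(\<integral>\<^sup>+w. 1 \<partial>Q) < \<infinity>"
      using emeasure_finite[of "space Q"] by (simp add: top.not_eq_extremum[symmetric])
    show "AE w in Q. ?L (g k) w \<le> 1" for k
      by simp
    show "?L (g k) \<in> borel_measurable Q" for k by measurable
    show "?L h \<in> borel_measurable Q" by measurable
  qed simp
  have um: "(\<lambda>w. \<integral>\<^sup>+x. ennreal (1 - exp_neg (g' x)) \<partial>\<Lambda> w) \<in> borel_measurable Q"
    if [measurable]: "g' \<in> borel_measurable borel" for g'
    by (intro pm_facts(4)) measurable
  note um[OF gm, measurable] um[OF h, measurable]
  have 2: "(\<lambda>k. \<integral>\<^sup>+w. ?R (g k) w \<partial>Q) \<longlonglongrightarrow> (\<integral>\<^sup>+w. ?R h w \<partial>Q)"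
  proof (rule nn_integral_dominated_convergence[where w="\<lambda>_. 1"])
    show "AE w in Q. (\<lambda>k. ?R (g k) w) \<longlonglongrightarrow> ?R h w"
    proof (intro AE_I2 tendsto_ennrealI tendsto_exp_neg)
      fix w
      have [measurable_cong]: "sets (\<Lambda> w) = sets borel" by (rule pm_facts)
      show "(\<lambda>k. \<integral>\<^sup>+x. ennreal (1 - exp_neg (g k x)) \<partial>\<Lambda> w)
         \<longlonglongrightarrow> (\<integral>\<^sup>+x. ennreal (1 - exp_neg (h x)) \<partial>\<Lambda> w)"
      proof (rule nn_integral_LIMSEQ)
        show "incseq (\<lambda>k x. ennreal (1 - exp_neg (g k x)))"
          using g_inc by (auto simp: incseq_def le_fun_def intro!: ennreal_leI exp_neg_antimono)
        show "(\<lambda>k. ennreal (1 - exp_neg (g k x))) \<longlonglongrightarrow> ennreal (1 - exp_neg (h x))" for x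
          unfolding g_sup[of x, symmetric]
          by (intro tendsto_ennrealI tendsto_diff tendsto_const exp_neg_incseq g_inc)
      qed measurable
    qed
    show "(\<integral>\<^sup>+w. 1 \<partial>Q) < \<infinity>"
      using emeasure_finite[of "space Q"] by (simp add: top.not_eq_extremum[symmetric])
    show "AE w in Q. ?R (g k) w \<le> 1" for k
      by simp
    show "?R (g k) \<in> borel_measurable Q" for k by measurable
    show "?R h \<in> borel_measurable Q" by measurable
  qed simp
  have "g k x < top" for k x using f(3) by (auto simp: g_def indicator_def)
  then have eq: "(\<integral>\<^sup>+w. ?L (g k) w \<partial>Q) = (\<integral>\<^sup>+w. ?R (g k) w \<partial>Q)" for k
    by (intro poisson_laplace_simple gm g_fin g_bd)
  show ?thesis by (rule LIMSEQ_unique[OF 1[unfolded eq] 2])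
qed

end

section \<open>Conditional laws\<close>

text \<open>The hypothesis \<open>eq\<close> says that the measures with densities \<open>f\<close>
  and \<open>g\<close> coincide when restricted to \<open>F\<close>, and the integral of an
  \<open>F\<close>-measurable \<open>u\<close> sees these restrictions only.\<close>

lemma nn_integral_eq_on_subalgebra:
  assumes sub: "subalgebra M F"
    and [measurable]: "f \<in> borel_measurable M" "g \<in> borel_measurable M"
    and eq: "\<And>A. A \<in> sets F \<Longrightarrow> (\<integral>\<^sup>+x. indicator A x * f x \<partial>M) = (\<integral>\<^sup>+x. indicator A x * g x \<partial>M)"
    and u: "u \<in> borel_measurable F"
  shows "(\<integral>\<^sup>+x. u x * f x \<partial>M) = (\<integral>\<^sup>+x. u x * g x \<partial>M)"
proof -
  have F_M: "A \<in> sets M" if "A \<in> sets F" for A using sub that by (auto simp: subalgebra_def)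
  have id: "(\<lambda>x. x) \<in> measurable M F" by (rule measurable_from_subalg[OF sub]) simp
  have um [measurable]: "u \<in> borel_measurable M" by (rule measurable_from_subalg[OF sub u])
  have idd: "(\<lambda>x. x) \<in> measurable (density M h) F" for h
    using id by (simp cong: measurable_cong_sets)
  have em: "emeasure (distr (density M h) F (\<lambda>x. x)) A = (\<integral>\<^sup>+x. indicator A x * h x \<partial>M)"
    if "A \<in> sets F" and [measurable]: "h \<in> borel_measurable M" for A h
  proof -
    have [measurable]: "A \<in> sets M" using F_M that by blast
    have "emeasure (distr (density M h) F (\<lambda>x. x)) A = emeasure (density M h) (A \<inter> space M)"
      using that(1) by (subst emeasure_distr[OF idd]) (auto simp: vimage_def Int_def)
    also have "A \<inter> space M = A" using sets.sets_into_space[OF \<open>A \<in> sets M\<close>] by blast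
    finally show ?thesis by (simp add: emeasure_density mult.commute)
  qed
  have int: "(\<integral>\<^sup>+x. u x \<partial>distr (density M h) F (\<lambda>x. x)) = (\<integral>\<^sup>+x. u x \<partial>density M h)" for h
    by (rule nn_integral_distr[OF idd]) (use u in \<open>simp cong: measurable_cong_sets\<close>)
  have "distr (density M f) F (\<lambda>x. x) = distr (density M g) F (\<lambda>x. x)"
    by (rule measure_eqI) (simp_all add: em eq)
  then have "(\<integral>\<^sup>+x. u x \<partial>distr (density M f) F (\<lambda>x. x)) = (\<integral>\<^sup>+x. u x \<partial>distr (density M g) F (\<lambda>x. x))"
    by simp
  then have "(\<integral>\<^sup>+x. u x \<partial>density M f) = (\<integral>\<^sup>+x. u x \<partial>density M g)"
    by (simp only: int)
  then show ?thesis by (simp add: nn_integral_density mult.commute)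
qed

text \<open>Transfers the defining property of conditional expectation from Bochner integrals to
  integrals in [0,\<infinity>]. The almost sure sign is part of the transfer, since
  \<open>ennreal\<close> would cut off negative values.\<close>

lemma
  assumes prob: "prob_space P" and sub: "subalgebra P F" and E: "E \<in> sets P"
  shows borel_measurable_cond_prob_sub: "cond_prob_sub P F E \<in> borel_measurable F"
    and cond_prob_sub_nonneg: "AE w in P. 0 \<le> cond_prob_sub P F E w"
    and nn_integral_cond_prob_sub: "A \<in> sets F \<Longrightarrow>
      (\<integral>\<^sup>+w. indicator A w * ennreal (cond_prob_sub P F E w) \<partial>P)
        = (\<integral>\<^sup>+w. indicator A w * indicator E w \<partial>P)"
proof -
  interpret prob_space P by fact
  interpret finite_measure_subalgebra P F by unfold_locales (rule sub)
  show "cond_prob_sub P F E \<in> borel_measurable F" by (simp add: cond_prob_sub_def)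
  have i: "integrable P (indicator E :: _ \<Rightarrow> real)"
    using E by (simp add: integrable_indicator_iff less_top[symmetric])
  show pos: "AE w in P. 0 \<le> cond_prob_sub P F E w"
    unfolding cond_prob_sub_def using E by (intro real_cond_exp_pos) auto
  assume A: "A \<in> sets F"
  then have AM [measurable]: "A \<in> sets P" using sub by (auto simp: subalgebra_def)
  note E[measurable]
  have ii: "integrable P (\<lambda>w. indicator A w * cond_prob_sub P F E w)"
    using integrable_mult_indicator[OF AM real_cond_exp_int(1)[OF i]] by (simp add: cond_prob_sub_def)
  have "(\<integral>\<^sup>+w. indicator A w * ennreal (cond_prob_sub P F E w) \<partial>P)
      = (\<integral>\<^sup>+w. ennreal (indicator A w * cond_prob_sub P F E w) \<partial>P)"
    by (intro nn_integral_cong) (simp add: indicator_def)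
  also have "\<dots> = ennreal (\<integral>w. indicator A w * cond_prob_sub P F E w \<partial>P)"
    by (rule nn_integral_eq_integral[OF ii]) (use pos in \<open>auto simp: indicator_def\<close>)
  also have "\<dots> = ennreal (\<integral>w. indicator A w * indicator E w \<partial>P)"
    using real_cond_exp_intA[OF i A] by (simp add: cond_prob_sub_def set_lebesgue_integral_def)
  also have "\<dots> = (\<integral>\<^sup>+w. ennreal (indicator A w * indicator E w) \<partial>P)"
    using integrable_mult_indicator[OF AM i] by (intro nn_integral_eq_integral[symmetric]) auto
  also have "\<dots> = (\<integral>\<^sup>+w. indicator A w * indicator E w \<partial>P)"
    by (intro nn_integral_cong) (simp add: indicator_def)
  finally show "(\<integral>\<^sup>+w. indicator A w * ennreal (cond_prob_sub P F E w) \<partial>P)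
        = (\<integral>\<^sup>+w. indicator A w * indicator E w \<partial>P)" .
qed

text \<open>
  Each passage from one factor to its conditional version tests against the indicators of one
  of the three \<open>\<sigma>\<close>-algebras, and \<^const>\<open>cond_indep_sets\<close> is used for indicators only.
\<close>

lemma nn_integral_cond_indep:
  assumes prob: "prob_space P" and sub: "subalgebra P F" "subalgebra P MA" "subalgebra P MB"
    and ci: "cond_indep_sets P F (sets MA) (sets MB)"
    and f: "f \<in> borel_measurable MA" and g: "g \<in> borel_measurable MB"
    and f': "f' \<in> borel_measurable F" and g': "g' \<in> borel_measurable F"
    and ff': "\<And>A. A \<in> sets F \<Longrightarrow> (\<integral>\<^sup>+x. indicator A x * f x \<partial>P) = (\<integral>\<^sup>+x. indicator A x * f' x \<partial>P)"
    and gg': "\<And>A. A \<in> sets F \<Longrightarrow> (\<integral>\<^sup>+x. indicator A x * g x \<partial>P) = (\<integral>\<^sup>+x. indicator A x * g' x \<partial>P)"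
  shows "(\<integral>\<^sup>+x. f x * g x \<partial>P) = (\<integral>\<^sup>+x. f' x * g' x \<partial>P)"
proof -
  have [measurable]: "f \<in> borel_measurable P" "g \<in> borel_measurable P"
      "f' \<in> borel_measurable P" "g' \<in> borel_measurable P"
    using f g f' g' sub by (auto intro: measurable_from_subalg)
  \<comment> \<open>The indicator of \<open>B\<close> is not \<open>F\<close>-measurable, so
    \<open>ff'\<close> does not apply to it. Conditional independence exchanges it for the
    conditional probability \<open>?b\<close>, which is \<open>F\<close>-measurable; once
    \<open>f\<close> has become \<open>f'\<close>, the exchange is reversed.\<close>
  have swap: "(\<integral>\<^sup>+x. indicator B x * f x \<partial>P) = (\<integral>\<^sup>+x. indicator B x * f' x \<partial>P)" if B: "B \<in> sets MB" for B
  proof -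
    have BM [measurable]: "B \<in> sets P" using B sub by (auto simp: subalgebra_def)
    let ?b = "\<lambda>x. ennreal (cond_prob_sub P F B x)"
    have bF: "?b \<in> borel_measurable F"
      using borel_measurable_cond_prob_sub[OF prob sub(1) BM] by measurable
    then have [measurable]: "?b \<in> borel_measurable P" by (rule measurable_from_subalg[OF sub(1)])
    have *: "(\<integral>\<^sup>+x. indicator A x * indicator B x \<partial>P) = (\<integral>\<^sup>+x. indicator A x * ?b x \<partial>P)"
      if A: "A \<in> sets MA" for A
    proof -
      have AM [measurable]: "A \<in> sets P" using A sub by (auto simp: subalgebra_def)
      have sp: "space P \<in> sets F"
        using sub(1) sets.top[of F] by (simp add: subalgebra_def)
      have aF: "(\<lambda>x. ennreal (cond_prob_sub P F A x)) \<in> borel_measurable F"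
        using borel_measurable_cond_prob_sub[OF prob sub(1) AM] by measurable
      then have [measurable]: "(\<lambda>x. ennreal (cond_prob_sub P F A x)) \<in> borel_measurable P"
        by (rule measurable_from_subalg[OF sub(1)])
      have "(\<integral>\<^sup>+x. indicator A x * indicator B x \<partial>P) = (\<integral>\<^sup>+x. indicator (space P) x * indicator (A \<inter> B) x \<partial>P)"
        by (intro nn_integral_cong) (simp add: indicator_def)
      also have "\<dots> = (\<integral>\<^sup>+x. indicator (space P) x * ennreal (cond_prob_sub P F (A \<inter> B) x) \<partial>P)"
        by (rule nn_integral_cond_prob_sub[OF prob sub(1) _ sp, symmetric]) measurable
      also have "\<dots> = (\<integral>\<^sup>+x. ?b x * ennreal (cond_prob_sub P F A x) \<partial>P)"
      proof (rule nn_integral_cong_AE)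
        have "AE x in P. cond_prob_sub P F (A \<inter> B) x = cond_prob_sub P F A x * cond_prob_sub P F B x"
          using ci A B by (auto simp: cond_indep_sets_def)
        moreover note cond_prob_sub_nonneg[OF prob sub(1) AM] cond_prob_sub_nonneg[OF prob sub(1) BM]
        ultimately show "AE x in P. indicator (space P) x * ennreal (cond_prob_sub P F (A \<inter> B) x)
            = ?b x * ennreal (cond_prob_sub P F A x)"
          by (auto simp: ennreal_mult mult.commute)
      qed
      also have "\<dots> = (\<integral>\<^sup>+x. ?b x * indicator A x \<partial>P)"
        \<comment> \<open>Tower property: against the \<open>F\<close>-measurable weight
          \<open>?b\<close>, the conditional probability of \<open>A\<close> integrates like its
          indicator.\<close>
        by (rule nn_integral_eq_on_subalgebra[OF sub(1) _ _ _ bF])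
           (measurable, rule nn_integral_cond_prob_sub[OF prob sub(1) AM])
      also have "\<dots> = (\<integral>\<^sup>+x. indicator A x * ?b x \<partial>P)" by (simp only: mult.commute)
      finally show ?thesis .
    qed
    have "(\<integral>\<^sup>+x. indicator B x * f x \<partial>P) = (\<integral>\<^sup>+x. f x * indicator B x \<partial>P)"
      by (simp only: mult.commute)
    also have "\<dots> = (\<integral>\<^sup>+x. f x * ?b x \<partial>P)"
      by (rule nn_integral_eq_on_subalgebra[OF sub(2) _ _ * f]) measurable
    also have "\<dots> = (\<integral>\<^sup>+x. ?b x * f x \<partial>P)" by (simp only: mult.commute)
    also have "\<dots> = (\<integral>\<^sup>+x. ?b x * f' x \<partial>P)"
      by (rule nn_integral_eq_on_subalgebra[OF sub(1) _ _ ff' bF]) measurable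
    also have "\<dots> = (\<integral>\<^sup>+x. f' x * ?b x \<partial>P)" by (simp only: mult.commute)
    also have "\<dots> = (\<integral>\<^sup>+x. f' x * indicator B x \<partial>P)"
      by (rule nn_integral_eq_on_subalgebra[OF sub(1) _ _ _ f'])
         (measurable, rule nn_integral_cond_prob_sub[OF prob sub(1) BM])
    also have "\<dots> = (\<integral>\<^sup>+x. indicator B x * f' x \<partial>P)" by (simp only: mult.commute)
    finally show ?thesis .
  qed
  have "(\<integral>\<^sup>+x. f x * g x \<partial>P) = (\<integral>\<^sup>+x. g x * f x \<partial>P)" by (simp only: mult.commute)
  also have "\<dots> = (\<integral>\<^sup>+x. g x * f' x \<partial>P)"
    by (rule nn_integral_eq_on_subalgebra[OF sub(3) _ _ swap g]) measurable
  also have "\<dots> = (\<integral>\<^sup>+x. f' x * g x \<partial>P)" by (simp only: mult.commute)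
  also have "\<dots> = (\<integral>\<^sup>+x. f' x * g' x \<partial>P)"
    by (rule nn_integral_eq_on_subalgebra[OF sub(1) _ _ gg' f']) measurable
  finally show ?thesis .
qed

text \<open>The assumption \<open>kernel\<close> admits an integrand with an
  \<open>F\<close>-measurable parameter \<open>C\<close>. This is the measurability needed when
  \<open>cos (\<beta> / 2)\<close> occurs in the summand.\<close>

locale cond_poisson = prob_space P for P :: "'w measure" +
  fixes F :: "'w measure" and N and X :: "nat \<Rightarrow> 'w \<Rightarrow> 'a::metric_space" and \<Lambda>
  assumes sub: "subalgebra P F"
    and process: "cond_poisson_process P F N X \<Lambda>"
    and sets_\<Lambda> [measurable_cong, simp]: "sets (\<Lambda> w) = sets borel"
    and finite_\<Lambda>: "B \<in> sets borel \<Longrightarrow> bounded B \<Longrightarrow> emeasure (\<Lambda> w) B < \<infinity>"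
    and kernel: "C \<in> borel_measurable F \<Longrightarrow> u \<in> borel_measurable (borel \<Otimes>\<^sub>M borel) \<Longrightarrow>
      (\<lambda>w. \<integral>\<^sup>+x. u (C w :: real, x) \<partial>\<Lambda> w) \<in> borel_measurable F"
begin

lemma N_meas [measurable]: "N \<in> measurable P (count_space UNIV)"
  and X_meas [measurable]: "X i \<in> borel_measurable P"
  using process by (auto simp: cond_poisson_process_def)

lemma process_counts:
  fixes n :: nat
  assumes "\<And>j. j < n \<Longrightarrow> B j \<in> sets borel" "\<And>j. j < n \<Longrightarrow> bounded (B j)"
    "disjoint_family_on B {..<n}"
  shows "AE w in P.
          cond_prob_sub P F {w \<in> space P. \<forall>j<n. point_count N X (B j) w = of_nat (k j)} w
            = (\<Prod>j<n. poisson_mass (measure (\<Lambda> w) (B j)) (k j))"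
  by (rule process[unfolded cond_poisson_process_def, THEN conjunct2, THEN conjunct2, rule_format])
     (use assms in auto)

lemma kernel_const:
  assumes [measurable]: "u \<in> borel_measurable borel"
  shows "(\<lambda>w. \<integral>\<^sup>+x. u x \<partial>\<Lambda> w) \<in> borel_measurable F"
  using kernel[of "\<lambda>_. 0" "\<lambda>(c, x). u x"] by simp

text \<open>Integrating the almost sure formula for the conditional probability of the counts over
  \<open>A\<close> yields the mixture formula; that \<open>A\<close> belongs to \<open>F\<close> is
  what permits replacing this conditional probability by the event itself.\<close>

lemma poisson_mixture_restrict:
  assumes A: "A \<in> sets F"
  shows "poisson_mixture (density P (indicator A)) N X \<Lambda>"
  unfolding poisson_mixture_def
proof (intro conjI allI impI ballI)
  have AM [measurable]: "A \<in> sets P" using A sub by (auto simp: subalgebra_def)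
  show "finite_measure (density P (indicator A))"
    by (rule finite_measureI) (simp add: emeasure_density less_top[symmetric])
  show "N \<in> measurable (density P (indicator A)) (count_space UNIV)" by simp
  show "X i \<in> borel_measurable (density P (indicator A))" for i by simp
  show "(\<lambda>w. \<integral>\<^sup>+x. u x \<partial>\<Lambda> w) \<in> borel_measurable (density P (indicator A))"
    if "u \<in> borel_measurable borel" for u
    using measurable_from_subalg[OF sub kernel_const[OF that]] by simp
  show "sets (\<Lambda> w) = sets borel" for w by simp
  show "emeasure (\<Lambda> w) B < \<infinity>" if "B \<in> sets borel \<and> bounded B" for B w
    using finite_\<Lambda> that by blast
  fix n :: nat and B :: "nat \<Rightarrow> 'a set" and k :: "nat \<Rightarrow> nat"
  assume B: "(\<forall>j<n. B j \<in> sets borel \<and> bounded (B j)) \<and> disjoint_family_on B {..<n}"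
  define E where "E = {w \<in> space P. \<forall>j\<in>{..<n}. point_count N X (B j) w = of_nat (k j)}"
  have E [measurable]: "E \<in> sets P" unfolding E_def
  proof (intro sets.sets_Collect_finite_All)
    fix j assume "j \<in> {..<n}"
    then have [measurable]: "point_count N X (B j) \<in> borel_measurable P"
      using B by (intro borel_measurable_point_count) auto
    show "{w\<in>space P. point_count N X (B j) w = of_nat (k j)} \<in> sets P" by measurable
  qed simp
  have *: "AE w in P. cond_prob_sub P F E w = (\<Prod>j<n. poisson_mass (measure (\<Lambda> w) (B j)) (k j))"
    using process_counts[of n B k] B by (simp only: E_def Ball_def lessThan_iff)
  have "emeasure (density P (indicator A)) E = (\<integral>\<^sup>+w. indicator A w * indicator E w \<partial>P)"
    by (simp add: emeasure_density)
  also have "\<dots> = (\<integral>\<^sup>+w. indicator A w * ennreal (cond_prob_sub P F E w) \<partial>P)"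
    by (rule nn_integral_cond_prob_sub[OF _ sub E A, symmetric]) unfold_locales
  also have "\<dots> = (\<integral>\<^sup>+w. indicator A w * (\<Prod>j<n. ennreal (poisson_mass (measure (\<Lambda> w) (B j)) (k j))) \<partial>P)"
    using * by (intro nn_integral_cong_AE) (auto simp: prod_ennreal poisson_mass_def)
  also have "\<dots> = (\<integral>\<^sup>+w. (\<Prod>j<n. ennreal (poisson_mass (measure (\<Lambda> w) (B j)) (k j))) \<partial>density P (indicator A))"
  proof (rule nn_integral_density[symmetric])
    show "(\<lambda>w. \<Prod>j<n. ennreal (poisson_mass (measure (\<Lambda> w) (B j)) (k j))) \<in> borel_measurable P"
    proof (intro borel_measurable_prod_ennreal)
      fix j assume "j \<in> {..<n}"
      then have Bj: "B j \<in> sets borel" using B by auto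
      have "(\<lambda>w. \<integral>\<^sup>+x. indicator (B j) x \<partial>\<Lambda> w) \<in> borel_measurable P"
        by (rule measurable_from_subalg[OF sub kernel_const]) (use Bj in measurable)
      then have [measurable]: "(\<lambda>w. emeasure (\<Lambda> w) (B j)) \<in> borel_measurable P"
        using Bj by simp
      show "(\<lambda>w. ennreal (poisson_mass (measure (\<Lambda> w) (B j)) (k j))) \<in> borel_measurable P"
        unfolding poisson_mass_def measure_def by measurable
    qed
  qed simp
  finally show "emeasure (density P (indicator A))
         {w \<in> space (density P (indicator A)). \<forall>j<n. point_count N X (B j) w = of_nat (k j)}
          = (\<integral>\<^sup>+w. (\<Prod>j<n. ennreal (poisson_mass (measure (\<Lambda> w) (B j)) (k j))) \<partial>density P (indicator A))"
    by (simp only: E_def Ball_def lessThan_iff space_density)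
qed

lemma cond_laplace_const:
  assumes A: "A \<in> sets F" and h [measurable]: "h \<in> borel_measurable borel"
  shows "(\<integral>\<^sup>+w. indicator A w * ennreal (exp_neg (point_sum (N w) (\<lambda>i. h (X i w)))) \<partial>P)
     = (\<integral>\<^sup>+w. indicator A w * ennreal (exp_neg (\<integral>\<^sup>+x. ennreal (1 - exp_neg (h x)) \<partial>\<Lambda> w)) \<partial>P)"
proof -
  have [measurable]: "A \<in> sets P" using A sub by (auto simp: subalgebra_def)
  have [measurable]: "(\<lambda>w. \<integral>\<^sup>+x. ennreal (1 - exp_neg (h x)) \<partial>\<Lambda> w) \<in> borel_measurable P"
    by (rule measurable_from_subalg[OF sub kernel_const]) measurable
  show ?thesis
    using poisson_laplace[OF poisson_mixture_restrict[OF A] h]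
    by (subst (asm) (1 2) nn_integral_density) measurable
qed

text \<open>The random parameter is discretised from below, on a countable partition into events of \<open>F\<close>.\<close>

lemma cond_laplace:
  fixes C :: "'w \<Rightarrow> real" and h :: "real \<Rightarrow> 'a \<Rightarrow> ennreal"
  assumes A: "A \<in> sets F" and C: "C \<in> borel_measurable F"
    and h [measurable]: "(\<lambda>(c, x). h c x) \<in> borel_measurable (borel \<Otimes>\<^sub>M borel)"
    and mono: "\<And>c c' x. c \<le> c' \<Longrightarrow> h c x \<le> h c' x"
    and cont: "\<And>c c' x. incseq c \<Longrightarrow> c \<longlonglongrightarrow> c' \<Longrightarrow> (\<lambda>n. h (c n) x) \<longlonglongrightarrow> h c' x"
  shows "(\<integral>\<^sup>+w. indicator A w * ennreal (exp_neg (point_sum (N w) (\<lambda>i. h (C w) (X i w)))) \<partial>P)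
     = (\<integral>\<^sup>+w. indicator A w * ennreal (exp_neg (\<integral>\<^sup>+x. ennreal (1 - exp_neg (h (C w) x)) \<partial>\<Lambda> w)) \<partial>P)"
proof -
  have AM [measurable]: "A \<in> sets P" using A sub by (auto simp: subalgebra_def)
  note C[measurable]
  have CP [measurable]: "C \<in> borel_measurable P" by (rule measurable_from_subalg[OF sub C])
  \<comment> \<open>Dyadic rounding down: countably many values, and increasing in \<open>n\<close>,
    as needed because \<open>h\<close> is continuous in its parameter along increasing
    sequences.\<close>
  define D where "D n w = real_of_int \<lfloor>2 ^ n * C w\<rfloor> / 2 ^ n" for n w
  have DF: "D n \<in> borel_measurable F" for n unfolding D_def[abs_def] by measurable
  note this[measurable]
  have DP [measurable]: "D n \<in> borel_measurable P" for n by (rule measurable_from_subalg[OF sub DF])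
  have D_inc: "incseq (\<lambda>n. D n w)" for w
  proof (rule incseq_SucI)
    fix n
    have "2 * \<lfloor>2 ^ n * C w\<rfloor> \<le> \<lfloor>2 ^ Suc n * C w\<rfloor>" by (simp add: le_floor_iff)
    then have "2 * real_of_int \<lfloor>2 ^ n * C w\<rfloor> \<le> real_of_int \<lfloor>2 ^ Suc n * C w\<rfloor>" by linarith
    then show "D n w \<le> D (Suc n) w" by (simp add: D_def field_simps)
  qed
  have D_lim: "(\<lambda>n. D n w) \<longlonglongrightarrow> C w" for w
  proof (rule tendsto_sandwich)
    show "eventually (\<lambda>n. C w - (1/2) ^ n \<le> D n w) sequentially"
    proof (intro always_eventually allI)
      fix n
      have "2 ^ n * C w - 1 \<le> real_of_int \<lfloor>2 ^ n * C w\<rfloor>" by linarith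
      then have "(2 ^ n * C w - 1) / 2 ^ n \<le> D n w"
        unfolding D_def by (rule divide_right_mono) simp
      then show "C w - (1/2) ^ n \<le> D n w" by (simp add: diff_divide_distrib power_divide)
    qed
    show "eventually (\<lambda>n. D n w \<le> C w) sequentially"
    proof (intro always_eventually allI)
      fix n
      have "real_of_int \<lfloor>2 ^ n * C w\<rfloor> \<le> 2 ^ n * C w" by linarith
      then show "D n w \<le> C w" by (simp add: D_def field_simps)
    qed
    have "(\<lambda>n. C w - (1/2) ^ n) \<longlonglongrightarrow> C w - 0"
      by (intro tendsto_diff tendsto_const LIMSEQ_power_zero) simp
    then show "(\<lambda>n. C w - (1/2) ^ n) \<longlonglongrightarrow> C w" by simp
  qed simp
  have hc [measurable]: "h c \<in> borel_measurable borel" for c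
    using measurable_compose[OF measurable_Pair1'[of c borel borel] h] by simp
  define L where "L c w = ennreal (exp_neg (point_sum (N w) (\<lambda>i. h c (X i w))))" for c w
  define R where "R c w = ennreal (exp_neg (\<integral>\<^sup>+x. ennreal (1 - exp_neg (h c x)) \<partial>\<Lambda> w))" for c w
  have [measurable]: "L c \<in> borel_measurable P" for c unfolding L_def[abs_def] by measurable
  have "(\<lambda>w. \<integral>\<^sup>+x. ennreal (1 - exp_neg (h c x)) \<partial>\<Lambda> w) \<in> borel_measurable P" for c
    by (rule measurable_from_subalg[OF sub kernel_const]) measurable
  note this[measurable]
  have [measurable]: "R c \<in> borel_measurable P" for c unfolding R_def[abs_def] by measurable
  have LC [measurable]: "(\<lambda>w. L (C' w) w) \<in> borel_measurable P" if [measurable]: "C' \<in> borel_measurable P" for C'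
  proof -
    have "(\<lambda>w. h (C' w) (X i w)) \<in> borel_measurable P" for i
      using measurable_compose[OF measurable_Pair[OF that X_meas[of i]] h] by simp
    note this[measurable]
    show ?thesis unfolding L_def by measurable
  qed
  have RC: "(\<lambda>w. R (C' w) w) \<in> borel_measurable P" if "C' \<in> borel_measurable F" for C'
  proof -
    have "(\<lambda>w. \<integral>\<^sup>+x. (\<lambda>(c, x). ennreal (1 - exp_neg (h c x))) (C' w, x) \<partial>\<Lambda> w) \<in> borel_measurable P"
      by (rule measurable_from_subalg[OF sub kernel[OF that]]) measurable
    then have [measurable]: "(\<lambda>w. \<integral>\<^sup>+x. ennreal (1 - exp_neg (h (C' w) x)) \<partial>\<Lambda> w) \<in> borel_measurable P"
      by simp
    show ?thesis unfolding R_def by measurable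
  qed
  have L_le: "L c w \<le> 1" and R_le: "R c w \<le> 1" for c w by (simp_all add: L_def R_def)
  have step: "(\<integral>\<^sup>+w. indicator A w * L (D n w) w \<partial>P) = (\<integral>\<^sup>+w. indicator A w * R (D n w) w \<partial>P)" for n
  proof -
    define B where "B m = {w\<in>space P. \<lfloor>2 ^ n * C w\<rfloor> = int_decode m}" for m
    define d where "d m = real_of_int (int_decode m) / 2 ^ n" for m
    have spF: "space F = space P" using sub by (simp add: subalgebra_def)
    have BF: "B m \<in> sets F" for m
      unfolding B_def spF[symmetric] by measurable
    then have BP [measurable]: "B m \<in> sets P" for m using sub by (auto simp: subalgebra_def)
    \<comment> \<open>On \<open>B m\<close> the rounded parameter is the constant
      \<open>d m\<close>, so the case of a deterministic summand applies on the event
      \<open>A \<inter> B m\<close>, which again belongs to \<open>F\<close>. The decoding of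
      integers makes the partition a sequence.\<close>
    have decomp: "(\<integral>\<^sup>+w. indicator A w * G (D n w) w \<partial>P)
       = (\<Sum>m. \<integral>\<^sup>+w. indicator (A \<inter> B m) w * G (d m) w \<partial>P)"
      if [measurable]: "\<And>c. G c \<in> borel_measurable P" for G :: "real \<Rightarrow> 'w \<Rightarrow> ennreal"
    proof -
      have "indicator A w * G (D n w) w = (\<Sum>m. indicator (A \<inter> B m) w * G (d m) w)"
        if "w \<in> space P" for w
      proof -
        define m0 where "m0 = int_encode \<lfloor>2 ^ n * C w\<rfloor>"
        have m0: "w \<in> B m \<longleftrightarrow> m = m0" for m
          using that by (auto simp: B_def m0_def)
        have "(\<Sum>m. indicator (A \<inter> B m) w * G (d m) w) = (\<Sum>m\<in>{m0}. indicator (A \<inter> B m) w * G (d m) w)"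
          by (rule suminf_finite) (auto simp: m0 indicator_def)
        also have "\<dots> = indicator A w * G (D n w) w"
          using m0[of m0] by (auto simp: indicator_def d_def D_def m0_def)
        finally show ?thesis by simp
      qed
      then have "(\<integral>\<^sup>+w. indicator A w * G (D n w) w \<partial>P)
         = (\<integral>\<^sup>+w. (\<Sum>m. indicator (A \<inter> B m) w * G (d m) w) \<partial>P)"
        by (rule nn_integral_cong)
      also have "\<dots> = (\<Sum>m. \<integral>\<^sup>+w. indicator (A \<inter> B m) w * G (d m) w \<partial>P)"
        by (rule nn_integral_suminf) measurable
      finally show ?thesis .
    qed
    have "(\<integral>\<^sup>+w. indicator (A \<inter> B m) w * L (d m) w \<partial>P) = (\<integral>\<^sup>+w. indicator (A \<inter> B m) w * R (d m) w \<partial>P)" for m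
      unfolding L_def R_def by (rule cond_laplace_const) (use A BF in auto)
    then show ?thesis by (simp add: decomp)
  qed
  have conv: "(\<lambda>n. \<integral>\<^sup>+w. indicator A w * G (D n w) w \<partial>P) \<longlonglongrightarrow> (\<integral>\<^sup>+w. indicator A w * G (C w) w \<partial>P)"
    if G: "\<And>n. (\<lambda>w. G (D n w) w) \<in> borel_measurable P" "(\<lambda>w. G (C w) w) \<in> borel_measurable P"
      and G1: "\<And>c w. G c w \<le> 1" and lim: "\<And>w. (\<lambda>n. G (D n w) w) \<longlonglongrightarrow> G (C w) w"
    for G :: "real \<Rightarrow> 'w \<Rightarrow> ennreal"
  proof (rule nn_integral_dominated_convergence[where w="\<lambda>_. 1"])
    show "(\<lambda>w. indicator A w * G (D n w) w) \<in> borel_measurable P" for n using G(1)[of n] by measurable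
    show "(\<lambda>w. indicator A w * G (C w) w) \<in> borel_measurable P" using G(2) by measurable
    show "AE w in P. indicator A w * G (D n w) w \<le> 1" for n
      using G1 by (intro AE_I2) (auto simp: indicator_def)
    show "AE w in P. (\<lambda>n. indicator A w * G (D n w) w) \<longlonglongrightarrow> indicator A w * G (C w) w"
      using lim by (intro AE_I2) (auto simp: indicator_def)
    show "(\<integral>\<^sup>+w. 1 \<partial>P) < \<infinity>" by (simp add: emeasure_space_1)
  qed simp
  have L_lim: "(\<lambda>n. L (D n w) w) \<longlonglongrightarrow> L (C w) w" for w
  proof -
    have inc: "incseq (\<lambda>n. h (D n w) x)" for x using D_inc mono by (simp add: incseq_def)
    have sup: "(SUP n. h (D n w) x) = h (C w) x" for x
      by (rule LIMSEQ_unique[OF LIMSEQ_SUP[OF inc] cont[OF D_inc D_lim]])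
    have "(\<lambda>n. exp_neg (point_sum (N w) (\<lambda>i. h (D n w) (X i w))))
       \<longlonglongrightarrow> exp_neg (SUP n. point_sum (N w) (\<lambda>i. h (D n w) (X i w)))"
      using inc by (intro exp_neg_incseq) (auto simp: incseq_def intro!: point_sum_mono)
    also have "(SUP n. point_sum (N w) (\<lambda>i. h (D n w) (X i w))) = point_sum (N w) (\<lambda>i. h (C w) (X i w))"
      using point_sum_SUP_incseq[of "\<lambda>n i. h (D n w) (X i w)", OF inc] by (simp add: sup)
    finally show ?thesis unfolding L_def by (rule tendsto_ennrealI)
  qed
  have R_lim: "(\<lambda>n. R (D n w) w) \<longlonglongrightarrow> R (C w) w" for w
    unfolding R_def
  proof (rule tendsto_ennrealI, rule tendsto_exp_neg, rule nn_integral_LIMSEQ)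
    show "incseq (\<lambda>n x. ennreal (1 - exp_neg (h (D n w) x)))"
      using D_inc mono by (auto simp: incseq_def le_fun_def intro!: ennreal_leI exp_neg_antimono)
    show "(\<lambda>n. ennreal (1 - exp_neg (h (D n w) x))) \<longlonglongrightarrow> ennreal (1 - exp_neg (h (C w) x))" for x
      by (intro tendsto_ennrealI tendsto_diff tendsto_const tendsto_exp_neg cont[OF D_inc D_lim])
  qed measurable
  have 1: "(\<lambda>n. \<integral>\<^sup>+w. indicator A w * L (D n w) w \<partial>P) \<longlonglongrightarrow> (\<integral>\<^sup>+w. indicator A w * L (C w) w \<partial>P)"
    by (rule conv[OF LC[OF DP] LC[OF CP] L_le L_lim])
  have 2: "(\<lambda>n. \<integral>\<^sup>+w. indicator A w * R (D n w) w \<partial>P) \<longlonglongrightarrow> (\<integral>\<^sup>+w. indicator A w * R (C w) w \<partial>P)"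
    by (rule conv[OF RC[OF DF] RC[OF C] R_le R_lim])
  show ?thesis using LIMSEQ_unique[OF 1[unfolded step] 2] by (simp only: L_def R_def)
qed

end

section \<open>Laplace transforms of the marks\<close>

definition laplace :: "'w measure \<Rightarrow> ('w \<Rightarrow> ennreal) \<Rightarrow> ennreal \<Rightarrow> real" where
  "laplace P Z c = (\<integral>w. exp_neg (c * Z w) \<partial>P)"

lemma exp_neg_inj: "exp_neg a = exp_neg b \<Longrightarrow> a = b"
  by (cases a; cases b) auto

text \<open>The limit is identified after applying \<open>exp_neg\<close>, which is continuous and
  injective. This covers the limit \<open>l' = 0\<close>, where \<open>neg_ln\<close> is infinite,
  together with the others.\<close>

lemma tendsto_neg_ln_decseq:
  assumes "decseq l" "l \<longlonglongrightarrow> l'" "\<And>n. 0 \<le> l n" "\<And>n. l n \<le> 1"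
  shows "(\<lambda>n. neg_ln (l n)) \<longlonglongrightarrow> neg_ln l'"
proof -
  have inc: "incseq (\<lambda>n. neg_ln (l n))"
    using assms(1) by (auto simp: incseq_def decseq_def intro!: neg_ln_antimono)
  have "l' \<le> 1" "0 \<le> l'"
    using assms by (auto intro: LIMSEQ_le_const LIMSEQ_le_const2)
  have "(\<lambda>n. exp_neg (neg_ln (l n))) \<longlonglongrightarrow> exp_neg (SUP n. neg_ln (l n))"
    by (rule exp_neg_incseq[OF inc])
  then have "l \<longlonglongrightarrow> exp_neg (SUP n. neg_ln (l n))"
    using assms by (simp add: exp_neg_neg_ln)
  then have "exp_neg (SUP n. neg_ln (l n)) = exp_neg (neg_ln l')"
    using LIMSEQ_unique[OF assms(2)] \<open>l' \<le> 1\<close> \<open>0 \<le> l'\<close> by (simp add: exp_neg_neg_ln)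
  then have "(SUP n. neg_ln (l n)) = neg_ln l'" by (rule exp_neg_inj)
  then show ?thesis using LIMSEQ_SUP[OF inc] by simp
qed

context prob_space
begin

lemma nn_integral_laplace:
  assumes [measurable]: "Z \<in> borel_measurable M"
  shows "(\<integral>\<^sup>+w. ennreal (exp_neg (c * Z w)) \<partial>M) = ennreal (laplace M Z c)"
  unfolding laplace_def
  by (intro nn_integral_eq_integral integrable_const_bound[where B=1]) auto

lemma laplace_nonneg: "0 \<le> laplace M Z c"
  unfolding laplace_def by (rule Bochner_Integration.integral_nonneg) simp

lemma laplace_le_1:
  assumes [measurable]: "Z \<in> borel_measurable M"
  shows "laplace M Z c \<le> 1"
proof -
  have "ennreal (laplace M Z c) \<le> (\<integral>\<^sup>+w. 1 \<partial>M)"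
    unfolding nn_integral_laplace[OF assms, symmetric] by (intro nn_integral_mono) simp
  then show ?thesis by (simp add: emeasure_space_1 ennreal_le_1)
qed

lemma laplace_0 [simp]: "laplace M Z 0 = 1"
  by (simp add: laplace_def prob_space)

lemma laplace_antimono:
  assumes [measurable]: "Z \<in> borel_measurable M" and "a \<le> b"
  shows "laplace M Z b \<le> laplace M Z a"
proof -
  have "ennreal (laplace M Z b) \<le> ennreal (laplace M Z a)"
    unfolding nn_integral_laplace[OF assms(1), symmetric] using assms(2)
    by (intro nn_integral_mono ennreal_leI exp_neg_antimono mult_right_mono) auto
  then show ?thesis by (simp add: laplace_nonneg)
qed

lemma tendsto_laplace_incseq:
  assumes [measurable]: "Z \<in> borel_measurable M" and inc: "incseq a"
  shows "(\<lambda>n. laplace M Z (a n)) \<longlonglongrightarrow> laplace M Z (SUP n. a n)"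
  unfolding laplace_def
proof (rule integral_dominated_convergence[where w="\<lambda>_. 1"])
  show "AE w in M. (\<lambda>n. exp_neg (a n * Z w)) \<longlonglongrightarrow> exp_neg ((SUP n. a n) * Z w)"
  proof (intro AE_I2)
    fix w
    have "incseq (\<lambda>n. a n * Z w)" using inc by (auto simp: incseq_def intro!: mult_right_mono)
    from exp_neg_incseq[OF this]
    show "(\<lambda>n. exp_neg (a n * Z w)) \<longlonglongrightarrow> exp_neg ((SUP n. a n) * Z w)"
      by (simp add: SUP_mult_right_ennreal)
  qed
qed auto

lemma borel_measurable_laplace [measurable]:
  assumes [measurable]: "Z \<in> borel_measurable M"
  shows "laplace M Z \<in> borel_measurable borel"
  unfolding laplace_def[abs_def] by measurable

lemma laplace_distr:
  assumes [measurable]: "Z \<in> borel_measurable M" "Z' \<in> borel_measurable M"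
    and "distr M borel Z = distr M borel Z'"
  shows "laplace M Z c = laplace M Z' c"
proof -
  have "laplace M Z c = (\<integral>y. exp_neg (c * y) \<partial>distr M borel Z)"
    by (simp add: laplace_def integral_distr)
  also have "\<dots> = laplace M Z' c"
    by (simp add: laplace_def integral_distr assms(3))
  finally show ?thesis .
qed

text \<open>Supplies the continuity in the random parameter that \<open>cond_laplace\<close> asks
  for.\<close>

lemma tendsto_neg_ln_laplace:
  assumes "Z \<in> borel_measurable M" "incseq a" "a \<longlonglongrightarrow> a'"
  shows "(\<lambda>n. neg_ln (laplace M Z (a n))) \<longlonglongrightarrow> neg_ln (laplace M Z a')"
proof (rule tendsto_neg_ln_decseq)
  have "(SUP n. a n) = a'" by (rule LIMSEQ_unique[OF LIMSEQ_SUP[OF assms(2)] assms(3)])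
  then show "(\<lambda>n. laplace M Z (a n)) \<longlonglongrightarrow> laplace M Z a'"
    using tendsto_laplace_incseq[OF assms(1,2)] by simp
  show "decseq (\<lambda>n. laplace M Z (a n))"
    using assms(2) by (auto simp: decseq_def incseq_def intro!: laplace_antimono assms(1))
qed (simp_all add: laplace_nonneg laplace_le_1 assms)

text \<open>Independence of the generated events is the product formula on rectangles, and
  rectangles determine the joint law. This is what opens the way to Fubini when marks are integrated
  out.\<close>

lemma distr_pair_indep_elements:
  assumes ind: "indep_elements M K W L V"
    and [measurable]: "W \<in> measurable M K" "V \<in> measurable M L"
  shows "distr M (K \<Otimes>\<^sub>M L) (\<lambda>w. (W w, V w)) = distr M K W \<Otimes>\<^sub>M distr M L V"
proof (rule pair_measure_eqI[symmetric])
  interpret W: prob_space "distr M K W" by (rule prob_space_distr) measurable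
  interpret V: prob_space "distr M L V" by (rule prob_space_distr) measurable
  show "sigma_finite_measure (distr M K W)" "sigma_finite_measure (distr M L V)" by unfold_locales
  show "sets (distr M K W \<Otimes>\<^sub>M distr M L V) = sets (distr M (K \<Otimes>\<^sub>M L) (\<lambda>w. (W w, V w)))"
    by (simp cong: sets_pair_measure_cong)
  fix A B assume "A \<in> sets (distr M K W)" "B \<in> sets (distr M L V)"
  then have [measurable]: "A \<in> sets K" "B \<in> sets L" by auto
  have "prob ((W -` A \<inter> space M) \<inter> (V -` B \<inter> space M)) = prob (W -` A \<inter> space M) * prob (V -` B \<inter> space M)"
    using ind unfolding indep_elements_def
    by (rule indep_setD) (auto intro!: in_vimage_algebra)
  moreover have "(W -` A \<inter> space M) \<inter> (V -` B \<inter> space M) = (\<lambda>w. (W w, V w)) -` (A \<times> B) \<inter> space M"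
    by auto
  ultimately show "emeasure (distr M K W) A * emeasure (distr M L V) B =
        emeasure (distr M (K \<Otimes>\<^sub>M L) (\<lambda>w. (W w, V w))) (A \<times> B)"
    by (simp add: emeasure_distr emeasure_eq_measure ennreal_mult[symmetric])
qed

text \<open>
  The marks are integrated out first, given the enumerated points and all other randomness \<open>W\<close>.
  The sets \<open>J k\<close> exhaust the index set, which allows several families of marks at once.
\<close>

lemma nn_integral_exp_neg_marks:
  fixes z :: "'i \<Rightarrow> 'l \<Rightarrow> ennreal"
  assumes ind: "indep_elements M K W L V"
    and [measurable]: "W \<in> measurable M K" "V \<in> measurable M L"
    and [measurable]: "\<And>i. z i \<in> borel_measurable L"
    and iid: "indep_vars (\<lambda>_. borel) (\<lambda>i w. z i (V w)) UNIV"
    and J: "\<And>k. finite (J k)" "incseq J"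
    and [measurable]: "\<And>i. c i \<in> borel_measurable K" "u \<in> borel_measurable K"
  shows "(\<integral>\<^sup>+w. u (W w) * ennreal (exp_neg (SUP k::nat. \<Sum>i\<in>J k. c i (W w) * z i (V w))) \<partial>M)
    = (\<integral>\<^sup>+w. u (W w) * ennreal (exp_neg (SUP k. \<Sum>i\<in>J k.
        neg_ln (laplace M (\<lambda>w. z i (V w)) (c i (W w))))) \<partial>M)"
proof -
  interpret V: prob_space "distr M L V" by (rule prob_space_distr) measurable
  let ?lap = "\<lambda>i. laplace M (\<lambda>w. z i (V w))"
  have zV [measurable]: "(\<lambda>w. z i (V w)) \<in> borel_measurable M" for i by measurable
  note borel_measurable_laplace[OF zV, measurable]
  have inc: "incseq (\<lambda>k. \<Sum>i\<in>J k. f i)" for f :: "'i \<Rightarrow> ennreal"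
    using J by (auto simp: incseq_def intro!: sum_mono2)
  \<comment> \<open>With the coefficients frozen at \<open>a\<close>, finite sums factor by
    independence of the marks, and \<open>neg_ln\<close> turns the product of transforms into a sum
    in the exponent. Both sides then converge along \<open>J\<close>.\<close>
  have inner: "(\<integral>\<^sup>+w. ennreal (exp_neg (SUP k. \<Sum>i\<in>J k. a i * z i (V w))) \<partial>M)
      = ennreal (exp_neg (SUP k. \<Sum>i\<in>J k. neg_ln (?lap i (a i))))" for a
  proof (rule LIMSEQ_unique)
    have "(\<integral>\<^sup>+w. ennreal (exp_neg (\<Sum>i\<in>J k. a i * z i (V w))) \<partial>M)
       = ennreal (exp_neg (\<Sum>i\<in>J k. neg_ln (?lap i (a i))))" for k
    proof -
      have "(\<integral>\<^sup>+w. ennreal (exp_neg (\<Sum>i\<in>J k. a i * z i (V w))) \<partial>M)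
         = (\<integral>\<^sup>+w. (\<Prod>i\<in>J k. ennreal (exp_neg (a i * z i (V w)))) \<partial>M)"
        by (simp add: exp_neg_sum prod_ennreal)
      also have "\<dots> = (\<Prod>i\<in>J k. \<integral>\<^sup>+w. ennreal (exp_neg (a i * z i (V w))) \<partial>M)"
      proof (rule indep_vars_nn_integral[OF J(1)])
        show "indep_vars (\<lambda>_. borel) (\<lambda>i w. ennreal (exp_neg (a i * z i (V w)))) (J k)"
          by (rule indep_vars_compose2[OF indep_vars_subset[OF iid subset_UNIV]]) measurable
      qed simp
      also have "\<dots> = ennreal (exp_neg (\<Sum>i\<in>J k. neg_ln (?lap i (a i))))"
        by (simp add: nn_integral_laplace exp_neg_sum exp_neg_neg_ln laplace_nonneg laplace_le_1 prod_ennreal)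
      finally show ?thesis .
    qed
    then show "(\<lambda>k. \<integral>\<^sup>+w. ennreal (exp_neg (\<Sum>i\<in>J k. a i * z i (V w))) \<partial>M)
       \<longlonglongrightarrow> ennreal (exp_neg (SUP k. \<Sum>i\<in>J k. neg_ln (?lap i (a i))))"
      by (simp only:) (intro tendsto_ennrealI exp_neg_incseq inc)
    show "(\<lambda>k. \<integral>\<^sup>+w. ennreal (exp_neg (\<Sum>i\<in>J k. a i * z i (V w))) \<partial>M)
       \<longlonglongrightarrow> (\<integral>\<^sup>+w. ennreal (exp_neg (SUP k. \<Sum>i\<in>J k. a i * z i (V w))) \<partial>M)"
    proof (rule nn_integral_dominated_convergence[where w="\<lambda>_. 1"])
      show "AE w in M. (\<lambda>k. ennreal (exp_neg (\<Sum>i\<in>J k. a i * z i (V w))))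
          \<longlonglongrightarrow> ennreal (exp_neg (SUP k. \<Sum>i\<in>J k. a i * z i (V w)))"
        by (intro AE_I2 tendsto_ennrealI exp_neg_incseq inc)
      show "(\<integral>\<^sup>+w. 1 \<partial>M) < \<infinity>" by (simp add: emeasure_space_1)
      show "(\<lambda>w. ennreal (exp_neg (\<Sum>i\<in>J k. a i * z i (V w)))) \<in> borel_measurable M" for k
        by measurable
      show "(\<lambda>w. ennreal (exp_neg (SUP k. \<Sum>i\<in>J k. a i * z i (V w)))) \<in> borel_measurable M"
        by measurable
      show "AE w in M. ennreal (exp_neg (\<Sum>i\<in>J k. a i * z i (V w))) \<le> 1" for k by simp
    qed simp
  qed
  let ?G = "\<lambda>t v. u t * ennreal (exp_neg (SUP k. \<Sum>i\<in>J k. c i t * z i v))"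
  \<comment> \<open>The joint law of \<open>W\<close> and \<open>V\<close> is a product, so the
    marks can be integrated for a frozen value \<open>t\<close> of \<open>W\<close>.\<close>
  have "(\<integral>\<^sup>+w. ?G (W w) (V w) \<partial>M) = (\<integral>\<^sup>+x. (\<lambda>(t, v). ?G t v) x \<partial>distr M (K \<Otimes>\<^sub>M L) (\<lambda>w. (W w, V w)))"
    by (subst nn_integral_distr) simp_all
  also have "\<dots> = (\<integral>\<^sup>+x. (\<lambda>(t, v). ?G t v) x \<partial>(distr M K W \<Otimes>\<^sub>M distr M L V))"
    by (simp only: distr_pair_indep_elements[OF ind \<open>W \<in> measurable M K\<close> \<open>V \<in> measurable M L\<close>])
  also have "\<dots> = (\<integral>\<^sup>+t. \<integral>\<^sup>+v. ?G t v \<partial>distr M L V \<partial>distr M K W)"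
    by (subst V.nn_integral_fst[symmetric]) simp_all
  also have "\<dots> = (\<integral>\<^sup>+t. u t * ennreal (exp_neg (SUP k. \<Sum>i\<in>J k. neg_ln (?lap i (c i t)))) \<partial>distr M K W)"
  proof (rule nn_integral_cong)
    fix t assume "t \<in> space (distr M K W)"
    have "(\<integral>\<^sup>+v. ?G t v \<partial>distr M L V) = u t * (\<integral>\<^sup>+v. ennreal (exp_neg (SUP k. \<Sum>i\<in>J k. c i t * z i v)) \<partial>distr M L V)"
      by (rule nn_integral_cmult) measurable
    also have "\<dots> = u t * (\<integral>\<^sup>+w. ennreal (exp_neg (SUP k. \<Sum>i\<in>J k. c i t * z i (V w))) \<partial>M)"
      by (subst nn_integral_distr) measurable
    finally show "(\<integral>\<^sup>+v. ?G t v \<partial>distr M L V) = u t * ennreal (exp_neg (SUP k. \<Sum>i\<in>J k. neg_ln (?lap i (c i t))))"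
      by (simp only: inner)
  qed
  also have "\<dots> = (\<integral>\<^sup>+w. u (W w) * ennreal (exp_neg (SUP k. \<Sum>i\<in>J k. neg_ln (?lap i (c i (W w))))) \<partial>M)"
    by (subst nn_integral_distr) measurable
  finally show ?thesis .
qed

text \<open>The random number of points is absorbed into the coefficients: an index beyond it gets
  coefficient 0, where the transform is 1 and hence \<open>neg_ln\<close> is 0. The index set
  becomes deterministic in this way.\<close>

lemma nn_integral_marked_point_sum:
  fixes z :: "nat \<Rightarrow> 'l \<Rightarrow> ennreal" and n :: "'k \<Rightarrow> enat"
  assumes ind: "indep_elements M K W L V"
    and [measurable]: "W \<in> measurable M K" "V \<in> measurable M L"
    and [measurable]: "\<And>i. z i \<in> borel_measurable L"
    and iid: "indep_vars (\<lambda>_. borel) (\<lambda>i w. z i (V w)) UNIV"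
    and lap: "\<And>i a. laplace M (\<lambda>w. z i (V w)) a = \<L> a"
    and [measurable]: "\<And>i. c i \<in> borel_measurable K" "u \<in> borel_measurable K"
      "n \<in> measurable K (count_space UNIV)"
  shows "(\<integral>\<^sup>+w. u (W w) * ennreal (exp_neg (point_sum (n (W w)) (\<lambda>i. c i (W w) * z i (V w)))) \<partial>M)
    = (\<integral>\<^sup>+w. u (W w) * ennreal (exp_neg (point_sum (n (W w)) (\<lambda>i. neg_ln (\<L> (c i (W w)))))) \<partial>M)"
proof -
  define c' where "c' i t = (if enat i < n t then c i t else 0)" for i t
  have [measurable]: "c' i \<in> borel_measurable K" for i unfolding c'_def[abs_def] by measurable
  have 1: "(\<Sum>i<k. if enat i < n t then c i t * y i else 0) = (\<Sum>i<k. c' i t * y i)" for k t y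
    by (intro sum.cong) (auto simp: c'_def)
  have L0: "neg_ln (\<L> 0) = 0" using lap[of _ 0] by (simp add: neg_ln_def)
  have 2: "(\<Sum>i<k. if enat i < n t then neg_ln (\<L> (c i t)) else 0)
      = (\<Sum>i<k. neg_ln (laplace M (\<lambda>w. z i (V w)) (c' i t)))" for k t
    by (intro sum.cong) (auto simp: c'_def lap L0)
  show ?thesis unfolding point_sum_SUP 1 2
    by (rule nn_integral_exp_neg_marks[OF ind]) (auto intro: iid simp: incseq_def)
qed

text \<open>Removes both families in a single step by viewing them as one family indexed by
  \<open>nat + nat\<close>, the form in which their joint independence is assumed for the fading
  gains.\<close>

lemma nn_integral_two_marked_point_sums:
  fixes z z' :: "nat \<Rightarrow> 'l \<Rightarrow> ennreal" and n n' :: "'k \<Rightarrow> enat"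
  assumes ind: "indep_elements M K W L V"
    and [measurable]: "W \<in> measurable M K" "V \<in> measurable M L"
    and [measurable]: "\<And>i. z i \<in> borel_measurable L" "\<And>i. z' i \<in> borel_measurable L"
    and iid: "indep_vars (\<lambda>_. borel) (\<lambda>i w. case_sum z z' i (V w)) UNIV"
    and lap: "\<And>i a. laplace M (\<lambda>w. z i (V w)) a = \<L> a" "\<And>i a. laplace M (\<lambda>w. z' i (V w)) a = \<L>' a"
    and [measurable]: "\<And>i. c i \<in> borel_measurable K" "\<And>i. c' i \<in> borel_measurable K"
      "n \<in> measurable K (count_space UNIV)" "n' \<in> measurable K (count_space UNIV)"
  shows "(\<integral>\<^sup>+w. ennreal (exp_neg (point_sum (n (W w)) (\<lambda>i. c i (W w) * z i (V w)) +
             point_sum (n' (W w)) (\<lambda>i. c' i (W w) * z' i (V w)))) \<partial>M)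
    = (\<integral>\<^sup>+w. ennreal (exp_neg (point_sum (n (W w)) (\<lambda>i. neg_ln (\<L> (c i (W w)))) +
             point_sum (n' (W w)) (\<lambda>i. neg_ln (\<L>' (c' i (W w)))))) \<partial>M)"
proof -
  define d where "d = case_sum (\<lambda>i t. if enat i < n t then c i t else 0) (\<lambda>i t. if enat i < n' t then c' i t else 0)"
  \<comment> \<open>Initial segments of both copies grow together, so one supremum covers the two
    partial sums.\<close>
  define J :: "nat \<Rightarrow> (nat + nat) set" where "J k = {..<k} <+> {..<k}" for k
  have J: "finite (J k)" "incseq J" for k unfolding J_def by (auto simp: incseq_def)
  have dm: "d i \<in> borel_measurable K" for i unfolding d_def by (cases i) simp_all
  have zm: "case_sum z z' i \<in> borel_measurable L" for i by (cases i) simp_all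
  have split: "(SUP k. \<Sum>i<k. f i) + (SUP k. \<Sum>i<k. g i) = (SUP k. \<Sum>i\<in>J k. case_sum f g i)"
    for f g :: "nat \<Rightarrow> ennreal"
  proof -
    have "(\<Sum>i\<in>J k. case_sum f g i) = (\<Sum>i<k. f i) + (\<Sum>i<k. g i)" for k
      unfolding J_def by (simp add: sum.Plus)
    then show ?thesis by (simp add: ennreal_SUP_add incseq_partial_sum)
  qed
  have L0: "neg_ln (\<L> 0) = 0" "neg_ln (\<L>' 0) = 0"
    using lap(1)[of _ 0] lap(2)[of _ 0] by (simp_all add: neg_ln_def)
  have 1: "point_sum (n t) (\<lambda>i. c i t * y i) + point_sum (n' t) (\<lambda>i. c' i t * y' i)
      = (SUP k. \<Sum>i\<in>J k. d i t * case_sum y y' i)" for t y y'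
    unfolding point_sum_SUP split
    by (intro SUP_cong sum.cong refl) (auto simp: d_def split: sum.split)
  have 2: "point_sum (n t) (\<lambda>i. neg_ln (\<L> (c i t))) + point_sum (n' t) (\<lambda>i. neg_ln (\<L>' (c' i t)))
      = (SUP k. \<Sum>i\<in>J k. neg_ln (laplace M (\<lambda>w. case_sum z z' i (V w)) (d i t)))" for t
    unfolding point_sum_SUP split
    by (intro SUP_cong sum.cong refl) (auto simp: d_def lap L0 split: sum.split)
  have 3: "case_sum (\<lambda>i. z i v) (\<lambda>i. z' i v) i = case_sum z z' i v" for i v by (cases i) simp_all
  show ?thesis unfolding 1 2 3
    using nn_integral_exp_neg_marks[OF ind \<open>W \<in> measurable M K\<close> \<open>V \<in> measurable M L\<close> zm iid J dm, of "\<lambda>_. 1"]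
    by simp
qed

text \<open>Tilting a gamma density of rate \<open>b\<close> by \<open>exp (- c * x)\<close> gives a
  multiple of the one of rate \<open>b + c\<close>, which is the original density rescaled by
  \<open>q = (b + c) / b\<close>. A linear substitution finishes the computation.\<close>

lemma laplace_gamma:
  assumes Y: "distributed M lborel Y (gamma_density k b)" and k: "0 < k" and b: "0 < b" and c: "0 \<le> c"
  shows "laplace M (\<lambda>w. ennreal (Y w)) (ennreal c) = (1 + c / b) powr (- k)"
proof -
  have [measurable]: "Y \<in> borel_measurable M" using distributed_measurable[OF Y] by simp
  have [measurable]: "gamma_density k b \<in> borel_measurable borel" for b
    unfolding gamma_density_def[abs_def] by measurable
  define q where "q = (b + c) / b"
  have q: "0 < q" using b c by (simp add: q_def)
  have G: "0 < Gamma k" using k by (rule Gamma_real_pos)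
  interpret D: prob_space "density lborel (gamma_density k b)"
    unfolding distributed_distr_eq_density[OF Y, symmetric]
    by (rule prob_space_distr) (use distributed_measurable[OF Y] in simp)
  \<comment> \<open>The total mass 1 is inherited from the law of \<open>Y\<close>, so the Gamma
    integral is not evaluated.\<close>
  have one: "(\<integral>\<^sup>+x. ennreal (gamma_density k b x) \<partial>lborel) = 1"
    using D.emeasure_space_1 by (simp add: emeasure_density)
  have "ennreal (laplace M (\<lambda>w. ennreal (Y w)) (ennreal c)) = (\<integral>\<^sup>+w. ennreal (exp_neg (ennreal c * ennreal (Y w))) \<partial>M)"
    by (rule nn_integral_laplace[symmetric]) measurable
  also have "\<dots> = (\<integral>\<^sup>+x. ennreal (gamma_density k b x) * ennreal (exp_neg (ennreal c * ennreal x)) \<partial>lborel)"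
    using Y by (rule distributed_nn_integral[symmetric]) measurable
  also have "\<dots> = (\<integral>\<^sup>+x. ennreal (q powr (- k)) * (ennreal q * ennreal (gamma_density k b (q * x))) \<partial>lborel)"
  proof (rule nn_integral_cong)
    fix x :: real
    show "ennreal (gamma_density k b x) * ennreal (exp_neg (ennreal c * ennreal x))
       = ennreal (q powr (- k)) * (ennreal q * ennreal (gamma_density k b (q * x)))"
    proof (cases "x \<le> 0")
      case False
      then have "gamma_density k b (q * x) = b powr k * (q powr (k - 1) * x powr (k - 1)) * exp (- (b + c) * x) / Gamma k"
      proof -
        have "\<not> q * x \<le> 0" using q False by (simp add: mult_le_0_iff)
        moreover have "b * q = b + c" using b by (simp add: q_def)
        then have "- b * (q * x) = - (b + c) * x" by (metis minus_mult_left mult.assoc)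
        ultimately show ?thesis
          using q False unfolding gamma_density_def by (simp only: powr_mult if_False)
      qed
      also have "q powr (- k) * (q * (b powr k * (q powr (k - 1) * x powr (k - 1)) * exp (- (b + c) * x) / Gamma k))
          = (q powr (- k) * q powr 1 * q powr (k - 1)) * (b powr k * x powr (k - 1) * exp (- (b + c) * x) / Gamma k)"
        using q by simp
      finally have "q powr (- k) * (q * gamma_density k b (q * x))
          = (q powr (- k) * q powr 1 * q powr (k - 1)) * (b powr k * x powr (k - 1) * exp (- (b + c) * x) / Gamma k)"
        by simp
      also have "q powr (- k) * q powr 1 * q powr (k - 1) = 1"
        unfolding powr_add[symmetric] using q by simp
      also have "b powr k * x powr (k - 1) * exp (- (b + c) * x) / Gamma k = gamma_density k b x * exp (- (c * x))"
        using False by (simp add: gamma_density_def exp_add[symmetric] algebra_simps)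
      finally have *: "q powr (- k) * (q * gamma_density k b (q * x)) = gamma_density k b x * exp (- (c * x))" by simp
      have pos: "0 \<le> gamma_density k b y" for y using G by (simp add: gamma_density_def)
      show ?thesis using * False c q pos by (simp add: ennreal_mult[symmetric])
    next
      case True
      then show ?thesis using q by (simp add: gamma_density_def mult_nonneg_nonpos)
    qed
  qed
  also have "\<dots> = ennreal (q powr (- k)) * (ennreal q * (\<integral>\<^sup>+x. ennreal (gamma_density k b (0 + q * x)) \<partial>lborel))"
    by (simp add: nn_integral_cmult)
  also have "ennreal q * (\<integral>\<^sup>+x. ennreal (gamma_density k b (0 + q * x)) \<partial>lborel) = (\<integral>\<^sup>+x. ennreal (gamma_density k b x) \<partial>lborel)"
    using nn_integral_real_affine[of "\<lambda>x. ennreal (gamma_density k b x)" q 0] q by simp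
  finally have "laplace M (\<lambda>w. ennreal (Y w)) (ennreal c) = q powr (- k)"
    by (simp add: one laplace_nonneg)
  then show ?thesis using b by (simp add: q_def add_divide_distrib)
qed

text \<open>The exponential law is the gamma law of shape 1; the two densities differ at the point 0
  only.\<close>

lemma laplace_exponential:
  assumes Y: "distributed M lborel Y (exponential_density (1 / \<sigma>))" and \<sigma>: "0 < \<sigma>" and c: "0 \<le> c"
  shows "laplace M (\<lambda>w. ennreal (Y w)) (ennreal c) = 1 / (1 + c * \<sigma>)"
proof -
  have [measurable]: "gamma_density 1 b \<in> borel_measurable borel" for b
    unfolding gamma_density_def[abs_def] by measurable
  have "density lborel (exponential_density (1 / \<sigma>)) = density lborel (gamma_density 1 (1 / \<sigma>))"
  proof (rule density_cong)
    show "AE x in lborel. ennreal (exponential_density (1 / \<sigma>) x) = ennreal (gamma_density 1 (1 / \<sigma>) x)"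
      using AE_lborel_singleton[of 0]
      by eventually_elim (use \<sigma> in \<open>auto simp: exponential_density_def gamma_density_def\<close>)
  qed measurable
  then have "distributed M lborel Y (gamma_density 1 (1 / \<sigma>))"
    using Y by (simp add: distributed_def)
  from laplace_gamma[OF this _ _ c] show ?thesis
    using \<sigma> c by (simp add: powr_minus_divide add_pos_nonneg)
qed

end

section \<open>Polar coordinates\<close>

text \<open>On the half-lines \<open>{..a}\<close>, which generate the Borel sets, both sides give
  the area of the disc of radius \<open>a\<close>.\<close>

lemma distr_norm_plane:
  "distr lborel borel (norm :: plane \<Rightarrow> real) = density lborel (\<lambda>r. ennreal (2 * pi * r) * indicator {0..} r)"
proof (rule measure_eqI_generator_eq[where E="range (\<lambda>a. {..a::real})" and \<Omega>=UNIV and A="\<lambda>i. {..real i}"])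
  have em: "emeasure (distr lborel borel (norm :: plane \<Rightarrow> real)) {..a} = ennreal (if 0 \<le> a then pi * a\<^sup>2 else 0)" for a
  proof -
    have "emeasure (distr lborel borel (norm :: plane \<Rightarrow> real)) {..a} = emeasure lborel (cball (0::plane) a)"
      by (subst emeasure_distr) (auto intro!: arg_cong[where f="emeasure lborel"] simp: dist_norm)
    also have "\<dots> = ennreal (if 0 \<le> a then pi * a\<^sup>2 else 0)"
      by (simp add: emeasure_cball unit_ball_vol_2)
    finally show ?thesis .
  qed
  then show "emeasure (distr lborel borel (norm :: plane \<Rightarrow> real)) {..real i} \<noteq> \<infinity>" for i by simp
  fix X assume "X \<in> range (\<lambda>a. {..a::real})"
  then obtain a where X: "X = {..a}" by auto
  have "emeasure (density lborel (\<lambda>r. ennreal (2 * pi * r) * indicator {0..} r)) {..a}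
     = (\<integral>\<^sup>+r. ennreal (2 * pi * r) * indicator {0..a} r \<partial>lborel)"
    by (subst emeasure_density) (auto intro!: nn_integral_cong simp: indicator_def)
  also have "\<dots> = ennreal (if 0 \<le> a then pi * a\<^sup>2 else 0)"
  proof (cases "0 \<le> a")
    case True
    have "(\<integral>\<^sup>+r. ennreal (2 * pi * r) * indicator {0..a} r \<partial>lborel) = ennreal (pi * a\<^sup>2 - pi * 0\<^sup>2)"
      by (rule nn_integral_FTC_Icc[where F="\<lambda>r. pi * r\<^sup>2"]) (auto intro!: derivative_eq_intros simp: True)
    then show ?thesis using True by simp
  qed simp
  finally show "emeasure (distr lborel borel (norm :: plane \<Rightarrow> real)) X
     = emeasure (density lborel (\<lambda>r. ennreal (2 * pi * r) * indicator {0..} r)) X"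
    by (simp only: X em)
next
  show "(\<Union>i. {..real i}) = UNIV" using real_arch_simple by auto
  show "sets (distr lborel borel (norm :: plane \<Rightarrow> real)) = sigma_sets UNIV (range (\<lambda>a. {..a::real}))"
    "sets (density lborel (\<lambda>r. ennreal (2 * pi * r) * indicator {0..} r)) = sigma_sets UNIV (range (\<lambda>a. {..a::real}))"
    by (simp_all add: borel_eq_atMost)
qed (auto simp: Int_stable_def)

lemma nn_integral_norm_plane:
  assumes [measurable]: "g \<in> borel_measurable borel"
  shows "(\<integral>\<^sup>+x. g (norm (x::plane)) \<partial>lborel) = (\<integral>\<^sup>+r\<in>{0..}. g r * ennreal (2 * pi * r) \<partial>lborel)"
proof -
  have "(\<integral>\<^sup>+x. g (norm (x::plane)) \<partial>lborel) = (\<integral>\<^sup>+r. g r \<partial>distr lborel borel (norm :: plane \<Rightarrow> real))"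
    by (subst nn_integral_distr) simp_all
  also have "\<dots> = (\<integral>\<^sup>+r. (ennreal (2 * pi * r) * indicator {0..} r) * g r \<partial>lborel)"
    unfolding distr_norm_plane by (rule nn_integral_density) measurable
  finally show ?thesis by (simp add: mult_ac)
qed

lemma nn_integral_outside_intensity:
  assumes [measurable]: "u \<in> borel_measurable borel" "f \<in> borel_measurable borel" and R: "0 \<le> R"
  shows "(\<integral>\<^sup>+x. u (norm x) \<partial>outside_intensity R f)
     = (\<integral>\<^sup>+r\<in>{R..}. ennreal (f r) * u r * ennreal (2 * pi * r) \<partial>lborel)"
proof -
  have "(\<integral>\<^sup>+x. u (norm x) \<partial>outside_intensity R f)
     = (\<integral>\<^sup>+x. ennreal (if norm (x::plane) > R then f (norm x) else 0) * u (norm x) \<partial>lborel)"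
    unfolding outside_intensity_def by (subst nn_integral_density) measurable
  also have "\<dots> = (\<integral>\<^sup>+r\<in>{0..}. ennreal (if r > R then f r else 0) * u r * ennreal (2 * pi * r) \<partial>lborel)"
    by (rule nn_integral_norm_plane[of "\<lambda>r. ennreal (if r > R then f r else 0) * u r"]) measurable
  also have "\<dots> = (\<integral>\<^sup>+r\<in>{R..}. ennreal (f r) * u r * ennreal (2 * pi * r) \<partial>lborel)"
    \<comment> \<open>The intensity lives on the open set \<open>norm x > R\<close>, the radial
      integrals include the endpoint \<open>R\<close>; the difference is a null set.\<close>
    using AE_lborel_singleton[of R] R
    by (intro nn_integral_cong_AE) (auto simp: indicator_def)
  finally show ?thesis .
qed

lemma sets_outside_intensity [simp, measurable_cong]: "sets (outside_intensity R f) = sets borel"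
  by (simp add: outside_intensity_def)

text \<open>Written against Lebesgue measure, the random radius moves from the measure into the
  integrand, and measurability follows from Fubini.\<close>

lemma kernel_outside_intensity:
  fixes Rv C :: "'w \<Rightarrow> real"
  assumes [measurable]: "Rv \<in> borel_measurable F" "C \<in> borel_measurable F"
    "u \<in> borel_measurable (borel \<Otimes>\<^sub>M borel)" "f \<in> borel_measurable borel"
  shows "(\<lambda>w. \<integral>\<^sup>+x. u (C w, x) \<partial>outside_intensity (Rv w) f) \<in> borel_measurable F"
proof -
  have "(\<integral>\<^sup>+x. u (C w, x) \<partial>outside_intensity (Rv w) f)
     = (\<integral>\<^sup>+x. ennreal (if norm (x::plane) > Rv w then f (norm x) else 0) * u (C w, x) \<partial>lborel)" for w
    unfolding outside_intensity_def by (subst nn_integral_density) measurable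
  then show ?thesis by simp
qed

lemma finite_outside_intensity:
  assumes [measurable]: "f \<in> borel_measurable borel" and f: "\<And>r. 0 \<le> r \<Longrightarrow> f r \<le> K"
    and B: "B \<in> sets borel" "bounded B"
  shows "emeasure (outside_intensity R f) B < \<infinity>"
proof -
  have "emeasure (outside_intensity R f) B = (\<integral>\<^sup>+x. ennreal (if norm x > R then f (norm x) else 0) * indicator B x \<partial>lborel)"
    unfolding outside_intensity_def by (rule emeasure_density) (use B in simp_all)
  also have "\<dots> \<le> (\<integral>\<^sup>+x. ennreal (max 0 K) * indicator B x \<partial>lborel)"
    by (intro nn_integral_mono mult_right_mono ennreal_leI) (auto intro: order_trans[OF f])
  also have "\<dots> = ennreal (max 0 K) * emeasure lborel B"
    using B by (subst nn_integral_cmult_indicator) auto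
  also have "\<dots> < \<infinity>"
    using emeasure_bounded_finite[OF B(2)] by (simp add: ennreal_mult_less_top)
  finally show ?thesis .
qed

section \<open>Events generated by the counts\<close>

text \<open>Conditional independence of two processes is stated for the events of their counts. The
  last part connects this with sums over the points: indicators give counts, and the closure steps
  of the induction on \<open>h\<close> are compatible with \<open>point_sum\<close>.\<close>

lemma
  fixes X :: "nat \<Rightarrow> 'w \<Rightarrow> 'a::metric_space"
  assumes [measurable]: "N \<in> measurable P (count_space UNIV)" "\<And>i. X i \<in> borel_measurable P"
  shows sets_process_events: "sets (sigma (space P) (process_events P N X)) = process_events P N X"
    and subalgebra_process_events: "subalgebra P (sigma (space P) (process_events P N X))"
    and borel_measurable_process_events: "h \<in> borel_measurable borel \<Longrightarrow>
      (\<lambda>w. point_sum (N w) (\<lambda>i. h (X i w))) \<in> borel_measurable (sigma (space P) (process_events P N X))"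
proof -
  let ?E = "\<Union>B\<in>sets borel. events_of P borel (point_count N X B)"
  let ?S = "sigma (space P) (process_events P N X)"
  have EP: "?E \<subseteq> sets P"
    by (auto simp: sets_vimage_algebra2 intro!: measurable_sets[of _ P borel])
  then have PP: "process_events P N X \<subseteq> sets P"
    unfolding process_events_def by (rule sets.sigma_sets_subset)
  then have Pow: "process_events P N X \<subseteq> Pow (space P)" using sets.space_closed[of P] by blast
  show S: "sets ?S = process_events P N X"
    using Pow EP sets.space_closed[of P] by (simp add: process_events_def sigma_sets_sigma_sets_eq)
  show "subalgebra P ?S"
    unfolding subalgebra_def S using PP Pow by (simp add: space_measure_of)
  assume "h \<in> borel_measurable borel"
  then show "(\<lambda>w. point_sum (N w) (\<lambda>i. h (X i w))) \<in> borel_measurable ?S"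
  proof (induction rule: borel_measurable_induct)
    case (cong f g)
    then have "f = g" by auto
    with cong show ?case by simp
  next
    case (set B)
    have "(\<lambda>w. point_sum (N w) (\<lambda>i. indicator B (X i w))) = point_count N X B"
      by (simp add: point_count_def fun_eq_iff)
    moreover have "point_count N X B \<in> borel_measurable ?S"
    proof (rule measurableI)
      fix A :: "ennreal set" assume A: "A \<in> sets borel"
      have "point_count N X B -` A \<inter> space P \<in> ?E"
        using set A by (auto intro!: bexI[of _ B] in_vimage_algebra)
      then show "point_count N X B -` A \<inter> space ?S \<in> sets ?S"
        unfolding S using Pow by (simp add: process_events_def space_measure_of sigma_sets.Basic)
    qed simp
    ultimately show ?case by simp
  next
    case (mult u c)
    then show ?case by (simp add: point_sum_cmult)
  next
    case (add u v)
    have "point_sum n (\<lambda>i. v (x i) + u (x i)) = point_sum n (\<lambda>i. v (x i)) + point_sum n (\<lambda>i. u (x i))" for n x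
    proof -
      \<comment> \<open>A sum of two terms is read as a finite sum over \<open>bool\<close>, so that
        \<open>point_sum_sum\<close> applies.\<close>
      have "point_sum n (\<lambda>i. \<Sum>b\<in>UNIV. if b then v (x i) else u (x i)) = (\<Sum>b\<in>UNIV. point_sum n (\<lambda>i. if b then v (x i) else u (x i)))"
        by (rule point_sum_sum)
      then show ?thesis by (simp add: UNIV_bool add.commute)
    qed
    then show ?case using add by simp
  next
    case (seq U)
    have "point_sum (N w) (\<lambda>i. (SUP k. U k) (X i w)) = (SUP k. point_sum (N w) (\<lambda>i. U k (X i w)))" for w
      using point_sum_SUP_incseq[of "\<lambda>k i. U k (X i w)" "N w"] seq
      by (simp add: incseq_def le_fun_def image_image)
    moreover have "(\<lambda>w. SUP k. point_sum (N w) (\<lambda>i. U k (X i w))) \<in> borel_measurable ?S"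
      by (rule borel_measurable_SUP) (use seq in auto)
    ultimately show ?case by (simp only:)
  qed
qed

lemma measurable_seq_space:
  "(\<And>i. X i \<in> borel_measurable M) \<Longrightarrow> (\<lambda>w i. X i w) \<in> measurable M seq_space"
  by (rule measurable_PiM_single') auto

lemma sets_vimage_algebraE:
  assumes "f \<in> measurable M K" "A \<in> sets (vimage_algebra (space M) f K)"
  obtains B where "B \<in> sets K" "A = f -` B \<inter> space M"
proof -
  have "f \<in> space M \<rightarrow> space K" using measurable_space[OF assms(1)] by auto
  then show thesis using assms(2) that by (auto simp: sets_vimage_algebra2)
qed

lemma vimage_compose_in_events_of:
  assumes Y: "Y \<in> measurable M K" and f: "f \<in> measurable K K'" and A: "A \<in> sets K'"
  shows "(\<lambda>w. f (Y w)) -` A \<inter> space M \<in> events_of M K Y"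
proof -
  have "(\<lambda>w. f (Y w)) -` A \<inter> space M = Y -` (f -` A \<inter> space K) \<inter> space M"
    using measurable_space[OF Y] by auto
  then show ?thesis using in_vimage_algebra[OF measurable_sets[OF f A]] by simp
qed

lemma subalgebra_vimage_algebra:
  assumes "f \<in> measurable M K"
  shows "subalgebra M (vimage_algebra (space M) f K)"
  using assms by (auto simp: subalgebra_def elim!: sets_vimage_algebraE[OF assms])

section \<open>Laplace transforms of the clutter and of the interference sums\<close>

lemma (in prob_space) laplace_distributed_cong:
  assumes Y: "distributed M lborel Y f" "distributed M lborel Y' f"
  shows "laplace M (\<lambda>w. ennreal (Y w)) a = laplace M (\<lambda>w. ennreal (Y' w)) a"
proof (rule laplace_distr)
  have [measurable]: "Y \<in> borel_measurable M" "Y' \<in> borel_measurable M"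
    using distributed_measurable[OF Y(1)] distributed_measurable[OF Y(2)] by simp_all
  have "distr M borel Y = distr M borel Y'"
    using distributed_distr_eq_density[OF Y(1)] distributed_distr_eq_density[OF Y(2)]
    by (simp cong: distr_cong)
  then have "distr (distr M borel Y) borel ennreal = distr (distr M borel Y') borel ennreal" by simp
  then show "distr M borel (\<lambda>w. ennreal (Y w)) = distr M borel (\<lambda>w. ennreal (Y' w))"
    by (simp add: distr_distr comp_def)
  show "(\<lambda>w. ennreal (Y w)) \<in> borel_measurable M" "(\<lambda>w. ennreal (Y' w)) \<in> borel_measurable M"
    by measurable
qed

text \<open>The sum is compound Poisson: its transform is the exponential of minus the mean number
  \<open>l * a\<close> of scatterers in the cell, times one minus the transform of a single
  cross-section.\<close>

lemma (in prob_space) laplace_clutter: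
  fixes X :: "nat \<Rightarrow> 'a \<Rightarrow> plane"
  assumes process: "poisson_process M N X (density lborel (\<lambda>_. ennreal l))"
    and A: "A \<in> sets borel" "emeasure lborel A = ennreal a" "0 \<le> a" and l: "0 \<le> l"
    and law: "\<And>i. distributed M lborel (Y i) (exponential_density (1 / \<sigma>))" and \<sigma>: "0 < \<sigma>"
    and iid: "indep_vars (\<lambda>_. borel) Y UNIV"
    and ind: "indep_elements M enum_space (\<lambda>w. (N w, \<lambda>i. X i w)) seq_space (\<lambda>w i. Y i w)"
    and t: "0 \<le> t"
  shows "laplace M (\<lambda>w. point_sum (N w) (\<lambda>i. indicator A (X i w) * ennreal (Y i w))) (ennreal t)
     = exp (- l * a * (t * \<sigma> / (1 + t * \<sigma>)))"
proof -
  have [measurable]: "N \<in> measurable M (count_space UNIV)" "X i \<in> borel_measurable M" for i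
    using process by (auto simp: poisson_process_def)
  have [measurable]: "Y i \<in> borel_measurable M" for i using distributed_measurable[OF law[of i]] by simp
  note A(1)[measurable]
  let ?\<Lambda> = "density lborel (\<lambda>_. ennreal l) :: plane measure"
  let ?S = "\<lambda>w. point_sum (N w) (\<lambda>i. indicator A (X i w) * ennreal (Y i w))"
  define \<L> where "\<L> = laplace M (\<lambda>w. ennreal (Y 0 w))"
  have [measurable]: "\<L> \<in> borel_measurable borel" unfolding \<L>_def by (rule borel_measurable_laplace) measurable
  have lap: "laplace M (\<lambda>w. ennreal (Y i w)) b = \<L> b" for i b
    unfolding \<L>_def by (rule laplace_distributed_cong[OF law law])
  have \<L>_01: "0 \<le> \<L> b" "\<L> b \<le> 1" for b
    unfolding \<L>_def by (auto intro: laplace_nonneg laplace_le_1)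
  \<comment> \<open>An unconditional Poisson process is the mixture with constant intensity, because
    the total mass is 1.\<close>
  have mixture: "poisson_mixture M N X (\<lambda>_. ?\<Lambda>)"
    unfolding poisson_mixture_def
  proof (intro conjI allI impI ballI)
    fix n :: nat and B :: "nat \<Rightarrow> plane set" and k :: "nat \<Rightarrow> nat"
    assume B: "(\<forall>j<n. B j \<in> sets borel \<and> bounded (B j)) \<and> disjoint_family_on B {..<n}"
    have "measure M {w \<in> space M. \<forall>j<n. point_count N X (B j) w = of_nat (k j)}
          = (\<Prod>j<n. poisson_mass (measure ?\<Lambda> (B j)) (k j))"
      by (rule process[unfolded poisson_process_def, THEN conjunct2, THEN conjunct2, rule_format])
         (use B in auto)
    then show "emeasure M {w \<in> space M. \<forall>j<n. point_count N X (B j) w = of_nat (k j)}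
          = (\<integral>\<^sup>+w. (\<Prod>j<n. ennreal (poisson_mass (measure ?\<Lambda> (B j)) (k j))) \<partial>M)"
      by (simp add: emeasure_eq_measure prod_ennreal poisson_mass_def prob_space)
  next
    fix w :: 'a and B :: "plane set" assume B: "B \<in> sets borel \<and> bounded B"
    then have "emeasure ?\<Lambda> B = ennreal l * emeasure lborel B"
      by (simp add: emeasure_density_const)
    then show "emeasure ?\<Lambda> B < \<infinity>"
      using emeasure_bounded_finite[of B] B by (simp add: ennreal_mult_less_top)
  qed (auto intro: finite_measure_axioms)
  have [measurable]: "(\<lambda>w. (N w, \<lambda>i. X i w)) \<in> measurable M enum_space"
    "(\<lambda>w i. Y i w) \<in> measurable M seq_space"
    by (intro measurable_Pair measurable_seq_space; measurable)+
  have Lt: "\<L> (ennreal t) = 1 / (1 + t * \<sigma>)"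
    unfolding \<L>_def by (rule laplace_exponential[OF law \<sigma> t])
  have "(\<integral>\<^sup>+w. ennreal (exp_neg (ennreal t * ?S w)) \<partial>M)
     = (\<integral>\<^sup>+w. 1 * ennreal (exp_neg (point_sum (fst (N w, \<lambda>i. X i w)) (\<lambda>i.
           (ennreal t * indicator A (snd (N w, \<lambda>i. X i w) i)) * ennreal (Y i w)))) \<partial>M)"
    by (simp add: point_sum_cmult[symmetric] mult.assoc)
  also have "\<dots> = (\<integral>\<^sup>+w. 1 * ennreal (exp_neg (point_sum (fst (N w, \<lambda>i. X i w)) (\<lambda>i.
           neg_ln (\<L> (ennreal t * indicator A (snd (N w, \<lambda>i. X i w) i)))))) \<partial>M)"
    by (rule nn_integral_marked_point_sum[OF ind, where z="\<lambda>i v. ennreal (v i)" and u="\<lambda>_. 1"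
          and c="\<lambda>i w. ennreal t * indicator A (snd w i)"])
       (auto intro!: lap indep_vars_compose2[OF iid])
  also have "\<dots> = (\<integral>\<^sup>+w. ennreal (exp_neg (\<integral>\<^sup>+x. ennreal (1 - exp_neg (neg_ln (\<L> (ennreal t * indicator A x)))) \<partial>?\<Lambda>)) \<partial>M)"
    using poisson_laplace[OF mixture, of "\<lambda>x. neg_ln (\<L> (ennreal t * indicator A x))"] by simp
  \<comment> \<open>Outside \<open>A\<close> the argument of \<open>\<L>\<close> is 0 and
    \<open>\<L> 0 = 1\<close>, so only the cell contributes.\<close>
  also have "(\<integral>\<^sup>+x. ennreal (1 - exp_neg (neg_ln (\<L> (ennreal t * indicator A x)))) \<partial>?\<Lambda>)
     = (\<integral>\<^sup>+x. ennreal (1 - \<L> (ennreal t)) * indicator A x \<partial>?\<Lambda>)"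
    by (intro nn_integral_cong)
       (use lap[of _ 0] in \<open>simp add: exp_neg_neg_ln \<L>_01 indicator_def\<close>)
  also have "\<dots> = ennreal ((1 - \<L> (ennreal t)) * (l * a))"
    using A l \<L>_01 by (simp add: nn_integral_cmult_indicator emeasure_density_const ennreal_mult[symmetric])
  finally have "ennreal (laplace M ?S (ennreal t)) = ennreal (exp (- ((1 - \<L> (ennreal t)) * (l * a))))"
    using A l \<L>_01 by (subst nn_integral_laplace[symmetric]) (simp_all add: emeasure_space_1)
  then have "laplace M ?S (ennreal t) = exp (- ((1 - \<L> (ennreal t)) * (l * a)))"
    by (simp add: laplace_nonneg)
  also have "1 - \<L> (ennreal t) = t * \<sigma> / (1 + t * \<sigma>)"
  proof -
    have "0 < 1 + t * \<sigma>" using t \<sigma> by (simp add: add_pos_nonneg)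
    then show ?thesis unfolding Lt by (simp add: field_simps)
  qed
  finally show ?thesis by (simp add: mult_ac)
qed

text \<open>Removing the marks leaves a sum over the points whose summand depends on
  \<open>\<beta>\<close> through the scalar \<open>cos (\<beta> w / 2)\<close>, the situation of
  \<open>cond_laplace\<close>. The event \<open>A\<close> is carried along because the result has to
  determine a conditional expectation given \<open>(R, \<beta>)\<close>.\<close>

lemma (in prob_space) cond_laplace_shot_noise:
  fixes X :: "nat \<Rightarrow> 'a \<Rightarrow> plane" and z :: "nat \<Rightarrow> 'l \<Rightarrow> ennreal"
  defines "F \<equiv> \<lambda>R \<beta>. vimage_algebra (space M) (\<lambda>w. (R w, \<beta> w)) (borel \<Otimes>\<^sub>M borel)"
  assumes R [measurable]: "R \<in> borel_measurable M" and \<beta> [measurable]: "\<beta> \<in> borel_measurable M"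
    and process: "cond_poisson_process M (F R \<beta>) N X (\<lambda>w. outside_intensity (R w) f)"
    and f: "f \<in> borel_measurable borel" "\<And>r. 0 \<le> r \<Longrightarrow> f r \<le> B"
    and ind: "indep_elements M ((borel \<Otimes>\<^sub>M borel) \<Otimes>\<^sub>M enum_space)
                (\<lambda>w. ((R w, \<beta> w), (N w, \<lambda>i. X i w))) L V"
    and V [measurable]: "V \<in> measurable M L" "\<And>i. z i \<in> borel_measurable L"
    and iid: "indep_vars (\<lambda>_. borel) (\<lambda>i w. z i (V w)) UNIV"
    and Z: "Z \<in> borel_measurable M" and lap: "\<And>i a. laplace M (\<lambda>w. z i (V w)) a = laplace M Z a"
    and s: "0 \<le> s"
    and A: "A \<in> sets (F R \<beta>)"
  shows "(\<integral>\<^sup>+w. indicator A w * ennreal (exp_neg (ennreal s * point_sum (N w) (\<lambda>i.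
             ennreal (cos (\<beta> w / 2) * norm (X i w) powr (- \<eta>)) * z i (V w)))) \<partial>M)
    = (\<integral>\<^sup>+w. indicator A w * ennreal (exp_neg (\<integral>\<^sup>+x. ennreal (1 -
             laplace M Z (ennreal s * ennreal (cos (\<beta> w / 2) * norm x powr (- \<eta>)))) \<partial>outside_intensity (R w) f)) \<partial>M)"
proof -
  let ?F = "F R \<beta>"
  have pm: "(\<lambda>w. (R w, \<beta> w)) \<in> measurable M (borel \<Otimes>\<^sub>M borel)" by measurable
  have sub: "subalgebra M ?F"
    unfolding F_def by (rule subalgebra_vimage_algebra[OF pm])
  have pF: "(\<lambda>w. (R w, \<beta> w)) \<in> measurable ?F (borel \<Otimes>\<^sub>M borel)"
    unfolding F_def by (rule measurable_vimage_algebra1) (auto simp: space_pair_measure)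
  have RF [measurable]: "R \<in> borel_measurable ?F" using measurable_compose[OF pF measurable_fst] by simp
  have bF [measurable]: "\<beta> \<in> borel_measurable ?F" using measurable_compose[OF pF measurable_snd] by simp
  interpret C: cond_poisson M ?F N X "\<lambda>w. outside_intensity (R w) f"
    by unfold_locales
      (rule sub process sets_outside_intensity finite_outside_intensity[OF f]
        kernel_outside_intensity[OF RF _ _ f(1)]; assumption)+
  define \<L> where "\<L> = laplace M Z"
  have [measurable]: "\<L> \<in> borel_measurable borel" unfolding \<L>_def by (rule borel_measurable_laplace[OF Z])
  \<comment> \<open>\<open>A\<close> is the preimage of a set of values of
    \<open>(R, \<beta>)\<close>, so its indicator is a function of \<open>?W\<close> and can serve
    as the weight \<open>u\<close>.\<close>
  obtain A' where A': "A' \<in> sets (borel \<Otimes>\<^sub>M borel)" "A = (\<lambda>w. (R w, \<beta> w)) -` A' \<inter> space M"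
    using A unfolding F_def by (rule sets_vimage_algebraE[OF pm])
  note A'(1)[measurable]
  let ?W = "\<lambda>w. ((R w, \<beta> w), (N w, \<lambda>i. X i w))"
  have [measurable]: "?W \<in> measurable M ((borel \<Otimes>\<^sub>M borel) \<Otimes>\<^sub>M enum_space)"
    by (intro measurable_Pair measurable_seq_space) measurable
  let ?c = "\<lambda>i w. ennreal s * ennreal (cos (snd (fst w) / 2) * norm (snd (snd w) i) powr (- \<eta>))"
  have "(\<integral>\<^sup>+w. indicator A w * ennreal (exp_neg (ennreal s * point_sum (N w) (\<lambda>i.
             ennreal (cos (\<beta> w / 2) * norm (X i w) powr (- \<eta>)) * z i (V w)))) \<partial>M)
      = (\<integral>\<^sup>+w. indicator A' (fst (?W w)) * ennreal (exp_neg (point_sum (fst (snd (?W w))) (\<lambda>i.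
             ?c i (?W w) * z i (V w)))) \<partial>M)"
    by (intro nn_integral_cong) (simp add: point_sum_cmult[symmetric] mult.assoc A'(2) indicator_def)
  also have "\<dots> = (\<integral>\<^sup>+w. indicator A' (fst (?W w)) * ennreal (exp_neg (point_sum (fst (snd (?W w))) (\<lambda>i.
             neg_ln (\<L> (?c i (?W w)))))) \<partial>M)"
    by (rule nn_integral_marked_point_sum[OF ind _ _ _ iid, where u="\<lambda>w. indicator A' (fst w)"
          and n="\<lambda>w. fst (snd w)" and c="?c"]) (auto simp: lap \<L>_def)
  also have "\<dots> = (\<integral>\<^sup>+w. indicator A w * ennreal (exp_neg (point_sum (N w) (\<lambda>i.
             neg_ln (\<L> (ennreal s * ennreal (cos (\<beta> w / 2) * norm (X i w) powr (- \<eta>))))))) \<partial>M)"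
    by (intro nn_integral_cong) (simp add: A'(2) indicator_def)
  also have "\<dots> = (\<integral>\<^sup>+w. indicator A w * ennreal (exp_neg (\<integral>\<^sup>+x. ennreal (1 - exp_neg
             (neg_ln (\<L> (ennreal s * ennreal (cos (\<beta> w / 2) * norm x powr (- \<eta>)))))) \<partial>outside_intensity (R w) f)) \<partial>M)"
  \<comment> \<open>Negative parameters \<open>c\<close> are cut off by \<open>ennreal\<close>, so
    the summand is monotone and continuous in \<open>c\<close> on the whole line: transforms
    decrease in their argument and \<open>neg_ln\<close> reverses the order.\<close>
  proof (rule C.cond_laplace[OF A, where C="\<lambda>w. cos (\<beta> w / 2)"
        and h="\<lambda>c x. neg_ln (\<L> (ennreal s * ennreal (c * norm x powr (- \<eta>))))"])
    show "(\<lambda>w. cos (\<beta> w / 2)) \<in> borel_measurable ?F" by measurable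
    show "(\<lambda>(c, x). neg_ln (\<L> (ennreal s * ennreal (c * norm x powr (- \<eta>))))) \<in> borel_measurable (borel \<Otimes>\<^sub>M borel)"
      by measurable
    show "neg_ln (\<L> (ennreal s * ennreal (c * norm x powr (- \<eta>)))) \<le> neg_ln (\<L> (ennreal s * ennreal (c' * norm x powr (- \<eta>))))"
      if "c \<le> c'" for c c' and x :: plane
      unfolding \<L>_def using that
      by (intro neg_ln_antimono laplace_antimono Z mult_left_mono ennreal_leI mult_right_mono) auto
    show "(\<lambda>n. neg_ln (\<L> (ennreal s * ennreal (c n * norm x powr (- \<eta>)))))
        \<longlonglongrightarrow> neg_ln (\<L> (ennreal s * ennreal (c' * norm x powr (- \<eta>))))"
      if c: "incseq c" "c \<longlonglongrightarrow> c'" for c c' and x :: plane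
      unfolding \<L>_def
    proof (rule tendsto_neg_ln_laplace[OF Z])
      show "incseq (\<lambda>n. ennreal s * ennreal (c n * norm x powr (- \<eta>)))"
        using c(1) by (auto simp: incseq_def intro!: mult_left_mono ennreal_leI mult_right_mono)
      show "(\<lambda>n. ennreal s * ennreal (c n * norm x powr (- \<eta>))) \<longlonglongrightarrow> ennreal s * ennreal (c' * norm x powr (- \<eta>))"
        by (intro ennreal_tendsto_cmult tendsto_ennrealI tendsto_mult c tendsto_const) simp
    qed
  qed
  finally show ?thesis
    by (simp add: exp_neg_neg_ln \<L>_def laplace_nonneg laplace_le_1 Z)
qed

lemma (in prob_space) indep_elements_compose:
  assumes ind: "indep_elements M K W L V" and W: "W \<in> measurable M K" and f: "f \<in> measurable K K'"
  shows "indep_elements M K' (\<lambda>w. f (W w)) L V"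
  unfolding indep_elements_def indep_set_def
proof (rule indep_sets_mono_sets[OF ind[unfolded indep_elements_def indep_set_def]])
  fix b :: bool assume "b \<in> UNIV"
  have "events_of M K' (\<lambda>w. f (W w)) \<subseteq> events_of M K W"
  proof
    fix A assume "A \<in> events_of M K' (\<lambda>w. f (W w))"
    then obtain B where B: "B \<in> sets K'" "A = (\<lambda>w. f (W w)) -` B \<inter> space M"
      by (rule sets_vimage_algebraE[OF measurable_compose[OF W f]])
    then show "A \<in> events_of M K W"
      using vimage_compose_in_events_of[OF W f] by blast
  qed
  then show "case_bool (events_of M K' (\<lambda>w. f (W w))) (events_of M L V) b
     \<subseteq> case_bool (events_of M K W) (events_of M L V) b"
    by (cases b) auto
qed

text \<open>Given \<open>R\<close>, independence is available for the events of the counts only.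
  Hence the gains of both families are integrated out first; what remains are sums of the
  deterministic functions \<open>uL\<close> and \<open>uN\<close> over the points, measurable with
  respect to these events, and they can be separated.\<close>

lemma (in prob_space) laplace_direct_interference:
  fixes XL XN :: "nat \<Rightarrow> 'a \<Rightarrow> plane"
  defines "F \<equiv> \<lambda>R. vimage_algebra (space M) R borel"
  assumes R [measurable]: "R \<in> borel_measurable M"
    and L: "cond_poisson_process M (F R) NL XL (\<lambda>w. outside_intensity (R w) fL)"
    and N: "cond_poisson_process M (F R) NN XN (\<lambda>w. outside_intensity (R w) fN)"
    and fL: "fL \<in> borel_measurable borel" "\<And>r. 0 \<le> r \<Longrightarrow> fL r \<le> BL"
    and fN: "fN \<in> borel_measurable borel" "\<And>r. 0 \<le> r \<Longrightarrow> fN r \<le> BN"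
    and L_N: "cond_indep_sets M (F R) (process_events M NL XL) (process_events M NN XN)"
    and iid: "indep_vars (\<lambda>_. borel) (case_sum hL hN) UNIV"
    and lapL: "\<And>i a. laplace M (\<lambda>w. ennreal (hL i w)) a = laplace M (\<lambda>w. ennreal (hL 0 w)) a"
    and lapN: "\<And>i a. laplace M (\<lambda>w. ennreal (hN i w)) a = laplace M (\<lambda>w. ennreal (hN 0 w)) a"
    and ind: "indep_elements M (borel \<Otimes>\<^sub>M enum_space \<Otimes>\<^sub>M enum_space)
           (\<lambda>w. (R w, (NL w, \<lambda>i. XL i w), (NN w, \<lambda>i. XN i w)))
           (seq_space \<Otimes>\<^sub>M seq_space) (\<lambda>w. (\<lambda>i. hL i w, \<lambda>i. hN i w))"
    and g [measurable]: "gL \<in> borel_measurable borel" "gN \<in> borel_measurable borel"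
    and s: "0 \<le> s"
  shows "(\<integral>\<^sup>+w. ennreal (exp_neg (ennreal s *
            (point_sum (NL w) (\<lambda>i. ennreal (gL (norm (XL i w))) * ennreal (hL i w)) +
             point_sum (NN w) (\<lambda>i. ennreal (gN (norm (XN i w))) * ennreal (hN i w))))) \<partial>M)
    = (\<integral>\<^sup>+w. ennreal (exp_neg (\<integral>\<^sup>+x. ennreal (1 - laplace M (\<lambda>w. ennreal (hL 0 w))
              (ennreal s * ennreal (gL (norm x)))) \<partial>outside_intensity (R w) fL)) *
            ennreal (exp_neg (\<integral>\<^sup>+x. ennreal (1 - laplace M (\<lambda>w. ennreal (hN 0 w))
              (ennreal s * ennreal (gN (norm x)))) \<partial>outside_intensity (R w) fN)) \<partial>M)"
proof -
  let ?F = "F R"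
  have sub: "subalgebra M ?F" unfolding F_def by (rule subalgebra_vimage_algebra[OF R])
  have RF [measurable]: "R \<in> borel_measurable ?F"
    unfolding F_def by (rule measurable_vimage_algebra1) auto
  interpret L: cond_poisson M ?F NL XL "\<lambda>w. outside_intensity (R w) fL"
    by unfold_locales
      (rule sub L sets_outside_intensity finite_outside_intensity[OF fL]
        kernel_outside_intensity[OF RF _ _ fL(1)]; assumption)+
  interpret N: cond_poisson M ?F NN XN "\<lambda>w. outside_intensity (R w) fN"
    by unfold_locales
      (rule sub N sets_outside_intensity finite_outside_intensity[OF fN]
        kernel_outside_intensity[OF RF _ _ fN(1)]; assumption)+
  have "case_sum hL hN i \<in> borel_measurable M" for i
    using indep_vars_def[THEN iffD1, OF iid] by blast
  from this[of "Inl _"] this[of "Inr _"]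
  have hm [measurable]: "hL i \<in> borel_measurable M" "hN i \<in> borel_measurable M" for i
    by simp_all
  define LL where "LL = laplace M (\<lambda>w. ennreal (hL 0 w))"
  define LN where "LN = laplace M (\<lambda>w. ennreal (hN 0 w))"
  have [measurable]: "LL \<in> borel_measurable borel" unfolding LL_def by (rule borel_measurable_laplace) measurable
  have [measurable]: "LN \<in> borel_measurable borel" unfolding LN_def by (rule borel_measurable_laplace) measurable
  have LL_01: "exp_neg (neg_ln (LL a)) = LL a" for a
    unfolding LL_def by (intro exp_neg_neg_ln laplace_nonneg laplace_le_1) measurable
  have LN_01: "exp_neg (neg_ln (LN a)) = LN a" for a
    unfolding LN_def by (intro exp_neg_neg_ln laplace_nonneg laplace_le_1) measurable
  define uL where "uL x = neg_ln (LL (ennreal s * ennreal (gL (norm x))))" for x :: plane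
  define uN where "uN x = neg_ln (LN (ennreal s * ennreal (gN (norm x))))" for x :: plane
  have [measurable]: "uL \<in> borel_measurable borel" "uN \<in> borel_measurable borel"
    unfolding uL_def[abs_def] uN_def[abs_def] by measurable
  let ?W = "\<lambda>w. (R w, (NL w, \<lambda>i. XL i w), (NN w, \<lambda>i. XN i w))"
  let ?V = "\<lambda>w. (\<lambda>i. hL i w, \<lambda>i. hN i w)"
  have Wm [measurable]: "?W \<in> measurable M (borel \<Otimes>\<^sub>M enum_space \<Otimes>\<^sub>M enum_space)"
    by (intro measurable_Pair measurable_seq_space) measurable
  have Vm [measurable]: "?V \<in> measurable M (seq_space \<Otimes>\<^sub>M seq_space)"
    by (intro measurable_Pair measurable_seq_space) measurable
  let ?cL = "\<lambda>i w. ennreal s * ennreal (gL (norm (snd (fst (snd w)) i)))"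
  let ?cN = "\<lambda>i w. ennreal s * ennreal (gN (norm (snd (snd (snd w)) i)))"
  let ?zL = "\<lambda>i v. ennreal (fst v i)" and ?zN = "\<lambda>i v. ennreal (snd v i)"
  have iid': "indep_vars (\<lambda>_. borel) (\<lambda>i w. case_sum ?zL ?zN i (?V w)) UNIV"
  proof -
    have "(\<lambda>w. case_sum ?zL ?zN i (?V w)) = (\<lambda>w. ennreal (case_sum hL hN i w))" for i
      by (cases i) simp_all
    then show ?thesis using indep_vars_compose2[OF iid, of "\<lambda>_. ennreal" "\<lambda>_. borel"] by simp
  qed
  let ?SL = "sigma (space M) (process_events M NL XL)" and ?SN = "sigma (space M) (process_events M NN XN)"
  let ?PL = "\<lambda>w. point_sum (NL w) (\<lambda>i. uL (XL i w))" and ?PN = "\<lambda>w. point_sum (NN w) (\<lambda>i. uN (XN i w))"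
  let ?KL = "\<lambda>w. \<integral>\<^sup>+x. ennreal (1 - exp_neg (uL x)) \<partial>outside_intensity (R w) fL"
  let ?KN = "\<lambda>w. \<integral>\<^sup>+x. ennreal (1 - exp_neg (uN x)) \<partial>outside_intensity (R w) fN"
  have cm: "ennreal s * point_sum n (\<lambda>i. a i * b i) = point_sum n (\<lambda>i. ennreal s * a i * b i)" for n a b
    by (simp add: point_sum_cmult[symmetric] mult.assoc)
  have "(\<integral>\<^sup>+w. ennreal (exp_neg (ennreal s *
            (point_sum (NL w) (\<lambda>i. ennreal (gL (norm (XL i w))) * ennreal (hL i w)) +
             point_sum (NN w) (\<lambda>i. ennreal (gN (norm (XN i w))) * ennreal (hN i w))))) \<partial>M)
      = (\<integral>\<^sup>+w. ennreal (exp_neg (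
             point_sum (fst (fst (snd (?W w)))) (\<lambda>i. ?cL i (?W w) * ?zL i (?V w)) +
             point_sum (fst (snd (snd (?W w)))) (\<lambda>i. ?cN i (?W w) * ?zN i (?V w)))) \<partial>M)"
    by (intro nn_integral_cong arg_cong[where f="\<lambda>x. ennreal (exp_neg x)"])
       (simp only: distrib_left cm fst_conv snd_conv)
  also have "\<dots> = (\<integral>\<^sup>+w. ennreal (exp_neg (
             point_sum (fst (fst (snd (?W w)))) (\<lambda>i. neg_ln (LL (?cL i (?W w)))) +
             point_sum (fst (snd (snd (?W w)))) (\<lambda>i. neg_ln (LN (?cN i (?W w)))))) \<partial>M)"
  proof (rule nn_integral_two_marked_point_sums[where z="?zL" and z'="?zN" and \<L>=LL and \<L>'=LN
          and c="?cL" and c'="?cN" and W="?W" and V="?V"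
          and n="\<lambda>w. fst (fst (snd w))" and n'="\<lambda>w. fst (snd (snd w))", OF ind Wm Vm _ _ iid'])
    show "laplace M (\<lambda>w. ?zL i (?V w)) a = LL a" for i a using lapL[of i a] by (simp add: LL_def)
    show "laplace M (\<lambda>w. ?zN i (?V w)) a = LN a" for i a using lapN[of i a] by (simp add: LN_def)
  qed measurable
  also have "\<dots> = (\<integral>\<^sup>+w. ennreal (exp_neg (?PL w)) *
             ennreal (exp_neg (?PN w)) \<partial>M)"
    by (simp add: exp_neg_add ennreal_mult uL_def uN_def)
  also have "\<dots> = (\<integral>\<^sup>+w. ennreal (exp_neg (?KL w)) *
             ennreal (exp_neg (?KN w)) \<partial>M)"
  \<comment> \<open>\<open>?KL\<close> and \<open>?KN\<close> are functions of \<open>R\<close>, and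
    \<open>cond_laplace_const\<close> identifies their \<open>exp_neg\<close> as the conditional
    transforms of the two factors.\<close>
  proof (rule nn_integral_cond_indep[OF _ sub, where MA="?SL"
        and MB="?SN"])
    show "prob_space M" by unfold_locales
    show "subalgebra M ?SL"
      by (rule subalgebra_process_events) measurable
    show "subalgebra M ?SN"
      by (rule subalgebra_process_events) measurable
    have "sets ?SL = process_events M NL XL"
      by (rule sets_process_events) measurable
    moreover have "sets ?SN = process_events M NN XN"
      by (rule sets_process_events) measurable
    ultimately show "cond_indep_sets M ?F (sets ?SL)
        (sets ?SN)" using L_N by simp
    have "?PL \<in> borel_measurable ?SL"
      by (rule borel_measurable_process_events) measurable
    then show "(\<lambda>w. ennreal (exp_neg (?PL w)))
        \<in> borel_measurable ?SL" by measurable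
    have "?PN \<in> borel_measurable ?SN"
      by (rule borel_measurable_process_events) measurable
    then show "(\<lambda>w. ennreal (exp_neg (?PN w)))
        \<in> borel_measurable ?SN" by measurable
    have "?KL \<in> borel_measurable ?F"
      by (rule L.kernel_const) measurable
    then show "(\<lambda>w. ennreal (exp_neg (?KL w)))
        \<in> borel_measurable ?F" by measurable
    have "?KN \<in> borel_measurable ?F"
      by (rule N.kernel_const) measurable
    then show "(\<lambda>w. ennreal (exp_neg (?KN w)))
        \<in> borel_measurable ?F" by measurable
  qed (rule L.cond_laplace_const N.cond_laplace_const; simp)+
  finally show ?thesis by (simp add: uL_def uN_def LL_01 LN_01) (simp add: LL_def LN_def)
qed

section \<open>From the tail of an exponential variable to a Laplace transform\<close>

lemma (in prob_space) prob_less_exponential: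
  fixes Y :: "'a \<Rightarrow> ennreal"
  assumes \<sigma>: "distributed M lborel \<sigma> (exponential_density l)" "0 < l"
    and ind: "indep_var borel (\<lambda>w. ennreal (\<sigma> w)) borel Y"
  shows "emeasure M {w\<in>space M. Y w < ennreal (\<sigma> w)} = (\<integral>\<^sup>+w. ennreal (exp_neg (ennreal l * Y w)) \<partial>M)"
proof -
  have [measurable]: "Y \<in> borel_measurable M" using ind by (rule indep_var_rv2)
  have [measurable]: "\<sigma> \<in> borel_measurable M" using distributed_measurable[OF \<sigma>(1)] by simp
  \<comment> \<open>At \<open>y = top\<close> the event is empty and \<open>exp_neg\<close>
    vanishes, so the tail formula survives an infinite denominator.\<close>
  have tail: "emeasure M {w\<in>space M. y < ennreal (\<sigma> w)} = ennreal (exp_neg (ennreal l * y))" for y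
  proof (cases y)
    case (real d)
    have "{w\<in>space M. y < ennreal (\<sigma> w)} = {w\<in>space M. d < \<sigma> w}"
    proof (intro Collect_cong conj_cong refl)
      show "y < ennreal (\<sigma> w) \<longleftrightarrow> d < \<sigma> w" for w
        using real by (cases "0 \<le> \<sigma> w") (auto simp: ennreal_less_iff ennreal_neg)
    qed
    then show ?thesis
      using exponential_distributedD_gt[OF \<sigma>(1) real(1) \<sigma>(2)] real \<sigma>(2)
      by (simp add: emeasure_eq_measure ennreal_mult[symmetric] mult.commute)
  next
    case top
    then show ?thesis using \<sigma>(2) by (simp add: ennreal_mult_top)
  qed
  interpret S: prob_space "distr M borel (\<lambda>w. ennreal (\<sigma> w))" by (rule prob_space_distr) measurable
  interpret Y: prob_space "distr M borel Y" by (rule prob_space_distr) measurable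
  interpret pair_sigma_finite "distr M borel (\<lambda>w. ennreal (\<sigma> w))" "distr M borel Y" ..
  have "emeasure M {w\<in>space M. Y w < ennreal (\<sigma> w)}
     = (\<integral>\<^sup>+w. indicator {w\<in>space M. Y w < ennreal (\<sigma> w)} w \<partial>M)"
    by (rule nn_integral_indicator[symmetric]) measurable
  also have "\<dots> = (\<integral>\<^sup>+w. (if Y w < ennreal (\<sigma> w) then 1 else 0) \<partial>M)"
    by (intro nn_integral_cong) (simp add: indicator_def)
  also have "\<dots> = (\<integral>\<^sup>+x. (if snd x < fst x then 1 else 0) \<partial>distr M (borel \<Otimes>\<^sub>M borel) (\<lambda>w. (ennreal (\<sigma> w), Y w)))"
    by (subst nn_integral_distr) simp_all
  also have "\<dots> = (\<integral>\<^sup>+x. (if snd x < fst x then 1 else 0) \<partial>(distr M borel (\<lambda>w. ennreal (\<sigma> w)) \<Otimes>\<^sub>M distr M borel Y))"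
    using indep_var_distribution_eq[THEN iffD1, OF ind] by simp
  also have "\<dots> = (\<integral>\<^sup>+y. \<integral>\<^sup>+x. (if y < x then 1 else 0) \<partial>distr M borel (\<lambda>w. ennreal (\<sigma> w)) \<partial>distr M borel Y)"
    by (subst nn_integral_snd[symmetric]) simp_all
  also have "\<dots> = (\<integral>\<^sup>+y. ennreal (exp_neg (ennreal l * y)) \<partial>distr M borel Y)"
  proof (rule nn_integral_cong)
    fix y :: ennreal
    have "(\<integral>\<^sup>+x. (if y < x then 1 else 0) \<partial>distr M borel (\<lambda>w. ennreal (\<sigma> w)))
       = (\<integral>\<^sup>+w. indicator {w\<in>space M. y < ennreal (\<sigma> w)} w \<partial>M)"
    proof (subst nn_integral_distr)
      show "(\<integral>\<^sup>+w. (if y < ennreal (\<sigma> w) then 1 else 0) \<partial>M)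
         = (\<integral>\<^sup>+w. indicator {w\<in>space M. y < ennreal (\<sigma> w)} w \<partial>M)"
        by (intro nn_integral_cong) (simp add: indicator_def)
    qed measurable
    then show "(\<integral>\<^sup>+x. (if y < x then 1 else 0) \<partial>distr M borel (\<lambda>w. ennreal (\<sigma> w)))
       = ennreal (exp_neg (ennreal l * y))"
      by (simp add: tail)
  qed
  also have "\<dots> = (\<integral>\<^sup>+w. ennreal (exp_neg (ennreal l * Y w)) \<partial>M)"
    by (subst nn_integral_distr) simp_all
  finally show ?thesis .
qed

section \<open>The closed forms as integrals over the plane\<close>

text \<open>One radial integral in two normalisations: \<open>L_IC\<close> keeps
  \<open>2 * pi * r\<close> under the integral in its second factor, while the other three factors
  of the closed forms have \<open>2 * pi\<close> in front.\<close>

lemma nn_integral_outside_intensity_scaled: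
  assumes [measurable]: "k \<in> borel_measurable borel" "\<phi> \<in> borel_measurable borel"
    and k: "\<And>r. 0 \<le> r \<Longrightarrow> 0 \<le> k r" and \<phi>: "\<And>r. 0 \<le> r \<Longrightarrow> 0 \<le> \<phi> r" and R: "0 \<le> R"
    and l: "0 \<le> l" "0 < D"
  shows "(\<integral>\<^sup>+x. ennreal (\<phi> (norm x)) \<partial>outside_intensity R (\<lambda>r. k r * l / D))
     = ennreal (l / D) * (\<integral>\<^sup>+r\<in>{R..}. ennreal (k r * \<phi> r * (2 * pi * r)) \<partial>lborel)"
    and "(\<integral>\<^sup>+x. ennreal (\<phi> (norm x)) \<partial>outside_intensity R (\<lambda>r. k r * l / D))
     = ennreal (2 * pi * l / D) * (\<integral>\<^sup>+r\<in>{R..}. ennreal (k r * \<phi> r * r) \<partial>lborel)"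
proof -
  have *: "(\<integral>\<^sup>+x. ennreal (\<phi> (norm x)) \<partial>outside_intensity R (\<lambda>r. k r * l / D))
     = (\<integral>\<^sup>+r\<in>{R..}. ennreal (k r * l / D) * ennreal (\<phi> r) * ennreal (2 * pi * r) \<partial>lborel)"
    by (rule nn_integral_outside_intensity[OF _ _ R, of "\<lambda>r. ennreal (\<phi> r)"]) measurable
  have scale: "(\<integral>\<^sup>+r\<in>{R..}. ennreal (k r * l / D) * ennreal (\<phi> r) * ennreal (2 * pi * r) \<partial>lborel)
     = ennreal c * (\<integral>\<^sup>+r\<in>{R..}. ennreal (w r) \<partial>lborel)"
    if w [measurable]: "w \<in> borel_measurable borel" and c: "0 \<le> c"
      and eq: "\<And>r. 0 \<le> r \<Longrightarrow> 0 \<le> w r \<and> c * w r = (k r * l / D) * \<phi> r * (2 * pi * r)" for c w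
  proof -
    have "ennreal (k r * l / D) * ennreal (\<phi> r) * ennreal (2 * pi * r) * indicator {R..} r
       = ennreal c * (ennreal (w r) * indicator {R..} r)" for r
    proof (cases "R \<le> r")
      case True
      then have r: "0 \<le> r" using R by simp
      have "ennreal (k r * l / D) * ennreal (\<phi> r) * ennreal (2 * pi * r) = ennreal ((k r * l / D) * \<phi> r * (2 * pi * r))"
        using k[OF r] \<phi>[OF r] l r by (subst (1 2) ennreal_mult) simp_all
      also have "\<dots> = ennreal c * ennreal (w r)"
        using eq[OF r] c by (subst ennreal_mult[symmetric]) simp_all
      finally show ?thesis using True by simp
    qed simp
    then show ?thesis by (simp add: nn_integral_cmult)
  qed
  show "(\<integral>\<^sup>+x. ennreal (\<phi> (norm x)) \<partial>outside_intensity R (\<lambda>r. k r * l / D))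
     = ennreal (l / D) * (\<integral>\<^sup>+r\<in>{R..}. ennreal (k r * \<phi> r * (2 * pi * r)) \<partial>lborel)"
    unfolding * by (rule scale) (use k \<phi> l in \<open>measurable, simp_all\<close>)
  show "(\<integral>\<^sup>+x. ennreal (\<phi> (norm x)) \<partial>outside_intensity R (\<lambda>r. k r * l / D))
     = ennreal (2 * pi * l / D) * (\<integral>\<^sup>+r\<in>{R..}. ennreal (k r * \<phi> r * r) \<partial>lborel)"
    unfolding * by (rule scale) (use k \<phi> l in \<open>measurable, simp_all\<close>)
qed

lemma borel_measurable_nn_integral_atLeast:
  assumes [measurable]: "a \<in> borel_measurable K" "(\<lambda>(x, r). u x r) \<in> borel_measurable (K \<Otimes>\<^sub>M borel)"
  shows "(\<lambda>x. \<integral>\<^sup>+r\<in>{a x..}. u x (r::real) \<partial>lborel) \<in> borel_measurable K"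
proof -
  have "(\<lambda>x. \<integral>\<^sup>+r. u x r * (if a x \<le> r then 1 else 0) \<partial>lborel) \<in> borel_measurable K"
    by measurable
  then show ?thesis by (simp add: indicator_def)
qed

text \<open>In the divergent case both sides are 0 by convention, so the closed forms may be moved
  to [0,\<infinity>] before their finiteness is known.\<close>

lemma set_LINT_eq_enn2real:
  fixes G :: "real \<Rightarrow> real"
  assumes [measurable]: "A \<in> sets borel" "G \<in> borel_measurable borel" and G: "\<And>x. x \<in> A \<Longrightarrow> 0 \<le> G x"
  shows "(LINT x:A|lborel. G x) = enn2real (\<integral>\<^sup>+x\<in>A. ennreal (G x) \<partial>lborel)"
proof -
  have "(LINT x:A|lborel. G x) = enn2real (\<integral>\<^sup>+x. ennreal (indicator A x * G x) \<partial>lborel)"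
    unfolding set_lebesgue_integral_def real_scaleR_def
    by (rule integral_eq_nn_integral) (use G in \<open>auto simp: indicator_def\<close>)
  also have "(\<integral>\<^sup>+x. ennreal (indicator A x * G x) \<partial>lborel) = (\<integral>\<^sup>+x\<in>A. ennreal (G x) \<partial>lborel)"
    by (intro nn_integral_cong) (simp add: indicator_def)
  finally show ?thesis .
qed

lemma borel_measurable_p_LOS [measurable]: "p_LOS p \<in> borel_measurable borel"
  unfolding p_LOS_def[abs_def] by measurable

text \<open>\<open>H\<close> stands for the conditional transform given the radius, in whatever form
  the probabilistic side delivers it. It has to match the closed form for nonnegative radii only,
  the density being 0 elsewhere.\<close>

lemma L_D_eq_enn2real:
  fixes s :: real
  defines "e1 \<equiv> \<lambda>p R. exp_neg (ennreal (2 * pi * lam_BS p / (real (M_div p))\<^sup>2) *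
         (\<integral>\<^sup>+ r\<in>{R..}. ennreal (p_LOS p r *
            (1 - (1 + s * P_c p * (G_m p)\<^sup>2 * C_L p * r powr (- eta_L p) / m_L p) powr (- m_L p)) * r)
            \<partial>lborel))"
  defines "e2 \<equiv> \<lambda>p R. exp_neg (ennreal (2 * pi * lam_BS p / (real (M_div p))\<^sup>2) *
         (\<integral>\<^sup>+ r\<in>{R..}. ennreal ((1 - p_LOS p r) *
            (1 - (1 + s * P_c p * (G_m p)\<^sup>2 * C_N p * r powr (- eta_N p) / m_N p) powr (- m_N p)) * r)
            \<partial>lborel))"
  assumes p: "valid_params p" and H: "\<And>R. 0 \<le> R \<Longrightarrow> H R = ennreal (e1 p R * e2 p R)"
  shows "L_D p s = enn2real (\<integral>\<^sup>+R. ennreal (R_d_density p R) * H R \<partial>lborel)"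
proof -
  have l: "0 < lam_BS p" using p by (simp add: valid_params_def)
  have [measurable]: "e1 p \<in> borel_measurable borel" "e2 p \<in> borel_measurable borel"
    unfolding e1_def e2_def
    by (intro measurable_compose[OF _ borel_measurable_exp_neg] borel_measurable_times_ennreal
        borel_measurable_const borel_measurable_nn_integral_atLeast; measurable)+
  have e: "0 \<le> e1 p R" "0 \<le> e2 p R" for R by (simp_all add: e1_def e2_def)
  have "L_D p s = (LINT R:{0..}|lborel. e1 p R * e2 p R * (2 * pi * lam_BS p * R * exp (- pi * lam_BS p * R\<^sup>2)))"
    by (simp only: L_D_def e1_def e2_def)
  also have "\<dots> = enn2real (\<integral>\<^sup>+R\<in>{0..}. ennreal (e1 p R * e2 p R * (2 * pi * lam_BS p * R * exp (- pi * lam_BS p * R\<^sup>2))) \<partial>lborel)"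
    by (rule set_LINT_eq_enn2real) (use e l in auto)
  also have "(\<integral>\<^sup>+R\<in>{0..}. ennreal (e1 p R * e2 p R * (2 * pi * lam_BS p * R * exp (- pi * lam_BS p * R\<^sup>2))) \<partial>lborel)
     = (\<integral>\<^sup>+R. ennreal (R_d_density p R) * H R \<partial>lborel)"
  proof (rule nn_integral_cong)
    fix R :: real
    show "ennreal (e1 p R * e2 p R * (2 * pi * lam_BS p * R * exp (- pi * lam_BS p * R\<^sup>2))) * indicator {0..} R
        = ennreal (R_d_density p R) * H R"
      using l e by (cases "0 \<le> R") (simp_all add: H R_d_density_def ennreal_mult[symmetric] mult_ac)
  qed
  finally show ?thesis .
qed

text \<open>The factor \<open>pi\<close> in the density of the radius cancels the uniform density
  \<open>1 / pi\<close> of the angle. This explains the weight \<open>2 * lam_BS p * R * ...\<close>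
  in \<open>L_IC\<close>, here called \<open>q\<close>.\<close>

lemma L_IC_eq_enn2real:
  fixes s :: real
  defines "e1 \<equiv> \<lambda>p R b. exp_neg (ennreal (2 * pi * lam_BS p / real (M_div p)) *
         (\<integral>\<^sup>+ r\<in>{R..}. ennreal (p_LOS p r *
            (1 - 1 / (1 + s * cos (b / 2) * r powr (- eta_L p) * sig_t p)) * r) \<partial>lborel))"
  defines "e2 \<equiv> \<lambda>p R1 R b. exp_neg (ennreal (lam_BS p / real (M_div p)) *
         (\<integral>\<^sup>+ r\<in>{R..}. ennreal (p_LOS p r *
            (1 - exp (- lam_cl p * cell_area p R1 *
                  (s * cos (b / 2) * r powr (- eta_L p) * sig_cl p /
                    (1 + s * cos (b / 2) * r powr (- eta_L p) * sig_cl p)))) * (2 * pi * r)) \<partial>lborel))"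
  assumes p: "valid_params p" and R1: "0 < R1"
    and H: "\<And>R b. R1 \<le> R \<Longrightarrow> b \<in> {0..pi} \<Longrightarrow> H R b = ennreal (e1 p R b * e2 p R1 R b)"
  shows "L_IC p R1 s = enn2real (\<integral>\<^sup>+R. ennreal (R_IC_density p R1 R) *
            (\<integral>\<^sup>+b. ennreal (indicator {0..pi} b / pi) * H R b \<partial>lborel) \<partial>lborel)"
proof -
  have l: "0 < lam_BS p" using p by (simp add: valid_params_def)
  define q where "q R = 2 * lam_BS p * R * exp (- lam_BS p * pi * (R\<^sup>2 - R1\<^sup>2))" for R
  have [measurable]: "(\<lambda>x. e1 p (fst x) (snd x)) \<in> borel_measurable (borel \<Otimes>\<^sub>M borel)"
    "(\<lambda>x. e2 p R1 (fst x) (snd x)) \<in> borel_measurable (borel \<Otimes>\<^sub>M borel)"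
    unfolding e1_def e2_def
    by (intro measurable_compose[OF _ borel_measurable_exp_neg] borel_measurable_times_ennreal
        borel_measurable_const borel_measurable_nn_integral_atLeast; measurable)+
  define E where "E R b = e1 p R b * e2 p R1 R b" for R b
  have Em: "(\<lambda>x. E (fst x) (snd x)) \<in> borel_measurable (borel \<Otimes>\<^sub>M borel)"
    unfolding E_def by measurable
  have E2 [measurable]: "E R \<in> borel_measurable borel" for R
    using measurable_compose[OF measurable_Pair1'[of R borel borel] Em] by simp
  have E_01: "0 \<le> E R b" "E R b \<le> 1" for R b
    by (simp_all add: E_def e1_def e2_def mult_le_one)
  have [measurable]: "q \<in> borel_measurable borel" unfolding q_def[abs_def] by measurable
  have q: "0 \<le> q R" if "R1 \<le> R" for R using that R1 l by (simp add: q_def)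
  define J where "J R = (LINT b:{0..pi}|lborel. E R b * q R)" for R
  have Jm [measurable]: "J \<in> borel_measurable borel"
  proof -
    have "(\<lambda>(R, b). indicator {0..pi} b *\<^sub>R (E R b * q R)) \<in> borel_measurable (borel \<Otimes>\<^sub>M lborel)"
      using Em by (simp add: case_prod_beta) measurable
    then show ?thesis unfolding J_def[abs_def] set_lebesgue_integral_def
      by (rule lborel.borel_measurable_lebesgue_integral)
  qed
  have J0: "0 \<le> J R" if "R1 \<le> R" for R
    unfolding J_def set_lebesgue_integral_def using E_01 q[OF that]
    by (intro Bochner_Integration.integral_nonneg) (simp add: indicator_def)
  have J: "ennreal (J R) = ennreal (R_IC_density p R1 R) *
            (\<integral>\<^sup>+b. ennreal (indicator {0..pi} b / pi) * H R b \<partial>lborel)" if R: "R1 \<le> R" for R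
  proof -
    have J_nn: "J R = enn2real (\<integral>\<^sup>+b\<in>{0..pi}. ennreal (E R b * q R) \<partial>lborel)"
      unfolding J_def using E_01 q[OF R] by (intro set_LINT_eq_enn2real) auto
    \<comment> \<open>The bound \<open>pi * q R\<close> makes the inner integral finite, so its
      \<open>enn2real\<close> can be undone under the outer integral.\<close>
    have "(\<integral>\<^sup>+b\<in>{0..pi}. ennreal (E R b * q R) \<partial>lborel) \<le> (\<integral>\<^sup>+b. ennreal (q R) * indicator {0..pi} b \<partial>lborel)"
      using E_01 q[OF R] by (intro nn_integral_mono mult_right_mono ennreal_leI) (auto intro: mult_left_le_one_le)
    also have "\<dots> = ennreal (q R) * ennreal pi" by (subst nn_integral_cmult_indicator) simp_all
    also have "\<dots> < top" by (simp add: ennreal_mult[symmetric] q[OF R])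
    finally have "ennreal (J R) = (\<integral>\<^sup>+b\<in>{0..pi}. ennreal (E R b * q R) \<partial>lborel)"
      by (simp add: J_nn)
    also have "\<dots> = (\<integral>\<^sup>+b. ennreal (R_IC_density p R1 R) * (ennreal (indicator {0..pi} b / pi) * ennreal (E R b)) \<partial>lborel)"
    proof (rule nn_integral_cong)
      fix b :: real
      have d: "R_IC_density p R1 R = pi * q R" using R by (simp add: R_IC_density_def q_def)
      have "ennreal (pi * q R) * (ennreal (1 / pi) * ennreal (E R b)) = ennreal (E R b * q R)"
        using E_01[of R b] q[OF R] by (simp add: ennreal_mult[symmetric] mult.commute)
      then show "ennreal (E R b * q R) * indicator {0..pi} b =
          ennreal (R_IC_density p R1 R) * (ennreal (indicator {0..pi} b / pi) * ennreal (E R b))"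
        unfolding d by (cases "b \<in> {0..pi}") simp_all
    qed
    also have "\<dots> = ennreal (R_IC_density p R1 R) * (\<integral>\<^sup>+b. ennreal (indicator {0..pi} b / pi) * ennreal (E R b) \<partial>lborel)"
      by (rule nn_integral_cmult) measurable
    also have "(\<integral>\<^sup>+b. ennreal (indicator {0..pi} b / pi) * ennreal (E R b) \<partial>lborel)
       = (\<integral>\<^sup>+b. ennreal (indicator {0..pi} b / pi) * H R b \<partial>lborel)"
    proof (rule nn_integral_cong)
      fix b :: real
      have "H R b = ennreal (E R b)" if "b \<in> {0..pi}"
        unfolding E_def by (rule H[OF R that])
      then show "ennreal (indicator {0..pi} b / pi) * ennreal (E R b) = ennreal (indicator {0..pi} b / pi) * H R b"
        by (cases "b \<in> {0..pi}") simp_all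
    qed
    finally show ?thesis .
  qed
  have "L_IC p R1 s = (LINT R:{R1..}|lborel. J R)"
    by (simp only: L_IC_def J_def E_def e1_def e2_def q_def)
  also have "\<dots> = enn2real (\<integral>\<^sup>+R\<in>{R1..}. ennreal (J R) \<partial>lborel)"
    by (rule set_LINT_eq_enn2real) (use J0 in auto)
  also have "(\<integral>\<^sup>+R\<in>{R1..}. ennreal (J R) \<partial>lborel) = (\<integral>\<^sup>+R. ennreal (R_IC_density p R1 R) *
            (\<integral>\<^sup>+b. ennreal (indicator {0..pi} b / pi) * H R b \<partial>lborel) \<partial>lborel)"
  proof (rule nn_integral_cong)
    fix R :: real
    show "ennreal (J R) * indicator {R1..} R = ennreal (R_IC_density p R1 R) *
            (\<integral>\<^sup>+b. ennreal (indicator {0..pi} b / pi) * H R b \<partial>lborel)"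
      by (cases "R1 \<le> R") (simp_all add: J, simp add: R_IC_density_def)
  qed
  finally show ?thesis .
qed

section \<open>The coverage event and its factorisation over the blocks\<close>

lemma SINR_gt_iff:
  assumes p: "valid_params p" and R1: "0 < R1" and \<phi>: "0 < \<phi>"
  shows "SINR p R1 \<sigma> S I1 I2 IL IN > ennreal \<phi> \<longleftrightarrow>
    ennreal (\<phi> / (kappa p * R1 powr (- 2 * eta_L p))) *
      (ennreal (kappa p * R1 powr (- 2 * eta_L p)) * S
      + ennreal (kappa p * R1 powr (- eta_L p)) * (I1 + I2)
      + ennreal (K_B p * temp p * W_b p) + IL + IN + ennreal (P_c p * zeta_c p)) < ennreal \<sigma>"
proof -
  define k where "k = kappa p * R1 powr (- 2 * eta_L p)"
  define D where "D = ennreal k * S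
      + ennreal (kappa p * R1 powr (- eta_L p)) * (I1 + I2)
      + ennreal (K_B p * temp p * W_b p) + IL + IN + ennreal (P_c p * zeta_c p)"
  have k: "0 < k" using p R1 by (simp add: k_def kappa_def valid_params_def)
  \<comment> \<open>The noise term keeps the denominator away from 0, so the quotient can be
    cleared.\<close>
  have D0: "D \<noteq> 0" using p by (auto simp: D_def valid_params_def)
  have "kappa p * \<sigma> * R1 powr (- 2 * eta_L p) = k * \<sigma>" by (simp add: k_def)
  then have "SINR p R1 \<sigma> S I1 I2 IL IN > ennreal \<phi> \<longleftrightarrow> ennreal \<phi> < ennreal (k * \<sigma>) / D"
    by (simp only: SINR_def D_def k_def)
  also have "\<dots> \<longleftrightarrow> ennreal (\<phi> / k) * D < ennreal \<sigma>"
  proof (cases D)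
    case (real d)
    with D0 have d: "0 < d" by (cases "d = 0") auto
    show ?thesis
    proof (cases "0 \<le> \<sigma>")
      case True
      then have "ennreal \<phi> < ennreal (k * \<sigma>) / D \<longleftrightarrow> \<phi> < k * \<sigma> / d"
        using real d k \<phi> by (simp add: divide_ennreal ennreal_less_iff)
      also have "\<dots> \<longleftrightarrow> \<phi> / k * d < \<sigma>" using d k by (simp add: field_simps)
      also have "\<dots> \<longleftrightarrow> ennreal (\<phi> / k) * D < ennreal \<sigma>"
        using real d k \<phi> True by (simp add: ennreal_mult[symmetric] ennreal_less_iff)
      finally show ?thesis .
    next
      case False
      \<comment> \<open>Truncation of \<open>ennreal\<close> at negative arguments makes both
        inequalities fail.\<close>
      then have "k * \<sigma> \<le> 0" using k by (simp add: mult_le_0_iff)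
      then show ?thesis using False by (simp add: ennreal_neg)
    qed
  next
    case top
    then show ?thesis using \<phi> k by (simp add: ennreal_mult_top)
  qed
  finally show ?thesis by (simp only: D_def k_def)
qed

text \<open>Each variable is a function of one block, so its events are among those of the block,
  and independence passes to smaller families of events. The SINR depends on the last two blocks
  through the sums of their components.\<close>

lemma (in prob_space) indep_vars_of_blocks:
  fixes \<sigma> :: "'a \<Rightarrow> real" and S I1 I2 IL IN :: "'a \<Rightarrow> ennreal"
  assumes [measurable]: "\<sigma> \<in> borel_measurable M" "S \<in> borel_measurable M" "I1 \<in> borel_measurable M"
    "I2 \<in> borel_measurable M" "IL \<in> borel_measurable M" "IN \<in> borel_measurable M"
    and blocks: "indep_sets
           (\<lambda>j. [events_of M borel \<sigma>, events_of M borel S,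
                 events_of M (borel \<Otimes>\<^sub>M borel) (\<lambda>w. (I1 w, I2 w)),
                 events_of M (borel \<Otimes>\<^sub>M borel) (\<lambda>w. (IL w, IN w))] ! j) {..<4}" (is "indep_sets (\<lambda>j. ?E ! j) _")
  shows "indep_vars (\<lambda>_. borel)
      (\<lambda>j. [\<lambda>w. ennreal (\<sigma> w), S, \<lambda>w. I1 w + I2 w, \<lambda>w. IL w + IN w] ! j) {..<4::nat}"
    (is "indep_vars _ (\<lambda>j. ?Y ! j) _")
  unfolding indep_vars_def2
proof (intro conjI ballI)
  have cases: "j = 0 \<or> j = 1 \<or> j = 2 \<or> j = 3" if "j \<in> {..<4}" for j :: nat using that by auto
  show "?Y ! j \<in> borel_measurable M"
    if "j \<in> {..<4}" for j
    using cases[OF that] by (auto simp: numeral_2_eq_2 numeral_3_eq_3)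
  have sub0: "(\<lambda>w. ennreal (\<sigma> w)) -` A \<inter> space M \<in> events_of M borel \<sigma>"
    if "A \<in> sets borel" for A :: "ennreal set"
    by (rule vimage_compose_in_events_of[OF _ _ that]) measurable
  have sub1: "S -` A \<inter> space M \<in> events_of M borel S"
    if "A \<in> sets borel" for A :: "ennreal set"
    using that by (rule in_vimage_algebra)
  have plus: "(\<lambda>x. fst x + snd x) \<in> borel_measurable (borel \<Otimes>\<^sub>M borel :: (ennreal \<times> ennreal) measure)"
    by measurable
  have sub2: "(\<lambda>w. I1 w + I2 w) -` A \<inter> space M \<in> events_of M (borel \<Otimes>\<^sub>M borel) (\<lambda>w. (I1 w, I2 w))"
    if "A \<in> sets borel" for A :: "ennreal set"
    using vimage_compose_in_events_of[OF _ plus that, of "\<lambda>w. (I1 w, I2 w)" M] by simp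
  have sub3: "(\<lambda>w. IL w + IN w) -` A \<inter> space M \<in> events_of M (borel \<Otimes>\<^sub>M borel) (\<lambda>w. (IL w, IN w))"
    if "A \<in> sets borel" for A :: "ennreal set"
    using vimage_compose_in_events_of[OF _ plus that, of "\<lambda>w. (IL w, IN w)" M] by simp
  show "indep_sets (\<lambda>j. {(?Y ! j) -` A \<inter> space M
      |A. A \<in> sets borel}) {..<4}"
  proof (rule indep_sets_mono_sets[OF blocks])
    fix j :: nat assume "j \<in> {..<4}"
    from cases[OF this] sub0 sub1 sub2 sub3
    show "{(?Y ! j) -` A \<inter> space M
      |A. A \<in> sets borel} \<subseteq> ?E ! j"
      by (elim disjE) (auto simp: numeral_2_eq_2 numeral_3_eq_3)
  qed
qed

text \<open>Independence is used twice: for the target against the whole denominator, which gives a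
  single Laplace transform, and among the three random terms of the denominator, which splits
  it.\<close>

lemma (in prob_space) prob_less_exponential_sum:
  fixes Y :: "nat \<Rightarrow> 'a \<Rightarrow> ennreal"
  assumes \<sigma>: "distributed M lborel \<sigma> (exponential_density l)" "0 < l"
    and ind: "indep_vars (\<lambda>_. borel) Y {..<4}" and Y0: "Y 0 = (\<lambda>w. ennreal (\<sigma> w))"
    and pos: "0 \<le> a" "0 \<le> b" "0 \<le> n" "0 \<le> e" "0 \<le> c"
  shows "emeasure M {w\<in>space M. ennreal c * (ennreal a * Y 1 w + ennreal b * Y 2 w + ennreal n + Y 3 w + ennreal e)
        < ennreal (\<sigma> w)}
    = ennreal (laplace M (Y 1) (ennreal (l * c * a))) * ennreal (laplace M (Y 2) (ennreal (l * c * b)))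
      * ennreal (exp (- (l * c * n))) * ennreal (laplace M (Y 3) (ennreal (l * c))) * ennreal (exp (- (l * c * e)))"
proof -
  let ?D = "\<lambda>w. ennreal c * (ennreal a * Y 1 w + ennreal b * Y 2 w + ennreal n + Y 3 w + ennreal e)"
  \<comment> \<open>The coefficient of \<open>Y j\<close> in the exponent after multiplying the
    weighted sum by the rate \<open>l\<close>.\<close>
  define t where "t j = l * c * (if j = 1 then a else if j = 2 then b else 1)" for j :: nat
  let ?g = "\<lambda>j w. ennreal (exp_neg (ennreal (t j) * Y j w))"
  have [measurable]: "Y j \<in> borel_measurable M" if "j < 4" for j
    using indep_vars_def[THEN iffD1, OF ind] that by simp
  have Ym [measurable]: "Y 1 \<in> borel_measurable M" "Y 2 \<in> borel_measurable M" "Y 3 \<in> borel_measurable M"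
    by simp_all
  \<comment> \<open>Grouping the indices as \<open>{0}\<close> and \<open>{1,2,3}\<close> makes the
    target independent of the whole denominator, which is a function of the second group.\<close>
  have "indep_var (PiM {0} (\<lambda>_. borel)) (\<lambda>w. restrict (\<lambda>i. Y i w) {0})
      (PiM {1,2,3} (\<lambda>_. borel)) (\<lambda>w. restrict (\<lambda>i. Y i w) {1,2,3})"
    by (rule indep_var_restrict[OF ind]) auto
  then have "indep_var borel ((\<lambda>f. f 0) \<circ> (\<lambda>w. restrict (\<lambda>i. Y i w) {0}))
      borel ((\<lambda>f. ennreal c * (ennreal a * f 1 + ennreal b * f 2 + ennreal n + f 3 + ennreal e)) \<circ>
        (\<lambda>w. restrict (\<lambda>i. Y i w) {1,2,3}))"
    by (rule indep_var_compose) measurable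
  then have "indep_var borel (\<lambda>w. ennreal (\<sigma> w)) borel ?D"
    by (simp add: comp_def Y0)
  then have "emeasure M {w\<in>space M. ?D w < ennreal (\<sigma> w)} = (\<integral>\<^sup>+w. ennreal (exp_neg (ennreal l * ?D w)) \<partial>M)"
    by (rule prob_less_exponential[OF \<sigma>])
  also have "\<dots> = (\<integral>\<^sup>+w. ennreal (exp (- (l * c * n)) * exp (- (l * c * e))) * (\<Prod>j\<in>{1,2,3}. ?g j w) \<partial>M)"
  proof (rule nn_integral_cong)
    fix w
    have "ennreal l * ?D w = ennreal (l * c * a) * Y 1 w + ennreal (l * c * b) * Y 2 w + ennreal (l * c * n)
        + ennreal (l * c) * Y 3 w + ennreal (l * c * e)" (is "_ = ?r")
      using pos \<sigma>(2) by (simp add: distrib_left ennreal_mult mult.assoc)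
    then show "ennreal (exp_neg (ennreal l * ?D w)) = ennreal (exp (- (l * c * n)) * exp (- (l * c * e))) * (\<Prod>j\<in>{1,2,3}. ?g j w)"
    proof -
      assume eq: "ennreal l * ?D w = ?r"
      have "exp_neg (ennreal (l * c * n)) = exp (- (l * c * n))" "exp_neg (ennreal (l * c * e)) = exp (- (l * c * e))"
        using pos \<sigma>(2) by simp_all
      moreover have "ennreal (x1 * x2 * u * x3 * v) = ennreal (u * v) * (ennreal x1 * ennreal x2 * ennreal x3)"
        if "0 \<le> x1" "0 \<le> x2" "0 \<le> x3" "0 \<le> u" "0 \<le> v" for x1 x2 x3 u v :: real
        using that by (simp add: ennreal_mult[symmetric] mult_ac)
      ultimately show ?thesis unfolding eq exp_neg_add by (simp add: mult.assoc t_def)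
    qed
  qed
  also have "\<dots> = ennreal (exp (- (l * c * n)) * exp (- (l * c * e))) * (\<integral>\<^sup>+w. (\<Prod>j\<in>{1,2,3}. ?g j w) \<partial>M)"
    by (rule nn_integral_cmult) simp
  also have "(\<integral>\<^sup>+w. (\<Prod>j\<in>{1,2,3}. ?g j w) \<partial>M)
    = (\<Prod>j\<in>{1,2,3}. \<integral>\<^sup>+w. ?g j w \<partial>M)"
  proof (rule indep_vars_nn_integral)
    have "indep_vars (\<lambda>_. borel) Y {1,2,3}" by (rule indep_vars_subset[OF ind]) auto
    then show "indep_vars (\<lambda>_. borel) ?g {1,2,3}"
      by (rule indep_vars_compose2) measurable
  qed simp_all
  also have "\<dots> = ennreal (laplace M (Y 1) (ennreal (l * c * a))) * ennreal (laplace M (Y 2) (ennreal (l * c * b)))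
     * ennreal (laplace M (Y 3) (ennreal (l * c)))"
    by (simp add: nn_integral_laplace Ym[simplified] mult.assoc t_def)
  finally show ?thesis by (simp add: ennreal_mult mult_ac)
qed

section \<open>Identification of the transforms with the closed forms\<close>

lemma p_LOS_bounds:
  assumes "valid_params p" "0 \<le> r"
  shows "0 \<le> p_LOS p r" "p_LOS p r \<le> 1"
  using assms by (simp_all add: p_LOS_def valid_params_def)

context prob_space
begin

text \<open>The conditional transform depends on \<open>Rd\<close> alone, so its expectation is an
  integral against the density of \<open>Rd\<close>. Shape and rate of the gains are both
  \<open>m_L p\<close> or \<open>m_N p\<close>, the normalisation to mean 1, which yields the bases
  \<open>1 + ... / m_L p\<close> and \<open>1 + ... / m_N p\<close>.\<close>

lemma laplace_direct_eq_L_D: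
  fixes XL XN :: "nat \<Rightarrow> 'a \<Rightarrow> plane"
  assumes p: "valid_params p" and s: "0 \<le> s"
    and Rd: "distributed M lborel Rd (R_d_density p)"
    and L: "cond_poisson_process M (vimage_algebra (space M) Rd borel) NL XL (\<lambda>w. DL_intensity p (Rd w))"
    and N: "cond_poisson_process M (vimage_algebra (space M) Rd borel) NN XN (\<lambda>w. DN_intensity p (Rd w))"
    and L_N: "cond_indep_sets M (vimage_algebra (space M) Rd borel)
           (process_events M NL XL) (process_events M NN XN)"
    and hL: "\<And>i. distributed M lborel (hL i) (gamma_density (m_L p) (m_L p))"
    and hN: "\<And>i. distributed M lborel (hN i) (gamma_density (m_N p) (m_N p))"
    and iid: "indep_vars (\<lambda>_. borel) (case_sum hL hN) UNIV"
    and ind: "indep_elements M (borel \<Otimes>\<^sub>M enum_space \<Otimes>\<^sub>M enum_space)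
           (\<lambda>w. (Rd w, (NL w, \<lambda>i. XL i w), (NN w, \<lambda>i. XN i w)))
           (seq_space \<Otimes>\<^sub>M seq_space) (\<lambda>w. (\<lambda>i. hL i w, \<lambda>i. hN i w))"
    and IL: "IL = (\<lambda>w. point_sum (NL w) (\<lambda>i.
               ennreal (P_c p * hL i w * (G_m p)\<^sup>2 * C_L p * norm (XL i w) powr (- eta_L p))))"
    and IN: "IN = (\<lambda>w. point_sum (NN w) (\<lambda>i.
               ennreal (P_c p * hN i w * (G_m p)\<^sup>2 * C_N p * norm (XN i w) powr (- eta_N p))))"
    and I [measurable]: "IL \<in> borel_measurable M" "IN \<in> borel_measurable M"
  shows "laplace M (\<lambda>w. IL w + IN w) (ennreal s) = L_D p s"
proof -
  have v: "0 < lam_BS p" "0 < P_c p" "0 < G_m p" "0 < C_L p" "0 < C_N p" "0 < m_L p" "0 < m_N p" "0 < M_div p"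
    using p by (simp_all add: valid_params_def)
  have Rdm [measurable]: "Rd \<in> borel_measurable M" using distributed_measurable[OF Rd] by simp
  define D where "D = (real (M_div p))\<^sup>2"
  have D: "0 < D" using v by (simp add: D_def)
  define fL where "fL r = p_LOS p r * lam_BS p / D" for r
  define fN where "fN r = (1 - p_LOS p r) * lam_BS p / D" for r
  have fm: "fL \<in> borel_measurable borel" "fN \<in> borel_measurable borel"
    unfolding fL_def[abs_def] fN_def[abs_def] by measurable
  have f_le: "fL r \<le> lam_BS p / D" "fN r \<le> lam_BS p / D" if "0 \<le> r" for r
    unfolding fL_def fN_def using p_LOS_bounds[OF p that] v D
    by (auto intro!: divide_right_mono mult_left_le_one_le)
  have int: "DL_intensity p R = outside_intensity R fL" "DN_intensity p R = outside_intensity R fN" for R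
    by (simp_all add: DL_intensity_def DN_intensity_def fL_def[abs_def] fN_def[abs_def] D_def)
  define gL where "gL r = P_c p * (G_m p)\<^sup>2 * C_L p * r powr (- eta_L p)" for r
  define gN where "gN r = P_c p * (G_m p)\<^sup>2 * C_N p * r powr (- eta_N p)" for r
  have gm [measurable]: "gL \<in> borel_measurable borel" "gN \<in> borel_measurable borel"
    unfolding gL_def[abs_def] gN_def[abs_def] by measurable
  have g0: "0 \<le> gL r" "0 \<le> gN r" for r using v by (simp_all add: gL_def gN_def)
  \<comment> \<open>The gains are nonnegative only almost surely, so they are split off with
    \<open>ennreal_mult'\<close>, which looks at the sign of the deterministic factor.\<close>
  have IL': "IL w = point_sum (NL w) (\<lambda>i. ennreal (gL (norm (XL i w))) * ennreal (hL i w))" for w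
    unfolding IL by (intro point_sum_cong) (simp add: ennreal_mult'[OF g0(1), symmetric], simp add: gL_def mult_ac)
  have IN': "IN w = point_sum (NN w) (\<lambda>i. ennreal (gN (norm (XN i w))) * ennreal (hN i w))" for w
    unfolding IN by (intro point_sum_cong) (simp add: ennreal_mult'[OF g0(2), symmetric], simp add: gN_def mult_ac)
  define LL where "LL = laplace M (\<lambda>w. ennreal (hL 0 w))"
  define LN where "LN = laplace M (\<lambda>w. ennreal (hN 0 w))"
  define \<phi>L where "\<phi>L r = 1 - (1 + s * P_c p * (G_m p)\<^sup>2 * C_L p * r powr (- eta_L p) / m_L p) powr (- m_L p)" for r
  define \<phi>N where "\<phi>N r = 1 - (1 + s * P_c p * (G_m p)\<^sup>2 * C_N p * r powr (- eta_N p) / m_N p) powr (- m_N p)" for r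
  have \<phi>m [measurable]: "\<phi>L \<in> borel_measurable borel" "\<phi>N \<in> borel_measurable borel"
    unfolding \<phi>L_def[abs_def] \<phi>N_def[abs_def] by measurable
  have \<phi>L: "1 - LL (ennreal s * ennreal (gL r)) = \<phi>L r" for r
  proof -
    have "LL (ennreal (s * gL r)) = (1 + s * gL r / m_L p) powr (- m_L p)"
      unfolding LL_def using s g0 v by (intro laplace_gamma[OF hL]) simp_all
    then show ?thesis using s g0[of r] by (simp add: ennreal_mult[symmetric]) (simp add: \<phi>L_def gL_def mult_ac)
  qed
  have \<phi>N: "1 - LN (ennreal s * ennreal (gN r)) = \<phi>N r" for r
  proof -
    have "LN (ennreal (s * gN r)) = (1 + s * gN r / m_N p) powr (- m_N p)"
      unfolding LN_def using s g0 v by (intro laplace_gamma[OF hN]) simp_all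
    then show ?thesis using s g0[of r] by (simp add: ennreal_mult[symmetric]) (simp add: \<phi>N_def gN_def mult_ac)
  qed
  have hm: "(\<lambda>w. ennreal (hL 0 w)) \<in> borel_measurable M" "(\<lambda>w. ennreal (hN 0 w)) \<in> borel_measurable M"
    using distributed_measurable[OF hL[of 0]] distributed_measurable[OF hN[of 0]] by simp_all
  have \<phi>0: "0 \<le> \<phi>L r" "0 \<le> \<phi>N r" for r
    unfolding \<phi>L[symmetric] \<phi>N[symmetric] LL_def LN_def using laplace_le_1[OF hm(1)] laplace_le_1[OF hm(2)]
    by simp_all
  define H where "H R = ennreal (exp_neg (\<integral>\<^sup>+x. ennreal (\<phi>L (norm x)) \<partial>outside_intensity R fL)) *
      ennreal (exp_neg (\<integral>\<^sup>+x. ennreal (\<phi>N (norm x)) \<partial>outside_intensity R fN))" for R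
  have km: "(\<lambda>R. \<integral>\<^sup>+x. (\<lambda>(c::real, x). ennreal (\<phi>L (norm x))) (0, x) \<partial>outside_intensity R fL) \<in> borel_measurable borel"
    "(\<lambda>R. \<integral>\<^sup>+x. (\<lambda>(c::real, x). ennreal (\<phi>N (norm x))) (0, x) \<partial>outside_intensity R fN) \<in> borel_measurable borel"
    by (rule kernel_outside_intensity[of "\<lambda>R. R"]; use fm in measurable)+
  have Hm: "H \<in> borel_measurable borel"
    unfolding H_def[abs_def] using km by simp
  have "ennreal (laplace M (\<lambda>w. IL w + IN w) (ennreal s)) = (\<integral>\<^sup>+w. ennreal (exp_neg (ennreal s * (IL w + IN w))) \<partial>M)"
    by (rule nn_integral_laplace[symmetric]) measurable
  also have "\<dots> = (\<integral>\<^sup>+w. H (Rd w) \<partial>M)"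
    unfolding IL' IN' H_def \<phi>L[symmetric] \<phi>N[symmetric] LL_def LN_def
    by (rule laplace_direct_interference[OF Rdm L[unfolded int] N[unfolded int] fm(1) f_le(1) fm(2) f_le(2) L_N iid
          laplace_distributed_cong[OF hL hL] laplace_distributed_cong[OF hN hN] ind gm s])
  also have "\<dots> = (\<integral>\<^sup>+R. ennreal (R_d_density p R) * H R \<partial>lborel)"
    by (rule distributed_nn_integral[OF Rd, symmetric]) (use Hm in simp)
  finally have "laplace M (\<lambda>w. IL w + IN w) (ennreal s) = enn2real (\<integral>\<^sup>+R. ennreal (R_d_density p R) * H R \<partial>lborel)"
    using laplace_nonneg by (metis enn2real_ennreal)
  also have "\<dots> = L_D p s"
  proof -
    have "H R = ennreal (
        exp_neg (ennreal (2 * pi * lam_BS p / D) * (\<integral>\<^sup>+r\<in>{R..}. ennreal (p_LOS p r * \<phi>L r * r) \<partial>lborel)) *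
        exp_neg (ennreal (2 * pi * lam_BS p / D) * (\<integral>\<^sup>+r\<in>{R..}. ennreal ((1 - p_LOS p r) * \<phi>N r * r) \<partial>lborel)))"
      if R: "0 \<le> R" for R
    proof -
      have "(\<integral>\<^sup>+x. ennreal (\<phi>L (norm x)) \<partial>outside_intensity R fL)
         = ennreal (2 * pi * lam_BS p / D) * (\<integral>\<^sup>+r\<in>{R..}. ennreal (p_LOS p r * \<phi>L r * r) \<partial>lborel)"
        unfolding fL_def[abs_def] using v D R p_LOS_bounds[OF p] \<phi>0
        by (intro nn_integral_outside_intensity_scaled(2)) auto
      moreover have "(\<integral>\<^sup>+x. ennreal (\<phi>N (norm x)) \<partial>outside_intensity R fN)
         = ennreal (2 * pi * lam_BS p / D) * (\<integral>\<^sup>+r\<in>{R..}. ennreal ((1 - p_LOS p r) * \<phi>N r * r) \<partial>lborel)"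
        unfolding fN_def[abs_def] using v D R p_LOS_bounds[OF p] \<phi>0
        by (intro nn_integral_outside_intensity_scaled(2)) auto
      ultimately show ?thesis by (simp only: H_def ennreal_mult[OF exp_neg_nonneg exp_neg_nonneg])
    qed
    then show ?thesis
      by (intro L_D_eq_enn2real[OF p, symmetric]) (simp only: \<phi>L_def \<phi>N_def D_def)
  qed
  finally show ?thesis .
qed

text \<open>Conditional independence is assumed for the sums themselves, so each is treated as a
  shot noise of its own: the first with exponential marks, the second with copies of the clutter sum
  as marks, whose transforms are \<open>lap1\<close> and \<open>lap2\<close>. The product of the two
  conditional transforms is integrated against the product law of
  \<open>(RIC, \<beta>)\<close>.\<close>

lemma laplace_inter_clutter_eq_L_IC:
  fixes X1 X2 :: "nat \<Rightarrow> 'a \<Rightarrow> plane"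
  assumes p: "valid_params p" and R1: "0 < R1" and s: "0 \<le> s"
    and RIC: "distributed M lborel RIC (R_IC_density p R1)"
    and \<beta>: "distributed M lborel \<beta> (\<lambda>b. ennreal (indicator {0..pi} b / pi))"
    and RIC_\<beta>: "indep_var borel RIC borel \<beta>"
    and process1: "cond_poisson_process M
           (vimage_algebra (space M) (\<lambda>w. (RIC w, \<beta> w)) (borel \<Otimes>\<^sub>M borel))
           N1 X1 (\<lambda>w. IC_intensity p (RIC w))"
    and process2: "cond_poisson_process M
           (vimage_algebra (space M) (\<lambda>w. (RIC w, \<beta> w)) (borel \<Otimes>\<^sub>M borel))
           N2 X2 (\<lambda>w. IC_intensity p (RIC w))"
    and iid1: "indep_vars (\<lambda>_. borel) Z1 UNIV" and iid2: "indep_vars (\<lambda>_. borel) Z2 UNIV"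
    and ind1: "indep_elements M ((borel \<Otimes>\<^sub>M borel) \<Otimes>\<^sub>M enum_space)
                (\<lambda>w. ((RIC w, \<beta> w), (N1 w, \<lambda>i. X1 i w))) seq_space (\<lambda>w i. Z1 i w :: real)"
    and ind2: "indep_elements M ((borel \<Otimes>\<^sub>M borel) \<Otimes>\<^sub>M enum_space)
                (\<lambda>w. ((RIC w, \<beta> w), (N2 w, \<lambda>i. X2 i w))) seq_space (\<lambda>w i. Z2 i w :: ennreal)"
    and \<sigma> [measurable]: "\<sigma> \<in> borel_measurable M" and S [measurable]: "S \<in> borel_measurable M"
    and law1: "\<And>i. distr M borel (Z1 i) = distr M borel \<sigma>"
    and law2: "\<And>i. distr M borel (Z2 i) = distr M borel S"
    and lap1: "\<And>t. 0 \<le> t \<Longrightarrow> laplace M (\<lambda>w. ennreal (\<sigma> w)) (ennreal t) = 1 / (1 + t * sig_t p)"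
    and lap2: "\<And>t. 0 \<le> t \<Longrightarrow> laplace M S (ennreal t)
        = exp (- lam_cl p * cell_area p R1 * (t * sig_cl p / (1 + t * sig_cl p)))"
    and I1: "I1 = (\<lambda>w. point_sum (N1 w) (\<lambda>i.
               ennreal (cos (\<beta> w / 2) * norm (X1 i w) powr (- eta_L p)) * ennreal (Z1 i w)))"
    and I2: "I2 = (\<lambda>w. point_sum (N2 w) (\<lambda>i.
               ennreal (cos (\<beta> w / 2) * norm (X2 i w) powr (- eta_L p)) * Z2 i w))"
    and I [measurable]: "I1 \<in> borel_measurable M" "I2 \<in> borel_measurable M"
    and I1_I2: "cond_indep_sets M
           (vimage_algebra (space M) (\<lambda>w. (RIC w, \<beta> w)) (borel \<Otimes>\<^sub>M borel))
           (events_of M borel I1) (events_of M borel I2)"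
  shows "laplace M (\<lambda>w. I1 w + I2 w) (ennreal s) = L_IC p R1 s"
proof -
  have v: "0 < lam_BS p" "0 < sig_t p" "0 < sig_cl p" "0 < M_div p"
    using p by (simp_all add: valid_params_def)
  have Rm [measurable]: "RIC \<in> borel_measurable M" using distributed_measurable[OF RIC] by simp
  have bm [measurable]: "\<beta> \<in> borel_measurable M" using distributed_measurable[OF \<beta>] by simp
  have Z1m [measurable]: "Z1 i \<in> borel_measurable M" and Z2m [measurable]: "Z2 i \<in> borel_measurable M" for i
    using indep_vars_def[THEN iffD1, OF iid1] indep_vars_def[THEN iffD1, OF iid2] by blast+
  define D where "D = real (M_div p)"
  have D: "0 < D" using v by (simp add: D_def)
  define f where "f r = p_LOS p r * lam_BS p / D" for r
  have fm [measurable]: "f \<in> borel_measurable borel" unfolding f_def[abs_def] by measurable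
  have f_le: "f r \<le> lam_BS p / D" if "0 \<le> r" for r
    unfolding f_def using p_LOS_bounds[OF p that] v D
    by (auto intro!: divide_right_mono mult_left_le_one_le)
  have int: "IC_intensity p R = outside_intensity R f" for R
    by (simp add: IC_intensity_def f_def[abs_def] D_def)
  let ?F = "vimage_algebra (space M) (\<lambda>w. (RIC w, \<beta> w)) (borel \<Otimes>\<^sub>M borel)"
  have pm: "(\<lambda>w. (RIC w, \<beta> w)) \<in> measurable M (borel \<Otimes>\<^sub>M borel)" by measurable
  have pF: "(\<lambda>w. (RIC w, \<beta> w)) \<in> measurable ?F (borel \<Otimes>\<^sub>M borel)"
    by (rule measurable_vimage_algebra1) (auto simp: space_pair_measure)
  define L1 where "L1 = laplace M (\<lambda>w. ennreal (\<sigma> w))"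
  define L2 where "L2 = laplace M S"
  have [measurable]: "L1 \<in> borel_measurable borel" unfolding L1_def by (rule borel_measurable_laplace) measurable
  have [measurable]: "L2 \<in> borel_measurable borel" unfolding L2_def by (rule borel_measurable_laplace) measurable
  have lawZ1: "laplace M (\<lambda>w. ennreal (Z1 i w)) a = L1 a" for i a
    unfolding L1_def
  proof (rule laplace_distr)
    have "distr (distr M borel (Z1 i)) borel ennreal = distr (distr M borel \<sigma>) borel ennreal"
      by (simp only: law1)
    then show "distr M borel (\<lambda>w. ennreal (Z1 i w)) = distr M borel (\<lambda>w. ennreal (\<sigma> w))"
      by (simp add: distr_distr comp_def)
  qed measurable
  have lawZ2: "laplace M (Z2 i) a = L2 a" for i a
    unfolding L2_def by (rule laplace_distr[OF Z2m S law2])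
  define H where "H L R b = ennreal (exp_neg (\<integral>\<^sup>+x. ennreal (1 -
      L (ennreal s * ennreal (cos (b / 2) * norm x powr (- eta_L p)))) \<partial>outside_intensity R f))"
    for L :: "ennreal \<Rightarrow> real" and R b
  have Hm: "(\<lambda>x. H L (fst x) (snd x)) \<in> borel_measurable (borel \<Otimes>\<^sub>M borel)"
    if [measurable]: "L \<in> borel_measurable borel" for L
  proof -
    have "(\<lambda>x. \<integral>\<^sup>+y. (\<lambda>(c, y). ennreal (1 - L (ennreal s * ennreal (c * norm y powr (- eta_L p)))))
        (cos (snd x / 2), y) \<partial>outside_intensity (fst x) f) \<in> borel_measurable (borel \<Otimes>\<^sub>M borel)"
      by (rule kernel_outside_intensity) measurable
    then show ?thesis unfolding H_def by simp
  qed
  have HF: "(\<lambda>w. H L (RIC w) (\<beta> w)) \<in> borel_measurable ?F" if "L \<in> borel_measurable borel" for L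
    using measurable_compose[OF pF Hm[OF that]] by simp
  have V1: "(\<lambda>w i. Z1 i w) \<in> measurable M seq_space" by (intro measurable_seq_space) measurable
  have V2: "(\<lambda>w i. Z2 i w) \<in> measurable M seq_space" by (intro measurable_seq_space) measurable
  have c1: "(\<integral>\<^sup>+w. indicator A w * ennreal (exp_neg (ennreal s * I1 w)) \<partial>M)
      = (\<integral>\<^sup>+w. indicator A w * H L1 (RIC w) (\<beta> w) \<partial>M)" if A: "A \<in> sets ?F" for A
    unfolding I1 H_def L1_def
  proof (rule cond_laplace_shot_noise[where z="\<lambda>i v. ennreal (v i)" and L=seq_space and V="\<lambda>w i. Z1 i w",
        OF Rm bm process1[unfolded int] fm f_le ind1 V1 _ _ _ _ s A])
    show "indep_vars (\<lambda>_. borel) (\<lambda>i w. ennreal (Z1 i w)) UNIV"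
      by (rule indep_vars_compose2[OF iid1]) measurable
    show "laplace M (\<lambda>w. ennreal (Z1 i w)) a = laplace M (\<lambda>w. ennreal (\<sigma> w)) a" for i a
      using lawZ1 by (simp add: L1_def)
  qed measurable
  have c2: "(\<integral>\<^sup>+w. indicator A w * ennreal (exp_neg (ennreal s * I2 w)) \<partial>M)
      = (\<integral>\<^sup>+w. indicator A w * H L2 (RIC w) (\<beta> w) \<partial>M)" if A: "A \<in> sets ?F" for A
    unfolding I2 H_def L2_def
  proof (rule cond_laplace_shot_noise[where z="\<lambda>i v. v i" and L=seq_space and V="\<lambda>w i. Z2 i w",
        OF Rm bm process2[unfolded int] fm f_le ind2 V2 _ _ _ _ s A])
    show "indep_vars (\<lambda>_. borel) (\<lambda>i w. Z2 i w) UNIV" using iid2 by simp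
    show "laplace M (\<lambda>w. Z2 i w) a = laplace M S a" for i a
      using lawZ2 by (simp add: L2_def)
  qed measurable
  have Ie: "(\<lambda>w. ennreal (exp_neg (ennreal s * Y w))) \<in> borel_measurable (vimage_algebra (space M) Y borel)"
    for Y :: "'a \<Rightarrow> ennreal"
  proof -
    have [measurable]: "Y \<in> borel_measurable (vimage_algebra (space M) Y borel)"
      by (rule measurable_vimage_algebra1) auto
    show ?thesis by measurable
  qed
  have "ennreal (laplace M (\<lambda>w. I1 w + I2 w) (ennreal s)) = (\<integral>\<^sup>+w. ennreal (exp_neg (ennreal s * (I1 w + I2 w))) \<partial>M)"
    by (rule nn_integral_laplace[symmetric]) measurable
  also have "\<dots> = (\<integral>\<^sup>+w. ennreal (exp_neg (ennreal s * I1 w)) * ennreal (exp_neg (ennreal s * I2 w)) \<partial>M)"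
    by (simp only: distrib_left exp_neg_add ennreal_mult[OF exp_neg_nonneg exp_neg_nonneg])
  also have "\<dots> = (\<integral>\<^sup>+w. H L1 (RIC w) (\<beta> w) * H L2 (RIC w) (\<beta> w) \<partial>M)"
    by (rule nn_integral_cond_indep[OF prob_space_axioms subalgebra_vimage_algebra[OF pm]
          subalgebra_vimage_algebra[OF I(1)] subalgebra_vimage_algebra[OF I(2)] I1_I2 Ie Ie HF HF c1 c2]) measurable
  also have "\<dots> = (\<integral>\<^sup>+x. H L1 (fst x) (snd x) * H L2 (fst x) (snd x)
      \<partial>distr M (borel \<Otimes>\<^sub>M borel) (\<lambda>w. (RIC w, \<beta> w)))"
  proof -
    note Hm[measurable]
    show ?thesis by (subst nn_integral_distr[OF pm]) simp_all
  qed
  also have "\<dots> = (\<integral>\<^sup>+R. ennreal (R_IC_density p R1 R) *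
       (\<integral>\<^sup>+b. ennreal (indicator {0..pi} b / pi) * (H L1 R b * H L2 R b) \<partial>lborel) \<partial>lborel)"
  proof -
    have d1: "distr M borel RIC = density lborel (\<lambda>R. ennreal (R_IC_density p R1 R))"
      using distributed_distr_eq_density[OF RIC] by (simp cong: distr_cong)
    have d2: "distr M borel \<beta> = density lborel (\<lambda>b. ennreal (indicator {0..pi} b / pi))"
      using distributed_distr_eq_density[OF \<beta>] by (simp cong: distr_cong)
    interpret B: prob_space "distr M borel \<beta>" by (rule prob_space_distr) measurable
    note Hm[measurable]
    have HH: "(\<lambda>x. H L1 (fst x) (snd x) * H L2 (fst x) (snd x)) \<in> borel_measurable (borel \<Otimes>\<^sub>M borel)"
      by measurable
    have Hb [measurable]: "(\<lambda>b. H L1 R b * H L2 R b) \<in> borel_measurable borel" for R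
      using measurable_compose[OF measurable_Pair1'[of R borel borel] HH] by simp
    have "(\<integral>\<^sup>+x. H L1 (fst x) (snd x) * H L2 (fst x) (snd x) \<partial>distr M (borel \<Otimes>\<^sub>M borel) (\<lambda>w. (RIC w, \<beta> w)))
       = (\<integral>\<^sup>+x. H L1 (fst x) (snd x) * H L2 (fst x) (snd x) \<partial>(distr M borel RIC \<Otimes>\<^sub>M distr M borel \<beta>))"
      using indep_var_distribution_eq[THEN iffD1, OF RIC_\<beta>] by simp
    also have "\<dots> = (\<integral>\<^sup>+R. \<integral>\<^sup>+b. H L1 R b * H L2 R b \<partial>distr M borel \<beta> \<partial>distr M borel RIC)"
      using HH by (subst B.nn_integral_fst[symmetric]) simp_all
    also have "\<dots> = (\<integral>\<^sup>+R. ennreal (R_IC_density p R1 R) * (\<integral>\<^sup>+b. H L1 R b * H L2 R b \<partial>distr M borel \<beta>) \<partial>lborel)"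
      unfolding d1
    proof (rule nn_integral_density)
      show "(\<lambda>R. ennreal (R_IC_density p R1 R)) \<in> borel_measurable lborel"
        unfolding R_IC_density_def[abs_def] by measurable
      have "(\<lambda>R. \<integral>\<^sup>+b. (\<lambda>(R, b). H L1 R b * H L2 R b) (R, b) \<partial>distr M borel \<beta>) \<in> borel_measurable borel"
        by (rule B.borel_measurable_nn_integral_fst) (use HH in \<open>simp add: case_prod_beta\<close>)
      then show "(\<lambda>R. \<integral>\<^sup>+b. H L1 R b * H L2 R b \<partial>distr M borel \<beta>) \<in> borel_measurable lborel" by simp
    qed
    also have "(\<lambda>R. \<integral>\<^sup>+b. H L1 R b * H L2 R b \<partial>distr M borel \<beta>)
       = (\<lambda>R. \<integral>\<^sup>+b. ennreal (indicator {0..pi} b / pi) * (H L1 R b * H L2 R b) \<partial>lborel)"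
      unfolding d2 by (intro ext nn_integral_density) measurable
    finally show ?thesis .
  qed
  finally have "laplace M (\<lambda>w. I1 w + I2 w) (ennreal s) = enn2real (\<integral>\<^sup>+R. ennreal (R_IC_density p R1 R) *
       (\<integral>\<^sup>+b. ennreal (indicator {0..pi} b / pi) * (H L1 R b * H L2 R b) \<partial>lborel) \<partial>lborel)"
    using laplace_nonneg by (metis enn2real_ennreal)
  also have "\<dots> = L_IC p R1 s"
  proof (intro L_IC_eq_enn2real[OF p R1, symmetric])
    fix R b :: real assume R: "R1 \<le> R" and b: "b \<in> {0..pi}"
    then have R0: "0 \<le> R" using R1 by simp
    \<comment> \<open>Half of an angle in \<open>{0..pi}\<close> has nonnegative cosine, so the
      product of \<open>ennreal\<close> terms is the \<open>ennreal\<close> of the real product in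
      the closed form.\<close>
    have cb: "0 \<le> cos (b / 2)" using b by (intro cos_ge_zero) auto
    define t where "t r = s * cos (b / 2) * r powr (- eta_L p)" for r
    have t0: "0 \<le> t r" for r using s cb by (simp add: t_def)
    have t: "ennreal s * ennreal (cos (b / 2) * r powr (- eta_L p)) = ennreal (t r)" for r
      using s cb by (simp add: t_def ennreal_mult[symmetric] mult.assoc)
    have [measurable]: "t \<in> borel_measurable borel" unfolding t_def[abs_def] by measurable
    define \<phi>1 where "\<phi>1 r = 1 - 1 / (1 + t r * sig_t p)" for r
    define \<phi>2 where "\<phi>2 r = 1 - exp (- lam_cl p * cell_area p R1 * (t r * sig_cl p / (1 + t r * sig_cl p)))" for r
    have [measurable]: "\<phi>1 \<in> borel_measurable borel" "\<phi>2 \<in> borel_measurable borel"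
      unfolding \<phi>1_def[abs_def] \<phi>2_def[abs_def] by measurable
    have \<phi>: "1 - L1 (ennreal (t r)) = \<phi>1 r" "1 - L2 (ennreal (t r)) = \<phi>2 r" for r
      unfolding L1_def L2_def \<phi>1_def \<phi>2_def lap1[OF t0] lap2[OF t0] by simp_all
    have \<phi>0: "0 \<le> \<phi>1 r" "0 \<le> \<phi>2 r" for r
    proof -
      have "(\<lambda>w. ennreal (\<sigma> w)) \<in> borel_measurable M" by measurable
      from laplace_le_1[OF this] laplace_le_1[OF S] show "0 \<le> \<phi>1 r" "0 \<le> \<phi>2 r"
        unfolding \<phi>[symmetric] L1_def L2_def by simp_all
    qed
    have "(\<integral>\<^sup>+x. ennreal (\<phi>1 (norm x)) \<partial>outside_intensity R f)
       = ennreal (2 * pi * lam_BS p / D) * (\<integral>\<^sup>+r\<in>{R..}. ennreal (p_LOS p r * \<phi>1 r * r) \<partial>lborel)"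
      unfolding f_def[abs_def] using v D R0 p_LOS_bounds[OF p] \<phi>0
      by (intro nn_integral_outside_intensity_scaled(2)) auto
    moreover have "(\<integral>\<^sup>+x. ennreal (\<phi>2 (norm x)) \<partial>outside_intensity R f)
       = ennreal (lam_BS p / D) * (\<integral>\<^sup>+r\<in>{R..}. ennreal (p_LOS p r * \<phi>2 r * (2 * pi * r)) \<partial>lborel)"
      unfolding f_def[abs_def] using v D R0 p_LOS_bounds[OF p] \<phi>0
      by (intro nn_integral_outside_intensity_scaled(1)) auto
    ultimately have "H L1 R b * H L2 R b = ennreal (
        exp_neg (ennreal (2 * pi * lam_BS p / D) * (\<integral>\<^sup>+r\<in>{R..}. ennreal (p_LOS p r * \<phi>1 r * r) \<partial>lborel)) *
        exp_neg (ennreal (lam_BS p / D) * (\<integral>\<^sup>+r\<in>{R..}. ennreal (p_LOS p r * \<phi>2 r * (2 * pi * r)) \<partial>lborel)))"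
      by (simp only: H_def t \<phi> ennreal_mult[OF exp_neg_nonneg exp_neg_nonneg])
    then show "H L1 R b * H L2 R b = ennreal (
       exp_neg (ennreal (2 * pi * lam_BS p / real (M_div p)) *
         (\<integral>\<^sup>+ r\<in>{R..}. ennreal (p_LOS p r *
            (1 - 1 / (1 + s * cos (b / 2) * r powr (- eta_L p) * sig_t p)) * r) \<partial>lborel)) *
       exp_neg (ennreal (lam_BS p / real (M_div p)) *
         (\<integral>\<^sup>+ r\<in>{R..}. ennreal (p_LOS p r *
            (1 - exp (- lam_cl p * cell_area p R1 *
                  (s * cos (b / 2) * r powr (- eta_L p) * sig_cl p /
                    (1 + s * cos (b / 2) * r powr (- eta_L p) * sig_cl p)))) * (2 * pi * r)) \<partial>lborel)))"
      by (simp only: \<phi>1_def \<phi>2_def t_def D_def)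
  qed
  finally show ?thesis .
qed

end

section \<open>The coverage probability\<close>

theorem theorem1:
  fixes p :: params and R1 \<phi>s :: real and P :: "'w measure"
    and \<sigma>tm :: "'w \<Rightarrow> real"
    and Ncl :: "'w \<Rightarrow> enat" and Xcl :: "nat \<Rightarrow> 'w \<Rightarrow> plane" and Arm :: "plane set"
    and \<sigma>cm :: "nat \<Rightarrow> 'w \<Rightarrow> real" and S :: "'w \<Rightarrow> ennreal"
    and RIC \<beta> :: "'w \<Rightarrow> real"
    and N1 N2 :: "'w \<Rightarrow> enat" and X1 X2 :: "nat \<Rightarrow> 'w \<Rightarrow> plane"
    and \<sigma>n :: "nat \<Rightarrow> 'w \<Rightarrow> real" and Sn :: "nat \<Rightarrow> 'w \<Rightarrow> ennreal"
    and I1 I2 :: "'w \<Rightarrow> ennreal"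
    and Rd :: "'w \<Rightarrow> real"
    and NL NN :: "'w \<Rightarrow> enat" and XL XN :: "nat \<Rightarrow> 'w \<Rightarrow> plane"
    and hL hN :: "nat \<Rightarrow> 'w \<Rightarrow> real"
    and IL IN :: "'w \<Rightarrow> ennreal"
  assumes prob: "prob_space P"
    and params: "valid_params p" and R1: "R1 > 0" and \<phi>s: "\<phi>s > 0"
    \<comment> \<open>target\<close>
    and \<sigma>tm: "distributed P lborel \<sigma>tm (exponential_density (1 / sig_t p))"
    \<comment> \<open>intra-clutter\<close>
    and cl_process: "poisson_process P Ncl Xcl (density lborel (\<lambda>_. ennreal (lam_cl p)))"
    and Arm: "Arm \<in> sets borel" "emeasure lborel Arm = ennreal (cell_area p R1)"
    and \<sigma>cm_law: "\<And>i. distributed P lborel (\<sigma>cm i) (exponential_density (1 / sig_cl p))"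
    and \<sigma>cm_iid: "prob_space.indep_vars P (\<lambda>_. borel) \<sigma>cm UNIV"
    and \<sigma>cm_indep: "indep_elements P enum_space (\<lambda>\<omega>. (Ncl \<omega>, \<lambda>i. Xcl i \<omega>))
                       seq_space (\<lambda>\<omega> i. \<sigma>cm i \<omega>)"
    and S: "S = (\<lambda>\<omega>. point_sum (Ncl \<omega>) (\<lambda>i. indicator Arm (Xcl i \<omega>) * ennreal (\<sigma>cm i \<omega>)))"
    \<comment> \<open>inter-clutter; the two sums have their own interferer processes with the same conditional law,
          because sums over one common process could not be conditionally independent\<close>
    and RIC: "distributed P lborel RIC (R_IC_density p R1)"
    and \<beta>: "distributed P lborel \<beta> (\<lambda>b. ennreal (indicator {0..pi} b / pi))"
    and RIC_\<beta>: "prob_space.indep_var P borel RIC borel \<beta>"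
    and IC1_process: "cond_poisson_process P
           (vimage_algebra (space P) (\<lambda>\<omega>. (RIC \<omega>, \<beta> \<omega>)) (borel \<Otimes>\<^sub>M borel))
           N1 X1 (\<lambda>\<omega>. IC_intensity p (RIC \<omega>))"
    and IC2_process: "cond_poisson_process P
           (vimage_algebra (space P) (\<lambda>\<omega>. (RIC \<omega>, \<beta> \<omega>)) (borel \<Otimes>\<^sub>M borel))
           N2 X2 (\<lambda>\<omega>. IC_intensity p (RIC \<omega>))"
    and \<sigma>n_law: "\<And>i. distr P borel (\<sigma>n i) = distr P borel \<sigma>tm"
    and \<sigma>n_iid: "prob_space.indep_vars P (\<lambda>_. borel) \<sigma>n UNIV"
    and \<sigma>n_indep: "indep_elements P ((borel \<Otimes>\<^sub>M borel) \<Otimes>\<^sub>M enum_space)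
                      (\<lambda>\<omega>. ((RIC \<omega>, \<beta> \<omega>), (N1 \<omega>, \<lambda>i. X1 i \<omega>))) seq_space (\<lambda>\<omega> i. \<sigma>n i \<omega>)"
    and Sn_law: "\<And>i. distr P borel (Sn i) = distr P borel S"
    and Sn_iid: "prob_space.indep_vars P (\<lambda>_. borel) Sn UNIV"
    and Sn_indep: "indep_elements P ((borel \<Otimes>\<^sub>M borel) \<Otimes>\<^sub>M enum_space)
                      (\<lambda>\<omega>. ((RIC \<omega>, \<beta> \<omega>), (N2 \<omega>, \<lambda>i. X2 i \<omega>))) seq_space (\<lambda>\<omega> i. Sn i \<omega>)"
    and I1: "I1 = (\<lambda>\<omega>. point_sum (N1 \<omega>) (\<lambda>i.
               ennreal (cos (\<beta> \<omega> / 2) * norm (X1 i \<omega>) powr (- eta_L p)) * ennreal (\<sigma>n i \<omega>)))"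
    and I2: "I2 = (\<lambda>\<omega>. point_sum (N2 \<omega>) (\<lambda>i.
               ennreal (cos (\<beta> \<omega> / 2) * norm (X2 i \<omega>) powr (- eta_L p)) * Sn i \<omega>))"
    and I1_I2: "cond_indep_sets P
           (vimage_algebra (space P) (\<lambda>\<omega>. (RIC \<omega>, \<beta> \<omega>)) (borel \<Otimes>\<^sub>M borel))
           (events_of P borel I1) (events_of P borel I2)"
    \<comment> \<open>direct interference\<close>
    and Rd: "distributed P lborel Rd (R_d_density p)"
    and L_process: "cond_poisson_process P (vimage_algebra (space P) Rd borel)
           NL XL (\<lambda>\<omega>. DL_intensity p (Rd \<omega>))"
    and N_process: "cond_poisson_process P (vimage_algebra (space P) Rd borel)
           NN XN (\<lambda>\<omega>. DN_intensity p (Rd \<omega>))"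
    and L_N: "cond_indep_sets P (vimage_algebra (space P) Rd borel)
           (process_events P NL XL) (process_events P NN XN)"
    and hL_law: "\<And>i. distributed P lborel (hL i) (gamma_density (m_L p) (m_L p))"
    and hN_law: "\<And>i. distributed P lborel (hN i) (gamma_density (m_N p) (m_N p))"
    and h_iid: "prob_space.indep_vars P (\<lambda>_. borel) (case_sum hL hN) UNIV"
    and h_indep: "indep_elements P
           ((borel \<Otimes>\<^sub>M enum_space \<Otimes>\<^sub>M enum_space) \<Otimes>\<^sub>M (borel \<Otimes>\<^sub>M borel \<Otimes>\<^sub>M borel \<Otimes>\<^sub>M borel))
             (\<lambda>\<omega>. ((Rd \<omega>, (NL \<omega>, \<lambda>i. XL i \<omega>), (NN \<omega>, \<lambda>i. XN i \<omega>)), (\<sigma>tm \<omega>, S \<omega>, I1 \<omega>, I2 \<omega>)))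
           (seq_space \<Otimes>\<^sub>M seq_space) (\<lambda>\<omega>. (\<lambda>i. hL i \<omega>, \<lambda>i. hN i \<omega>))"
    and IL: "IL = (\<lambda>\<omega>. point_sum (NL \<omega>) (\<lambda>i.
               ennreal (P_c p * hL i \<omega> * (G_m p)\<^sup>2 * C_L p * norm (XL i \<omega>) powr (- eta_L p))))"
    and IN: "IN = (\<lambda>\<omega>. point_sum (NN \<omega>) (\<lambda>i.
               ennreal (P_c p * hN i \<omega> * (G_m p)\<^sup>2 * C_N p * norm (XN i \<omega>) powr (- eta_N p))))"
    \<comment> \<open>mutual independence of the four blocks\<close>
    and blocks: "prob_space.indep_sets P
           (\<lambda>j. [events_of P borel \<sigma>tm, events_of P borel S,
                 events_of P (borel \<Otimes>\<^sub>M borel) (\<lambda>\<omega>. (I1 \<omega>, I2 \<omega>)),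
                 events_of P (borel \<Otimes>\<^sub>M borel) (\<lambda>\<omega>. (IL \<omega>, IN \<omega>))] ! j) {..<4}"
  shows "measure P {\<omega> \<in> space P.
             SINR p R1 (\<sigma>tm \<omega>) (S \<omega>) (I1 \<omega>) (I2 \<omega>) (IL \<omega>) (IN \<omega>) > ennreal \<phi>s}
         = clutter_factor p R1 \<phi>s
           * L_IC p R1 (\<phi>s * R1 powr eta_L p / sig_t p)
           * exp (- (\<phi>s * (4 * pi) ^ 3 * R1 powr (2 * eta_L p) * K_B p * temp p * W_b p
                     / (P_s p * (G_m p)\<^sup>2 * (wlen p)\<^sup>2 * sig_t p)))
           * L_D p (\<phi>s * (4 * pi) ^ 3 * R1 powr (2 * eta_L p)
                     / (P_s p * (G_m p)\<^sup>2 * (wlen p)\<^sup>2 * sig_t p))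
           * exp (- (\<phi>s * (4 * pi) ^ 3 * R1 powr (2 * eta_L p) * P_c p * zeta_c p
                     / (P_s p * (G_m p)\<^sup>2 * (wlen p)\<^sup>2 * sig_t p)))"
proof -
  interpret prob_space P by (rule prob)
  have v: "0 < lam_cl p" "0 < P_s p" "0 < P_c p" "0 < G_m p" "0 < C_L p" "0 < C_N p" "0 < c_light p"
    "0 < theta_B p" "0 < W_b p" "0 < K_B p" "0 < temp p" "0 < wlen p" "0 < sig_t p" "0 < sig_cl p" "0 \<le> zeta_c p"
    using params by (simp_all add: valid_params_def)
  have [measurable]: "\<sigma>tm \<in> borel_measurable P" using distributed_measurable[OF \<sigma>tm] by simp
  have [measurable]: "\<sigma>cm i \<in> borel_measurable P" for i using distributed_measurable[OF \<sigma>cm_law] by simp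
  have [measurable]: "hL i \<in> borel_measurable P" "hN i \<in> borel_measurable P" for i
    using distributed_measurable[OF hL_law] distributed_measurable[OF hN_law] by simp_all
  have [measurable]: "RIC \<in> borel_measurable P" "\<beta> \<in> borel_measurable P" "Rd \<in> borel_measurable P"
    using distributed_measurable[OF RIC] distributed_measurable[OF \<beta>] distributed_measurable[OF Rd] by simp_all
  have [measurable]: "\<sigma>n i \<in> borel_measurable P" "Sn i \<in> borel_measurable P" for i
    using indep_vars_def[THEN iffD1, OF \<sigma>n_iid] indep_vars_def[THEN iffD1, OF Sn_iid] by blast+
  have [measurable]: "Ncl \<in> measurable P (count_space UNIV)" "Xcl i \<in> borel_measurable P" for i
    using cl_process by (auto simp: poisson_process_def)
  have [measurable]: "N1 \<in> measurable P (count_space UNIV)" "X1 i \<in> borel_measurable P" for i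
    using IC1_process by (auto simp: cond_poisson_process_def)
  have [measurable]: "N2 \<in> measurable P (count_space UNIV)" "X2 i \<in> borel_measurable P" for i
    using IC2_process by (auto simp: cond_poisson_process_def)
  have [measurable]: "NL \<in> measurable P (count_space UNIV)" "XL i \<in> borel_measurable P" for i
    using L_process by (auto simp: cond_poisson_process_def)
  have [measurable]: "NN \<in> measurable P (count_space UNIV)" "XN i \<in> borel_measurable P" for i
    using N_process by (auto simp: cond_poisson_process_def)
  note Arm(1)[measurable]
  have Sm [measurable]: "S \<in> borel_measurable P" unfolding S by measurable
  have I1m [measurable]: "I1 \<in> borel_measurable P" unfolding I1 by measurable
  have I2m [measurable]: "I2 \<in> borel_measurable P" unfolding I2 by measurable
  have ILm [measurable]: "IL \<in> borel_measurable P" unfolding IL by measurable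
  have INm [measurable]: "IN \<in> borel_measurable P" unfolding IN by measurable
  have cell: "0 \<le> cell_area p R1" using v R1 by (simp add: cell_area_def)

  have lapS: "laplace P S (ennreal t)
        = exp (- lam_cl p * cell_area p R1 * (t * sig_cl p / (1 + t * sig_cl p)))" if "0 \<le> t" for t
    unfolding S by (rule laplace_clutter[OF cl_process Arm cell _ \<sigma>cm_law _ \<sigma>cm_iid \<sigma>cm_indep that])
      (use v in simp_all)
  have lap\<sigma>: "laplace P (\<lambda>\<omega>. ennreal (\<sigma>tm \<omega>)) (ennreal t) = 1 / (1 + t * sig_t p)" if "0 \<le> t" for t
    using laplace_exponential[OF \<sigma>tm _ that] v by simp
  have lapIC: "laplace P (\<lambda>\<omega>. I1 \<omega> + I2 \<omega>) (ennreal s) = L_IC p R1 s" if s: "0 \<le> s" for s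
    by (rule laplace_inter_clutter_eq_L_IC[OF params R1 s RIC \<beta> RIC_\<beta> IC1_process IC2_process
          \<sigma>n_iid Sn_iid \<sigma>n_indep Sn_indep _ Sm \<sigma>n_law Sn_law lap\<sigma> lapS I1 I2 I1m I2m I1_I2]) measurable

  let ?W = "\<lambda>\<omega>. (Rd \<omega>, (NL \<omega>, \<lambda>i. XL i \<omega>), (NN \<omega>, \<lambda>i. XN i \<omega>))"
  have Wm: "(\<lambda>\<omega>. (?W \<omega>, (\<sigma>tm \<omega>, S \<omega>, I1 \<omega>, I2 \<omega>))) \<in> measurable P
      ((borel \<Otimes>\<^sub>M enum_space \<Otimes>\<^sub>M enum_space) \<Otimes>\<^sub>M (borel \<Otimes>\<^sub>M borel \<Otimes>\<^sub>M borel \<Otimes>\<^sub>M borel))"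
    by (intro measurable_Pair measurable_seq_space) measurable
  \<comment> \<open>The gains are independent of a larger tuple that also holds the target and the
    clutter; projection retains the radius and the two point processes.\<close>
  have ind: "indep_elements P (borel \<Otimes>\<^sub>M enum_space \<Otimes>\<^sub>M enum_space) ?W
      (seq_space \<Otimes>\<^sub>M seq_space) (\<lambda>\<omega>. (\<lambda>i. hL i \<omega>, \<lambda>i. hN i \<omega>))"
    using indep_elements_compose[OF h_indep Wm measurable_fst] by simp
  have lapD: "laplace P (\<lambda>\<omega>. IL \<omega> + IN \<omega>) (ennreal s) = L_D p s" if s: "0 \<le> s" for s
    by (rule laplace_direct_eq_L_D[OF params s Rd L_process N_process L_N hL_law hN_law h_iid ind IL IN ILm INm])

  define k where "k = kappa p * R1 powr (- 2 * eta_L p)"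
  define b where "b = kappa p * R1 powr (- eta_L p)"
  define n where "n = K_B p * temp p * W_b p"
  define e where "e = P_c p * zeta_c p"
  \<comment> \<open>The multiplier of the denominator in \<open>SINR_gt_iff\<close>. Together with
    the rate \<open>1 / sig_t p\<close> of the target it produces \<open>s\<close>, the argument of
    \<open>L_D\<close>.\<close>
  define c where "c = \<phi>s / k"
  define s where "s = \<phi>s * (4 * pi) ^ 3 * R1 powr (2 * eta_L p) / (P_s p * (G_m p)\<^sup>2 * (wlen p)\<^sup>2 * sig_t p)"
  have kap: "0 < kappa p" using v by (simp add: kappa_def)
  have k: "0 < k" using kap R1 by (simp add: k_def)
  have c: "0 < c" using k \<phi>s by (simp add: c_def)
  have pos: "0 \<le> k" "0 \<le> b" "0 \<le> n" "0 \<le> e" "0 \<le> c" "0 \<le> s"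
    using v kap k c R1 \<phi>s by (simp_all add: b_def n_def e_def s_def)
  \<comment> \<open>The direct interference has weight 1 in the denominator, so \<open>s\<close>
    keeps the full power \<open>R1 powr (2 * eta_L p)\<close>. The weight \<open>b\<close> of the
    inter-clutter lowers it to \<open>R1 powr eta_L p\<close>, and the weight \<open>k\<close> of
    the intra-clutter cancels it.\<close>
  have r2: "R1 powr (2 * eta_L p) * R1 powr (- 2 * eta_L p) = 1"
    using R1 by (simp add: powr_add[symmetric])
  have r1: "R1 powr (- eta_L p) = R1 powr (eta_L p) * R1 powr (- 2 * eta_L p)"
    by (simp add: powr_add[symmetric])
  have ck: "1 / sig_t p * c * k = \<phi>s / sig_t p" using k by (simp add: c_def)
  have cb: "1 / sig_t p * c * b = \<phi>s * R1 powr eta_L p / sig_t p"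
    using kap R1 by (simp add: c_def k_def b_def r1)
  have cs: "1 / sig_t p * c = s"
  proof -
    have "inverse (R1 powr (- 2 * eta_L p)) = R1 powr (2 * eta_L p)"
      using r2 R1 by (simp add: powr_minus)
    then have "c = \<phi>s * R1 powr (2 * eta_L p) / kappa p"
      by (simp add: c_def k_def divide_inverse mult_ac)
    then show ?thesis using v by (simp add: s_def kappa_def field_simps)
  qed

  have sk: "s * k = \<phi>s / sig_t p" using ck by (simp only: cs)
  have sb: "s * b = \<phi>s * R1 powr eta_L p / sig_t p" using cb by (simp only: cs)

  let ?Y = "\<lambda>j. [\<lambda>\<omega>. ennreal (\<sigma>tm \<omega>), S, \<lambda>\<omega>. I1 \<omega> + I2 \<omega>, \<lambda>\<omega>. IL \<omega> + IN \<omega>] ! j"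
  have Y: "?Y 0 = (\<lambda>\<omega>. ennreal (\<sigma>tm \<omega>))" "?Y 1 = S" "?Y 2 = (\<lambda>\<omega>. I1 \<omega> + I2 \<omega>)" "?Y 3 = (\<lambda>\<omega>. IL \<omega> + IN \<omega>)"
    by (simp_all add: numeral_2_eq_2 numeral_3_eq_3)
  have indY: "indep_vars (\<lambda>_. borel) ?Y {..<4}"
    by (rule indep_vars_of_blocks[OF _ Sm I1m I2m ILm INm blocks]) measurable
  have "{\<omega> \<in> space P. SINR p R1 (\<sigma>tm \<omega>) (S \<omega>) (I1 \<omega>) (I2 \<omega>) (IL \<omega>) (IN \<omega>) > ennreal \<phi>s}
     = {\<omega> \<in> space P. ennreal c * (ennreal k * ?Y 1 \<omega> + ennreal b * ?Y 2 \<omega> + ennreal n + ?Y 3 \<omega> + ennreal e)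
        < ennreal (\<sigma>tm \<omega>)}"
    unfolding SINR_gt_iff[OF params R1 \<phi>s] Y k_def b_def n_def e_def c_def by (simp only: add.assoc)
  then have "emeasure P {\<omega> \<in> space P. SINR p R1 (\<sigma>tm \<omega>) (S \<omega>) (I1 \<omega>) (I2 \<omega>) (IL \<omega>) (IN \<omega>) > ennreal \<phi>s}
     = ennreal (laplace P (?Y 1) (ennreal (1 / sig_t p * c * k))) * ennreal (laplace P (?Y 2) (ennreal (1 / sig_t p * c * b)))
      * ennreal (exp (- (1 / sig_t p * c * n))) * ennreal (laplace P (?Y 3) (ennreal (1 / sig_t p * c)))
      * ennreal (exp (- (1 / sig_t p * c * e)))"
    using prob_less_exponential_sum[OF \<sigma>tm _ indY Y(1) pos(1-5)] v by simp
  also have "\<dots> = ennreal (laplace P S (ennreal (\<phi>s / sig_t p)) * L_IC p R1 (\<phi>s * R1 powr eta_L p / sig_t p)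
      * exp (- (s * n)) * L_D p s * exp (- (s * e)))"
  proof -
    have "0 \<le> \<phi>s * R1 powr eta_L p / sig_t p" using \<phi>s v by simp
    note IC = lapIC[OF this]
    \<comment> \<open>The signs of the closed forms are read off from their being Laplace
      transforms.\<close>
    have "0 \<le> L_IC p R1 (\<phi>s * R1 powr eta_L p / sig_t p)" "0 \<le> L_D p s"
      unfolding IC[symmetric] lapD[OF pos(6), symmetric] by (rule laplace_nonneg)+
    then show ?thesis
      unfolding Y cs sk sb lapD[OF pos(6)] IC by (simp add: ennreal_mult laplace_nonneg)
  qed
  finally have "measure P {\<omega> \<in> space P. SINR p R1 (\<sigma>tm \<omega>) (S \<omega>) (I1 \<omega>) (I2 \<omega>) (IL \<omega>) (IN \<omega>) > ennreal \<phi>s}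
     = laplace P S (ennreal (\<phi>s / sig_t p)) * L_IC p R1 (\<phi>s * R1 powr eta_L p / sig_t p)
      * exp (- (s * n)) * L_D p s * exp (- (s * e))"
    unfolding measure_def
    using \<phi>s v lapIC[of "\<phi>s * R1 powr eta_L p / sig_t p", symmetric] lapD[OF pos(6), symmetric]
    by (simp add: laplace_nonneg)
  moreover have "laplace P S (ennreal (\<phi>s / sig_t p)) = clutter_factor p R1 \<phi>s"
  proof -
    have "\<phi>s / sig_t p * sig_cl p / (1 + \<phi>s / sig_t p * sig_cl p) = \<phi>s * sig_cl p / (sig_t p + \<phi>s * sig_cl p)"
      using v \<phi>s by (simp add: field_simps)
    then show ?thesis using \<phi>s v by (simp add: lapS clutter_factor_def)
  qed
  ultimately show ?thesis by (simp add: s_def n_def e_def mult.assoc)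
qed

end
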